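(* Let $T$ be a consistent first-order theory in a countable vocabulary containing a binary relation symbol $<$, and suppose $T$ satisfies the following: (A1) for every formula $\phi(x,\vec y)$ of the vocabulary, $T$ proves the well-ordering axiom $(\forall \vec y)[(\exists x)\phi(x,\vec y)\to(\exists x_0)(\phi(x_0,\vec y)\wedge(\forall x<x_0)\neg\phi(x,\vec y))]$; (A2) $T$ proves that every non-minimal element (with respect to $<$) has an immediate predecessor; (A3) $T$ proves that there is no largest element. Then for every countable ordinal $\delta<\omega_1$ there are countable models $\mathfrak{A}$ and $\mathfrak{B}$ of $T$ such that $\mathfrak{A}$ and $\mathfrak{B}$ are $\delta$-equivalent but not isomorphic.
   Context: Two structures $\mathfrak{A},\mathfrak{B}$ of the same vocabulary are $\delta$-equivalent, written $\mathfrak{A}\equiv^\delta_{\infty\omega}\mathfrak{B}$, if they satisfy the same sentences of the infinitary logic $L_{\infty\omega}$ of quantifier rank $<\delta$. Peano arithmetic and its expansions to richer vocabularies are examples of theories satisfying (A1)–(A3).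
   Formalization: It is additionally assumed that T proves < is a strict linear order; without this the claim fails, e.g. for the theory of ω with x<y read as y=x+1. Infinitary conjunctions are indexed by an arbitrary fixed set, which gives all of L_{∞ω} once that set is large enough. *)

theory Defs
  imports Main "HOL-Library.Countable_Set"
begin

record ('f, 'r) vocab =
  funs :: "'f set"
  rels :: "'r set"
  farity :: "'f \<Rightarrow> nat"
  rarity :: "'r \<Rightarrow> nat"

definition countable_vocab :: "('f, 'r) vocab \<Rightarrow> bool" where
  "countable_vocab V \<longleftrightarrow> countable (funs V) \<and> countable (rels V)"


text \<open>Variables are de Bruijn indices. Constants are function symbols of arity 0.\<close>

datatype 'f tm = Var nat | Fn 'f "'f tm list"

primrec tm_vars :: "'f tm \<Rightarrow> nat set" where
  "tm_vars (Var n) = {n}"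
| "tm_vars (Fn f ts) = \<Union> (set (map tm_vars ts))"

primrec tm_in :: "('f, 'r) vocab \<Rightarrow> 'f tm \<Rightarrow> bool" where
  "tm_in V (Var n) = True"
| "tm_in V (Fn f ts) = (f \<in> funs V \<and> length ts = farity V f \<and> list_all (tm_in V) ts)"

primrec tm_subst :: "(nat \<Rightarrow> 'f tm) \<Rightarrow> 'f tm \<Rightarrow> 'f tm" where
  "tm_subst \<sigma> (Var n) = \<sigma> n"
| "tm_subst \<sigma> (Fn f ts) = Fn f (map (tm_subst \<sigma>) ts)"

datatype ('f, 'r) fm =
    Fls
  | Eq "'f tm" "'f tm"
  | Rel 'r "'f tm list"
  | Imp "('f, 'r) fm" "('f, 'r) fm"
  | All "('f, 'r) fm"

abbreviation Neg :: "('f, 'r) fm \<Rightarrow> ('f, 'r) fm" where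
  "Neg \<phi> \<equiv> Imp \<phi> Fls"

abbreviation Con :: "('f, 'r) fm \<Rightarrow> ('f, 'r) fm \<Rightarrow> ('f, 'r) fm" where
  "Con \<phi> \<psi> \<equiv> Neg (Imp \<phi> (Neg \<psi>))"

abbreviation Dis :: "('f, 'r) fm \<Rightarrow> ('f, 'r) fm \<Rightarrow> ('f, 'r) fm" where
  "Dis \<phi> \<psi> \<equiv> Imp (Neg \<phi>) \<psi>"

abbreviation Exi :: "('f, 'r) fm \<Rightarrow> ('f, 'r) fm" where
  "Exi \<phi> \<equiv> Neg (All (Neg \<phi>))"

abbreviation Alls :: "nat \<Rightarrow> ('f, 'r) fm \<Rightarrow> ('f, 'r) fm" where
  "Alls n \<phi> \<equiv> (All ^^ n) \<phi>"

primrec fm_vars :: "('f, 'r) fm \<Rightarrow> nat set" where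
  "fm_vars Fls = {}"
| "fm_vars (Eq s t) = tm_vars s \<union> tm_vars t"
| "fm_vars (Rel r ts) = \<Union> (set (map tm_vars ts))"
| "fm_vars (Imp \<phi> \<psi>) = fm_vars \<phi> \<union> fm_vars \<psi>"
| "fm_vars (All \<phi>) = {n. Suc n \<in> fm_vars \<phi>}"

primrec fm_in :: "('f, 'r) vocab \<Rightarrow> ('f, 'r) fm \<Rightarrow> bool" where
  "fm_in V Fls = True"
| "fm_in V (Eq s t) = (tm_in V s \<and> tm_in V t)"
| "fm_in V (Rel r ts) = (r \<in> rels V \<and> length ts = rarity V r \<and> list_all (tm_in V) ts)"
| "fm_in V (Imp \<phi> \<psi>) = (fm_in V \<phi> \<and> fm_in V \<psi>)"
| "fm_in V (All \<phi>) = fm_in V \<phi>"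

definition lift_subst :: "(nat \<Rightarrow> 'f tm) \<Rightarrow> nat \<Rightarrow> 'f tm" where
  "lift_subst \<sigma> = case_nat (Var 0) (\<lambda>n. tm_subst (\<lambda>m. Var (Suc m)) (\<sigma> n))"

primrec fm_subst :: "(nat \<Rightarrow> 'f tm) \<Rightarrow> ('f, 'r) fm \<Rightarrow> ('f, 'r) fm" where
  "fm_subst \<sigma> Fls = Fls"
| "fm_subst \<sigma> (Eq s t) = Eq (tm_subst \<sigma> s) (tm_subst \<sigma> t)"
| "fm_subst \<sigma> (Rel r ts) = Rel r (map (tm_subst \<sigma>) ts)"
| "fm_subst \<sigma> (Imp \<phi> \<psi>) = Imp (fm_subst \<sigma> \<phi>) (fm_subst \<sigma> \<psi>)"
| "fm_subst \<sigma> (All \<phi>) = All (fm_subst (lift_subst \<sigma>) \<phi>)"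

definition shift :: "('f, 'r) fm \<Rightarrow> ('f, 'r) fm" where
  "shift = fm_subst (\<lambda>n. Var (Suc n))"

definition inst :: "'f tm \<Rightarrow> ('f, 'r) fm \<Rightarrow> ('f, 'r) fm" where
  "inst t = fm_subst (case_nat t Var)"


text \<open>Classical natural deduction with equality, for formulas of the vocabulary \<open>V\<close>.
  Shifting the context in \<open>AllI\<close> is the eigenvariable condition.\<close>

inductive derives :: "('f, 'r) vocab \<Rightarrow> ('f, 'r) fm set \<Rightarrow> ('f, 'r) fm \<Rightarrow> bool"
  for V :: "('f, 'r) vocab" where
  Assm: "\<phi> \<in> \<Gamma> \<Longrightarrow> fm_in V \<phi> \<Longrightarrow> derives V \<Gamma> \<phi>"
| ImpI: "fm_in V \<phi> \<Longrightarrow> derives V (insert \<phi> \<Gamma>) \<psi> \<Longrightarrow> derives V \<Gamma> (Imp \<phi> \<psi>)"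
| ImpE: "derives V \<Gamma> (Imp \<phi> \<psi>) \<Longrightarrow> derives V \<Gamma> \<phi> \<Longrightarrow> derives V \<Gamma> \<psi>"
| Contr: "fm_in V \<phi> \<Longrightarrow> derives V (insert (Neg \<phi>) \<Gamma>) Fls \<Longrightarrow> derives V \<Gamma> \<phi>"
| AllI: "derives V (shift ` \<Gamma>) \<phi> \<Longrightarrow> derives V \<Gamma> (All \<phi>)"
| AllE: "derives V \<Gamma> (All \<phi>) \<Longrightarrow> tm_in V t \<Longrightarrow> derives V \<Gamma> (inst t \<phi>)"
| EqI: "tm_in V t \<Longrightarrow> derives V \<Gamma> (Eq t t)"
| EqE: "derives V \<Gamma> (Eq s t) \<Longrightarrow> derives V \<Gamma> (inst s \<phi>) \<Longrightarrow> derives V \<Gamma> (inst t \<phi>)"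

definition is_theory :: "('f, 'r) vocab \<Rightarrow> ('f, 'r) fm set \<Rightarrow> bool" where
  "is_theory V T \<longleftrightarrow> (\<forall>\<phi>\<in>T. fm_in V \<phi> \<and> fm_vars \<phi> = {})"

definition consistent :: "('f, 'r) vocab \<Rightarrow> ('f, 'r) fm set \<Rightarrow> bool" where
  "consistent V T \<longleftrightarrow> \<not> derives V T Fls"


abbreviation Lt :: "'r \<Rightarrow> nat \<Rightarrow> nat \<Rightarrow> ('f, 'r) fm" where
  "Lt lt i j \<equiv> Rel lt [Var i, Var j]"

definition lin_irrefl_ax :: "'r \<Rightarrow> ('f, 'r) fm" where
  "lin_irrefl_ax lt = All (Neg (Lt lt 0 0))"

definition lin_trans_ax :: "'r \<Rightarrow> ('f, 'r) fm" where
  "lin_trans_ax lt = All (All (All (Imp (Con (Lt lt 2 1) (Lt lt 1 0)) (Lt lt 2 0))))"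

definition lin_total_ax :: "'r \<Rightarrow> ('f, 'r) fm" where
  "lin_total_ax lt = All (All (Dis (Lt lt 1 0) (Dis (Eq (Var 1) (Var 0)) (Lt lt 0 1))))"

text \<open>That \<open><\<close> is a linear order is implicit in calling the least element schema a well-ordering
  axiom. It does not follow from the schema: the theory of \<open>\<omega>\<close> with \<open>x < y\<close> read as
  \<open>y = x + 1\<close> satisfies it, has predecessors and no largest element, but is
  \<open>\<aleph>\<^sub>1\<close>-categorical with countable models of bounded Scott rank.\<close>

definition proves_linear :: "('f, 'r) vocab \<Rightarrow> 'r \<Rightarrow> ('f, 'r) fm set \<Rightarrow> bool" where
  "proves_linear V lt T \<longleftrightarrow>
    derives V T (lin_irrefl_ax lt) \<and> derives V T (lin_trans_ax lt) \<and> derives V T (lin_total_ax lt)"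

text \<open>In \<open>\<phi>\<close>, index 0 is \<open>x\<close> and the indices \<open>1, \<dots>, n\<close> are the parameters \<open>y\<close>. Below the
  innermost quantifier, index 0 is \<open>x\<close>, index 1 is \<open>x\<^sub>0\<close> and the parameters start at index 2,
  whence the renaming of \<open>\<phi>\<close>.\<close>

definition wo_ax :: "'r \<Rightarrow> nat \<Rightarrow> ('f, 'r) fm \<Rightarrow> ('f, 'r) fm" where
  "wo_ax lt n \<phi> =
    Alls n (Imp (Exi \<phi>)
      (Exi (Con \<phi>
        (All (Imp (Lt lt 0 1) (Neg (fm_subst (case_nat (Var 0) (\<lambda>k. Var (k + 2))) \<phi>)))))))"

definition pred_ax :: "'r \<Rightarrow> ('f, 'r) fm" where
  "pred_ax lt =
    All (Imp (Exi (Lt lt 0 1))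
      (Exi (Con (Lt lt 0 1) (Neg (Exi (Con (Lt lt 1 0) (Lt lt 0 2)))))))"

definition no_largest_ax :: "'r \<Rightarrow> ('f, 'r) fm" where
  "no_largest_ax lt = Neg (Exi (All (Dis (Lt lt 0 1) (Eq (Var 0) (Var 1)))))"


record ('f, 'r, 'u) fo_struct =
  universe :: "'u set"
  finterp :: "'f \<Rightarrow> 'u list \<Rightarrow> 'u"
  rinterp :: "'r \<Rightarrow> 'u list \<Rightarrow> bool"

definition is_struct :: "('f, 'r) vocab \<Rightarrow> ('f, 'r, 'u) fo_struct \<Rightarrow> bool" where
  "is_struct V A \<longleftrightarrow> universe A \<noteq> {} \<and>
    (\<forall>f\<in>funs V. \<forall>xs. length xs = farity V f \<longrightarrow> set xs \<subseteq> universe A \<longrightarrow> finterp A f xs \<in> universe A)"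

primrec tm_val :: "('f, 'r, 'u) fo_struct \<Rightarrow> (nat \<Rightarrow> 'u) \<Rightarrow> 'f tm \<Rightarrow> 'u" where
  "tm_val A e (Var n) = e n"
| "tm_val A e (Fn f ts) = finterp A f (map (tm_val A e) ts)"

primrec fm_sat :: "('f, 'r, 'u) fo_struct \<Rightarrow> (nat \<Rightarrow> 'u) \<Rightarrow> ('f, 'r) fm \<Rightarrow> bool" where
  "fm_sat A e Fls = False"
| "fm_sat A e (Eq s t) = (tm_val A e s = tm_val A e t)"
| "fm_sat A e (Rel r ts) = rinterp A r (map (tm_val A e) ts)"
| "fm_sat A e (Imp \<phi> \<psi>) = (fm_sat A e \<phi> \<longrightarrow> fm_sat A e \<psi>)"
| "fm_sat A e (All \<phi>) = (\<forall>a\<in>universe A. fm_sat A (case_nat a e) \<phi>)"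

definition is_model :: "('f, 'r) vocab \<Rightarrow> ('f, 'r) fm set \<Rightarrow> ('f, 'r, 'u) fo_struct \<Rightarrow> bool" where
  "is_model V T A \<longleftrightarrow> is_struct V A \<and>
    (\<forall>\<phi>\<in>T. \<forall>e. range e \<subseteq> universe A \<longrightarrow> fm_sat A e \<phi>)"

definition isomorphic ::
    "('f, 'r) vocab \<Rightarrow> ('f, 'r, 'u) fo_struct \<Rightarrow> ('f, 'r, 'v) fo_struct \<Rightarrow> bool" where
  "isomorphic V A B \<longleftrightarrow> (\<exists>h. bij_betw h (universe A) (universe B) \<and>
    (\<forall>f\<in>funs V. \<forall>xs. length xs = farity V f \<longrightarrow> set xs \<subseteq> universe A \<longrightarrow>
      h (finterp A f xs) = finterp B f (map h xs)) \<and>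
    (\<forall>r\<in>rels V. \<forall>xs. length xs = rarity V r \<longrightarrow> set xs \<subseteq> universe A \<longrightarrow>
      rinterp A r xs = rinterp B r (map h xs)))"


text \<open>Formulas of the infinitary logic \<open>L\<^sub>\<infinity>\<^sub>\<omega>\<close>: \<open>IConj I \<Phi>\<close> is the conjunction of the family
  \<open>\<Phi>\<close> over the arbitrary index set \<open>I\<close>. HOL has no type of all sets, so the type \<open>'k\<close> of indices
  is a parameter, which is to be kept universally quantified. Over structures with universe in
  a fixed type \<open>'u\<close>, all of \<open>L\<^sub>\<infinity>\<^sub>\<omega>\<close> is already obtained, up to equivalence and with no larger
  quantifier rank, when \<open>'k\<close> is the type of sets of pairs of a structure and an assignment, since
  a conjunction needs at most one conjunct for each such set of pairs.\<close>

datatype ('f, 'r, 'k) inf_fm =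
    IEq "'f tm" "'f tm"
  | IRel 'r "'f tm list"
  | INeg "('f, 'r, 'k) inf_fm"
  | IConj "'k set" "'k \<Rightarrow> ('f, 'r, 'k) inf_fm"
  | IEx "('f, 'r, 'k) inf_fm"

primrec inf_vars :: "('f, 'r, 'k) inf_fm \<Rightarrow> nat set" where
  "inf_vars (IEq s t) = tm_vars s \<union> tm_vars t"
| "inf_vars (IRel r ts) = \<Union> (set (map tm_vars ts))"
| "inf_vars (INeg \<phi>) = inf_vars \<phi>"
| "inf_vars (IConj I \<Phi>) = (\<Union>i\<in>I. inf_vars (\<Phi> i))"
| "inf_vars (IEx \<phi>) = {n. Suc n \<in> inf_vars \<phi>}"

primrec inf_in :: "('f, 'r) vocab \<Rightarrow> ('f, 'r, 'k) inf_fm \<Rightarrow> bool" where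
  "inf_in V (IEq s t) = (tm_in V s \<and> tm_in V t)"
| "inf_in V (IRel r ts) = (r \<in> rels V \<and> length ts = rarity V r \<and> list_all (tm_in V) ts)"
| "inf_in V (INeg \<phi>) = inf_in V \<phi>"
| "inf_in V (IConj I \<Phi>) = (\<forall>i\<in>I. inf_in V (\<Phi> i))"
| "inf_in V (IEx \<phi>) = inf_in V \<phi>"

primrec inf_sat :: "('f, 'r, 'u) fo_struct \<Rightarrow> (nat \<Rightarrow> 'u) \<Rightarrow> ('f, 'r, 'k) inf_fm \<Rightarrow> bool" where
  "inf_sat A e (IEq s t) = (tm_val A e s = tm_val A e t)"
| "inf_sat A e (IRel r ts) = rinterp A r (map (tm_val A e) ts)"
| "inf_sat A e (INeg \<phi>) = (\<not> inf_sat A e \<phi>)"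
| "inf_sat A e (IConj I \<Phi>) = (\<forall>i\<in>I. inf_sat A e (\<Phi> i))"
| "inf_sat A e (IEx \<phi>) = (\<exists>a\<in>universe A. inf_sat A (case_nat a e) \<phi>)"

text \<open>An ordinal \<open>\<delta>\<close> is given by a well-order, an ordinal below \<open>\<delta>\<close> by an element \<open>a\<close> of its
  field, namely as the order type of the strict predecessors of \<open>a\<close>. With
  \<open>qr (\<exists>x \<phi>) = qr \<phi> + 1\<close> and \<open>qr (\<And>\<Phi>) = sup {qr \<phi> | \<phi> \<in> \<Phi>}\<close>, the following says that the
  quantifier rank is at most \<open>a\<close>.\<close>

primrec qr_le :: "'o rel \<Rightarrow> ('f, 'r, 'k) inf_fm \<Rightarrow> 'o \<Rightarrow> bool" where
  "qr_le \<delta> (IEq s t) = (\<lambda>a. True)"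
| "qr_le \<delta> (IRel r ts) = (\<lambda>a. True)"
| "qr_le \<delta> (INeg \<phi>) = qr_le \<delta> \<phi>"
| "qr_le \<delta> (IConj I \<Phi>) = (\<lambda>a. \<forall>i\<in>I. qr_le \<delta> (\<Phi> i) a)"
| "qr_le \<delta> (IEx \<phi>) = (\<lambda>a. \<exists>b. (b, a) \<in> \<delta> - Id \<and> qr_le \<delta> \<phi> b)"

definition qr_less :: "('f, 'r, 'k) inf_fm \<Rightarrow> 'o rel \<Rightarrow> bool" where
  "qr_less \<phi> \<delta> \<longleftrightarrow> (\<exists>a\<in>Field \<delta>. qr_le \<delta> \<phi> a)"

definition inf_true :: "('f, 'r, 'u) fo_struct \<Rightarrow> ('f, 'r, 'k) inf_fm \<Rightarrow> bool" where
  "inf_true A \<phi> \<longleftrightarrow> (\<forall>e. range e \<subseteq> universe A \<longrightarrow> inf_sat A e \<phi>)"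

definition delta_equiv ::
    "'k itself \<Rightarrow> ('f, 'r) vocab \<Rightarrow> 'o rel \<Rightarrow>
      ('f, 'r, 'u) fo_struct \<Rightarrow> ('f, 'r, 'v) fo_struct \<Rightarrow> bool" where
  "delta_equiv _ V \<delta> A B \<longleftrightarrow>
    (\<forall>\<phi> :: ('f, 'r, 'k) inf_fm.
      inf_in V \<phi> \<longrightarrow> inf_vars \<phi> = {} \<longrightarrow> qr_less \<phi> \<delta> \<longrightarrow> inf_true A \<phi> = inf_true B \<phi>)"

end

theory Submission
  imports Defs Complex_Main "HOL-Library.Multiset_Order"
begin

text \<open>
  Let \<open>M\<close> be a countable model of \<open>T\<close>. The least element schema and the predecessors make a
  definable version of induction and of the pigeonhole principle available in \<open>M\<close>, and with them one
  builds, one formula after the other, a definable ultrafilter \<open>ult\<close> on the definable subsets of \<open>M\<close>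
  that contains all final segments, such that a definable function which is not constant modulo
  \<open>ult\<close> dominates, up to a definable function, the identity (\<open>ult\<close> is a minimal type, as in Gaifman's
  work on models of arithmetic). Iterating \<open>ult\<close> along a linear order \<open>L\<close> yields an elementary extension
  \<open>NN L\<close> of \<open>M\<close> generated by an increasing sequence of indiscernibles \<open>(c\<^sub>i)\<close>, \<open>i \<in> L\<close>.

  An order-preserving finite partial map between \<open>L\<close> and \<open>L'\<close> induces a partial elementary map, so
  back-and-forth systems between \<open>L\<close> and \<open>L'\<close> lift to \<open>NN L\<close> and \<open>NN L'\<close>; for \<open>L = \<omega>\<^sup>\<delta>\<close> and
  \<open>L' = \<omega>\<^bsup>\<delta>+1\<^esup>\<close> there is one of length \<open>\<delta>\<close>. On the other hand the elementary initial segments of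
  \<open>NN L\<close> above \<open>M\<close> recover \<open>L\<close>: they separate the \<open>c\<^sub>i\<close>, and every element above some \<open>c\<^sub>i\<close> lies in the same ones
  as some \<open>c\<^sub>j\<close>. Hence an isomorphism from \<open>NN L'\<close> to \<open>NN L\<close> would embed a final segment of \<open>\<omega>\<^bsup>\<delta>+1\<^esup>\<close> into \<open>\<omega>\<^sup>\<delta>\<close>.
\<close>

subsection \<open>Soundness\<close>

text \<open>\<open>T\<close> need not provide pairing or codes for finite sequences, so neither the
  parameters of a formula nor a subset of a bounded set can be packed into one element. Counting is
  replaced by agreement on boxes, treated one coordinate at a time, and definability is set up for
  relations whose argument places are indexed by an arbitrary type. The ultrafilter has to be
  definable because a set obtained with the quantifier "for \<open>ult\<close>-many
  \<open>z\<close>" must be definable before \<open>ult\<close> is applied to it again.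

  An isomorphism need not respect \<open>M\<close> or the generators \<open>c\<^sub>i\<close>. It
  does respect elementary cuts, and therefore the order is recovered from some point on only; a
  final segment of \<omega>^(\<delta>+1) still contains a copy of \<omega>^\<delta> with a point
  above it.

  One element of \<open>NN L\<close> uses finitely many indices, so a single quantifier adds a
  finite set of ordinals to the game on the indices. A position at rank a compares ordinals by
  quotient and remainder modulo \<omega>^a: remainders are equal, quotients only ordered alike.
  Lowering the rank shortens the remainders and leaves room for new quotients.\<close>

lemma tm_val_subst: "tm_val A e (tm_subst \<sigma> t) = tm_val A (\<lambda>n. tm_val A e (\<sigma> n)) t"
  by (induction t) (simp_all add: comp_def cong: map_cong)

lemma fm_sat_subst: "fm_sat A e (fm_subst \<sigma> \<phi>) = fm_sat A (\<lambda>n. tm_val A e (\<sigma> n)) \<phi>"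
proof (induction \<phi> arbitrary: \<sigma> e)
  case (All \<phi>)
  have "(\<lambda>n. tm_val A (case_nat a e) (lift_subst \<sigma> n)) = case_nat a (\<lambda>n. tm_val A e (\<sigma> n))" for a
    by (rule ext) (simp add: lift_subst_def tm_val_subst split: nat.split)
  then show ?case by (simp add: All)
qed (simp_all add: tm_val_subst comp_def)

lemma tm_val_cong: "(\<And>n. n \<in> tm_vars t \<Longrightarrow> e n = e' n) \<Longrightarrow> tm_val A e t = tm_val A e' t"
proof (induction t)
  case (Fn f ts)
  then have "map (tm_val A e) ts = map (tm_val A e') ts" by (intro map_cong) auto
  then show ?case by (metis tm_val.simps(2))
qed simp

lemma fm_sat_cong: "(\<And>n. n \<in> fm_vars \<phi> \<Longrightarrow> e n = e' n) \<Longrightarrow> fm_sat A e \<phi> = fm_sat A e' \<phi>"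
proof (induction \<phi> arbitrary: e e')
  case (Eq s t)
  then show ?case using tm_val_cong[of s e e' A] tm_val_cong[of t e e' A] by simp
next
  case (Rel r ts)
  then have "map (tm_val A e) ts = map (tm_val A e') ts" by (intro map_cong refl tm_val_cong) auto
  then show ?case by (metis fm_sat.simps(3))
next
  case (Imp \<phi> \<psi>)
  then show ?case by (metis Un_iff fm_sat.simps(4) fm_vars.simps(4))
next
  case (All \<phi>)
  have "fm_sat A (case_nat a e) \<phi> = fm_sat A (case_nat a e') \<phi>" for a
    by (rule All.IH) (use All.prems in \<open>auto split: nat.split\<close>)
  then show ?case by simp
qed simp

lemma finite_tm_vars: "finite (tm_vars t)"
  by (induction t) auto

lemma finite_fm_vars: "finite (fm_vars \<phi>)"
proof (induction \<phi>)
  case (All \<phi>)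
  have "fm_vars (All \<phi>) = Suc -` fm_vars \<phi>" by auto
  then show ?case using All by (simp add: finite_vimageI)
qed (auto simp: finite_tm_vars)

lemma tm_val_in: "is_struct V A \<Longrightarrow> tm_in V t \<Longrightarrow> range e \<subseteq> universe A \<Longrightarrow> tm_val A e t \<in> universe A"
proof (induction t)
  case (Fn f ts)
  then have "set (map (tm_val A e) ts) \<subseteq> universe A" by (auto simp: list_all_iff)
  then show ?case using Fn.prems unfolding is_struct_def by simp
qed auto

lemma case_nat_range: "a \<in> S \<Longrightarrow> range e \<subseteq> S \<Longrightarrow> range (case_nat a e) \<subseteq> S"
  by (auto split: nat.split) blast

theorem soundness:
  assumes "derives V \<Gamma> \<phi>" "is_struct V A" "range e \<subseteq> universe A"
    and "\<And>\<gamma>. \<gamma> \<in> \<Gamma> \<Longrightarrow> fm_sat A e \<gamma>"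
  shows "fm_sat A e \<phi>"
  using assms(1,3,4)
proof (induction arbitrary: e rule: derives.induct)
  case (Contr \<phi> \<Gamma>)
  then show ?case by (metis fm_sat.simps(1,4) insert_iff)
next
  case (AllI \<Gamma> \<phi>)
  have "fm_sat A (case_nat a e) \<phi>" if a: "a \<in> universe A" for a
  proof (rule AllI.IH)
    show "range (case_nat a e) \<subseteq> universe A" using a AllI.prems(1) by (rule case_nat_range)
    show "fm_sat A (case_nat a e) \<gamma>" if "\<gamma> \<in> shift ` \<Gamma>" for \<gamma>
      using that AllI.prems(2) by (auto simp: shift_def fm_sat_subst)
  qed
  then show ?case by simp
next
  case (AllE \<Gamma> \<phi> t)
  have *: "(\<lambda>n. tm_val A e (case n of 0 \<Rightarrow> t | Suc x \<Rightarrow> Var x)) = case_nat (tm_val A e t) e"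
    by (rule ext) (simp split: nat.split)
  have "tm_val A e t \<in> universe A" using AllE assms(2) by (intro tm_val_in)
  then show ?case using AllE by (simp add: inst_def fm_sat_subst *)
next
  case (EqE \<Gamma> s t \<phi>)
  have *: "(\<lambda>n. tm_val A e (case n of 0 \<Rightarrow> t | Suc x \<Rightarrow> Var x)) = case_nat (tm_val A e t) e" for t
    by (rule ext) (simp split: nat.split)
  have "tm_val A e s = tm_val A e t" using EqE by simp
  then show ?case using EqE.IH(2)[OF EqE.prems] by (simp add: inst_def fm_sat_subst *)
qed auto

lemma model_derives:
  assumes "is_model V T A" "derives V T \<phi>" "range e \<subseteq> universe A"
  shows "fm_sat A e \<phi>"
  using soundness[OF assms(2) _ assms(3)] assms(1,3) unfolding is_model_def by blast

subsection \<open>Completeness\<close>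

lemma tm_subst_subst: "tm_subst \<sigma> (tm_subst \<tau> t) = tm_subst (\<lambda>n. tm_subst \<sigma> (\<tau> n)) t"
  by (induction t) auto

lemma tm_subst_Var [simp]: "tm_subst Var t = t"
  by (induction t) (auto simp: map_idI)

lemma tm_subst_cong: "(\<And>n. n \<in> tm_vars t \<Longrightarrow> \<sigma> n = \<tau> n) \<Longrightarrow> tm_subst \<sigma> t = tm_subst \<tau> t"
  by (induction t) auto

lemma lift_subst_simps [simp]:
  "lift_subst \<sigma> 0 = Var 0" "lift_subst \<sigma> (Suc n) = tm_subst (\<lambda>m. Var (Suc m)) (\<sigma> n)"
  by (simp_all add: lift_subst_def)

lemma lift_subst_comp:
  "tm_subst (lift_subst \<sigma>) (lift_subst \<tau> n) = lift_subst (\<lambda>n. tm_subst \<sigma> (\<tau> n)) n"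
  by (cases n) (simp_all add: tm_subst_subst)

lemma fm_subst_subst: "fm_subst \<sigma> (fm_subst \<tau> \<phi>) = fm_subst (\<lambda>n. tm_subst \<sigma> (\<tau> n)) \<phi>"
  by (induction \<phi> arbitrary: \<sigma> \<tau>) (simp_all add: tm_subst_subst lift_subst_comp)

lemma lift_subst_Var [simp]: "lift_subst Var = Var"
  by (rule ext) (simp add: lift_subst_def split: nat.split)

lemma fm_subst_Var [simp]: "fm_subst Var \<phi> = \<phi>"
  by (induction \<phi>) (simp_all add: map_idI)

lemma fm_subst_cong: "(\<And>n. n \<in> fm_vars \<phi> \<Longrightarrow> \<sigma> n = \<tau> n) \<Longrightarrow> fm_subst \<sigma> \<phi> = fm_subst \<tau> \<phi>"
proof (induction \<phi> arbitrary: \<sigma> \<tau>)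
  case (Eq s t)
  have "tm_subst \<sigma> s = tm_subst \<tau> s" by (rule tm_subst_cong) (rule Eq.prems, simp)
  moreover have "tm_subst \<sigma> t = tm_subst \<tau> t" by (rule tm_subst_cong) (rule Eq.prems, simp)
  ultimately show ?case by (simp only: fm_subst.simps)
next
  case (Rel r ts)
  have "map (tm_subst \<sigma>) ts = map (tm_subst \<tau>) ts"
    by (rule map_cong[OF refl], rule tm_subst_cong, rule Rel.prems) auto
  then show ?case by (simp only: fm_subst.simps)
next
  case (Imp \<phi> \<psi>)
  have "fm_subst \<sigma> \<phi> = fm_subst \<tau> \<phi>" by (rule Imp.IH(1), rule Imp.prems) simp
  moreover have "fm_subst \<sigma> \<psi> = fm_subst \<tau> \<psi>" by (rule Imp.IH(2), rule Imp.prems) simp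
  ultimately show ?case by (simp only: fm_subst.simps)
next
  case (All \<phi>)
  have *: "lift_subst \<sigma> n = lift_subst \<tau> n" if "n \<in> fm_vars \<phi>" for n
  proof (cases n)
    case (Suc m)
    then have "\<sigma> m = \<tau> m" using that by (intro All.prems) simp
    then show ?thesis using Suc by simp
  qed simp
  have "fm_subst (lift_subst \<sigma>) \<phi> = fm_subst (lift_subst \<tau>) \<phi>" by (rule All.IH) (rule *)
  then show ?case by (simp only: fm_subst.simps)
qed simp

lemma tm_in_subst: "tm_in V t \<Longrightarrow> (\<And>n. tm_in V (\<sigma> n)) \<Longrightarrow> tm_in V (tm_subst \<sigma> t)"
  by (induction t) (simp_all add: list_all_iff)

lemma fm_in_subst: "fm_in V \<phi> \<Longrightarrow> (\<And>n. tm_in V (\<sigma> n)) \<Longrightarrow> fm_in V (fm_subst \<sigma> \<phi>)"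
proof (induction \<phi> arbitrary: \<sigma>)
  case (All \<phi>)
  have "tm_in V (lift_subst \<sigma> n)" for n
    by (cases n) (simp_all add: tm_in_subst All.prems)
  then show ?case using All by simp
qed (simp_all add: list_all_iff tm_in_subst)

lemma fm_subst_inst: "fm_subst \<sigma> (inst t \<phi>) = inst (tm_subst \<sigma> t) (fm_subst (lift_subst \<sigma>) \<phi>)"
proof -
  have "tm_subst \<sigma> (case_nat t Var n) =
      tm_subst (case_nat (tm_subst \<sigma> t) Var) (lift_subst \<sigma> n)" for n
    by (cases n) (simp_all add: tm_subst_subst)
  then show ?thesis by (simp add: inst_def fm_subst_subst)
qed

lemma fm_subst_shift: "fm_subst (lift_subst \<sigma>) (shift \<phi>) = shift (fm_subst \<sigma> \<phi>)"
  unfolding shift_def fm_subst_subst by simp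

section \<open>Weakening, finiteness and renaming of derivations\<close>

lemma derives_mono: "derives V \<Gamma> \<phi> \<Longrightarrow> \<Gamma> \<subseteq> \<Delta> \<Longrightarrow> derives V \<Delta> \<phi>"
proof (induction arbitrary: \<Delta> rule: derives.induct)
  case (Assm \<phi> \<Gamma>)
  then show ?case by (meson derives.Assm subsetD)
next
  case (ImpI \<phi> \<Gamma> \<psi>)
  show ?case by (rule derives.ImpI[OF ImpI.hyps(1)], rule ImpI.IH) (use ImpI.prems in auto)
next
  case (ImpE \<Gamma> \<phi> \<psi>)
  show ?case by (rule derives.ImpE; rule ImpE.IH ImpE.IH(2); rule ImpE.prems)
next
  case (Contr \<phi> \<Gamma>)
  show ?case by (rule derives.Contr[OF Contr.hyps(1)], rule Contr.IH) (use Contr.prems in auto)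
next
  case (AllI \<Gamma> \<phi>)
  show ?case by (rule derives.AllI, rule AllI.IH) (use AllI.prems in auto)
next
  case (AllE \<Gamma> \<phi> t)
  show ?case by (rule derives.AllE[OF AllE.IH AllE.hyps(2)]) (rule AllE.prems)
next
  case (EqI t \<Gamma>)
  show ?case by (rule derives.EqI[OF EqI.hyps])
next
  case (EqE \<Gamma> s t \<phi>)
  show ?case by (rule derives.EqE[OF EqE.IH]; rule EqE.prems)
qed

lemma derives_finite: "derives V \<Gamma> \<phi> \<Longrightarrow> \<exists>\<Delta>\<subseteq>\<Gamma>. finite \<Delta> \<and> derives V \<Delta> \<phi>"
proof (induction rule: derives.induct)
  case (Assm \<phi> \<Gamma>)
  then show ?case by (intro exI[of _ "{\<phi>}"]) (simp add: derives.Assm)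
next
  case (ImpI \<phi> \<Gamma> \<psi>)
  then obtain \<Delta> where \<Delta>: "\<Delta> \<subseteq> insert \<phi> \<Gamma>" "finite \<Delta>" "derives V \<Delta> \<psi>" by auto
  have "derives V (\<Delta> - {\<phi>}) (Imp \<phi> \<psi>)"
    by (rule derives.ImpI[OF ImpI.hyps(1)], rule derives_mono[OF \<Delta>(3)]) auto
  then show ?case using \<Delta> by (intro exI[of _ "\<Delta> - {\<phi>}"]) auto
next
  case (Contr \<phi> \<Gamma>)
  then obtain \<Delta> where \<Delta>: "\<Delta> \<subseteq> insert (Neg \<phi>) \<Gamma>" "finite \<Delta>" "derives V \<Delta> Fls" by auto
  have "derives V (\<Delta> - {Neg \<phi>}) \<phi>"
    by (rule derives.Contr[OF Contr.hyps(1)], rule derives_mono[OF \<Delta>(3)]) auto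
  then show ?case using \<Delta> by (intro exI[of _ "\<Delta> - {Neg \<phi>}"]) auto
next
  case (ImpE \<Gamma> \<phi> \<psi>)
  then obtain \<Delta> \<Delta>' where \<Delta>: "\<Delta> \<subseteq> \<Gamma>" "finite \<Delta>" "derives V \<Delta> (Imp \<phi> \<psi>)"
    "\<Delta>' \<subseteq> \<Gamma>" "finite \<Delta>'" "derives V \<Delta>' \<phi>" by auto
  have "derives V (\<Delta> \<union> \<Delta>') \<psi>"
    by (rule derives.ImpE[OF derives_mono[OF \<Delta>(3)] derives_mono[OF \<Delta>(6)]]) auto
  then show ?case using \<Delta> by (intro exI[of _ "\<Delta> \<union> \<Delta>'"]) auto
next
  case (EqE \<Gamma> s t \<phi>)
  then obtain \<Delta> \<Delta>' where \<Delta>: "\<Delta> \<subseteq> \<Gamma>" "finite \<Delta>" "derives V \<Delta> (Eq s t)"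
    "\<Delta>' \<subseteq> \<Gamma>" "finite \<Delta>'" "derives V \<Delta>' (inst s \<phi>)" by auto
  have "derives V (\<Delta> \<union> \<Delta>') (inst t \<phi>)"
    by (rule derives.EqE[OF derives_mono[OF \<Delta>(3)] derives_mono[OF \<Delta>(6)]]) auto
  then show ?case using \<Delta> by (intro exI[of _ "\<Delta> \<union> \<Delta>'"]) auto
next
  case (AllI \<Gamma> \<phi>)
  then obtain \<Delta> where \<Delta>: "\<Delta> \<subseteq> shift ` \<Gamma>" "finite \<Delta>" "derives V \<Delta> \<phi>" by auto
  then obtain \<Delta>' where \<Delta>': "\<Delta>' \<subseteq> \<Gamma>" "finite \<Delta>'" "\<Delta> = shift ` \<Delta>'"
    by (meson finite_subset_image)
  have "derives V \<Delta>' (All \<phi>)" by (rule derives.AllI) (use \<Delta>(3) \<Delta>'(3) in simp)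
  then show ?case using \<Delta>' by auto
next
  case (AllE \<Gamma> \<phi> t)
  then obtain \<Delta> where "\<Delta> \<subseteq> \<Gamma>" "finite \<Delta>" "derives V \<Delta> (All \<phi>)" by auto
  then show ?case using derives.AllE[OF _ AllE.hyps(2)] by meson
next
  case (EqI t \<Gamma>)
  then show ?case by (intro exI[of _ "{}"]) (simp add: derives.EqI)
qed

lemma derives_subst:
  "derives V \<Gamma> \<phi> \<Longrightarrow> (\<And>n. tm_in V (\<sigma> n)) \<Longrightarrow> derives V (fm_subst \<sigma> ` \<Gamma>) (fm_subst \<sigma> \<phi>)"
proof (induction arbitrary: \<sigma> rule: derives.induct)
  case (AllI \<Gamma> \<phi>)
  have "tm_in V (lift_subst \<sigma> n)" for n
    by (cases n) (auto intro: tm_in_subst AllI.prems)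
  then have "derives V (fm_subst (lift_subst \<sigma>) ` shift ` \<Gamma>) (fm_subst (lift_subst \<sigma>) \<phi>)"
    by (rule AllI.IH)
  also have "fm_subst (lift_subst \<sigma>) ` shift ` \<Gamma> = shift ` fm_subst \<sigma> ` \<Gamma>"
    by (simp add: image_image fm_subst_shift)
  finally show ?case by (simp add: derives.AllI)
next
  case (AllE \<Gamma> \<phi> t)
  then show ?case by (simp add: fm_subst_inst derives.AllE tm_in_subst)
next
  case (EqE \<Gamma> s t \<phi>)
  have "derives V (fm_subst \<sigma> ` \<Gamma>) (Eq (tm_subst \<sigma> s) (tm_subst \<sigma> t))"
    using EqE.IH(1)[OF EqE.prems] by simp
  then show ?case
    using EqE.IH(2)[OF EqE.prems] unfolding fm_subst_inst by (rule derives.EqE)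
next
  case (ImpE \<Gamma> \<phi> \<psi>)
  have "derives V (fm_subst \<sigma> ` \<Gamma>) (Imp (fm_subst \<sigma> \<phi>) (fm_subst \<sigma> \<psi>))"
    using ImpE.IH(1)[OF ImpE.prems] by simp
  then show ?case using ImpE.IH(2)[OF ImpE.prems] by (rule derives.ImpE)
next
  case (Assm \<phi> \<Gamma>)
  then show ?case by (simp add: derives.Assm fm_in_subst)
next
  case (ImpI \<phi> \<Gamma> \<psi>)
  then show ?case by (simp add: derives.ImpI fm_in_subst)
next
  case (Contr \<phi> \<Gamma>)
  then show ?case by (simp add: derives.Contr fm_in_subst)
next
  case (EqI t \<Gamma>)
  then show ?case by (simp add: derives.EqI tm_in_subst)
qed

text \<open>In \<open>AllI\<close> the eigenvariable is index 0. The substitution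
  \<open>\<sigma>\<close> moves \<open>k\<close> to 0 and shifts the rest; where \<open>k\<close> is
  absent it acts as \<open>shift\<close>, and on \<open>inst (Var k) \<psi>\<close> it restores
  \<open>\<psi>\<close>. Below the binder \<open>k\<close> reads \<open>Suc k\<close>, whence the
  last hypothesis.\<close>

lemma derives_generalize:
  assumes "derives V \<Gamma> (inst (Var k) \<psi>)" "\<And>\<gamma>. \<gamma> \<in> \<Gamma> \<Longrightarrow> k \<notin> fm_vars \<gamma>" "Suc k \<notin> fm_vars \<psi>"
  shows "derives V \<Gamma> (All \<psi>)"
proof -
  define \<sigma> :: "nat \<Rightarrow> 'a tm" where "\<sigma> n = (if n = k then Var 0 else Var (Suc n))" for n
  have "derives V (fm_subst \<sigma> ` \<Gamma>) (fm_subst \<sigma> (inst (Var k) \<psi>))"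
    by (rule derives_subst[OF assms(1)]) (simp add: \<sigma>_def)
  moreover have "fm_subst \<sigma> \<gamma> = shift \<gamma>" if "\<gamma> \<in> \<Gamma>" for \<gamma>
    unfolding shift_def by (rule fm_subst_cong) (use assms(2)[OF that] in \<open>auto simp: \<sigma>_def\<close>)
  moreover have "fm_subst \<sigma> (inst (Var k) \<psi>) = fm_subst Var \<psi>"
    unfolding inst_def fm_subst_subst
    by (rule fm_subst_cong) (use assms(3) in \<open>auto simp: \<sigma>_def split: nat.split\<close>)
  ultimately have "derives V (shift ` \<Gamma>) \<psi>" by (simp cong: image_cong)
  then show ?thesis by (rule derives.AllI)
qed

text \<open>Free variables serve as Henkin constants: the members of \<open>T\<close> are closed and
  \<open>F\<close> is finite, so a fresh \<open>k\<close> is always at hand and the vocabulary stays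
  fixed. If \<open>\<phi>\<close> cannot be added, \<open>Neg \<phi>\<close> is derivable; a
  contradiction from the witness \<open>Neg (inst (Var k) \<psi>)\<close> would generalize to
  \<open>All \<psi>\<close>.\<close>

lemma henkin_step:
  assumes T: "\<And>\<gamma>. \<gamma> \<in> T \<Longrightarrow> fm_vars \<gamma> = {}" and F: "finite F" "consistent V (T \<union> F)"
    and \<phi>: "fm_in V \<phi>"
  shows "\<exists>F'. finite F' \<and> F \<subseteq> F' \<and> consistent V (T \<union> F') \<and>
    (\<phi> \<in> F' \<or> Neg \<phi> \<in> F' \<and> (\<forall>\<psi>. \<phi> = All \<psi> \<longrightarrow> (\<exists>k. Neg (inst (Var k) \<psi>) \<in> F')))"
proof (cases "consistent V (T \<union> insert \<phi> F)")
  case True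
  then show ?thesis using F by (intro exI[of _ "insert \<phi> F"]) auto
next
  case False
  then have "derives V (insert \<phi> (T \<union> F)) Fls" by (simp add: consistent_def)
  then have neg: "derives V (T \<union> F) (Neg \<phi>)" using \<phi> by (intro derives.ImpI)
  have cons: "consistent V (T \<union> insert (Neg \<phi>) F)"
  proof (rule ccontr)
    assume "\<not> ?thesis"
    then have "derives V (T \<union> F) \<phi>" using \<phi> by (auto simp: consistent_def intro: derives.Contr[OF \<phi>])
    then show False using neg F(2) derives.ImpE unfolding consistent_def by meson
  qed
  show ?thesis
  proof (cases "\<exists>\<psi>. \<phi> = All \<psi>")
    case False
    then show ?thesis using F cons by (intro exI[of _ "insert (Neg \<phi>) F"]) auto
  next
    case True
    then obtain \<psi> where \<psi>: "\<phi> = All \<psi>" by blast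
    have "finite ((\<Union>\<gamma>\<in>F. fm_vars \<gamma>) \<union> fm_vars (All \<psi>))"
      using F finite_fm_vars by blast
    then obtain k where k: "k \<notin> (\<Union>\<gamma>\<in>F. fm_vars \<gamma>) \<union> fm_vars (All \<psi>)"
      using ex_new_if_finite infinite_UNIV_nat by blast
    let ?F = "insert (Neg (inst (Var k) \<psi>)) (insert (Neg \<phi>) F)"
    have in': "fm_in V (inst (Var k) \<psi>)"
      using \<phi> unfolding \<psi> inst_def by (auto intro!: fm_in_subst split: nat.split)
    have "consistent V (T \<union> ?F)"
    proof (rule ccontr)
      assume "\<not> ?thesis"
      then have "derives V (T \<union> insert (Neg \<phi>) F) (inst (Var k) \<psi>)"
        by (auto simp: consistent_def intro: derives.Contr[OF in'])
      then have "derives V (T \<union> insert (Neg \<phi>) F) (All \<psi>)"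
        by (rule derives_generalize) (use k T \<psi> in auto)
      then have "derives V (T \<union> F) \<phi>"
        using derives.Contr[OF \<phi>] derives.ImpE[OF derives.Assm[of "Neg \<phi>"]] \<phi> \<psi>
        by (metis UnCI Un_insert_right fm_in.simps(1,4) insertI1)
      then show False using neg F(2) derives.ImpE unfolding consistent_def by meson
    qed
    then show ?thesis using F \<psi> by (intro exI[of _ ?F]) auto
  qed
qed

section \<open>Countability of the language\<close>

instance tm :: (countable) countable by countable_datatype
instance fm :: (countable, countable) countable by countable_datatype

lemma tm_in_symbols: "tm_in V t \<Longrightarrow> set_tm t \<subseteq> funs V"
  by (induction t) (auto simp: list_all_iff)

lemma fm_in_symbols: "fm_in V \<phi> \<Longrightarrow> set1_fm \<phi> \<subseteq> funs V \<and> set2_fm \<phi> \<subseteq> rels V"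
  by (induction \<phi>) (auto simp: list_all_iff dest: tm_in_symbols)

text \<open>The types of symbols may be uncountable. Renaming the symbols of \<open>V\<close> by
  numbers is injective on formulas of \<open>V\<close>, and formulas over numerical symbols are
  countable.\<close>

lemma countable_fm_in:
  assumes "countable_vocab V"
  shows "countable {\<phi> :: ('f, 'r) fm. fm_in V \<phi>}"
proof -
  let ?f = "map_fm (to_nat_on (funs V)) (to_nat_on (rels V))"
  have "inj_on ?f {\<phi>. fm_in V \<phi>}"
  proof (rule inj_onI)
    fix \<phi> \<psi> :: "('f, 'r) fm" assume *: "\<phi> \<in> {\<phi>. fm_in V \<phi>}" "\<psi> \<in> {\<phi>. fm_in V \<phi>}" "?f \<phi> = ?f \<psi>"
    have i: "inj_on (to_nat_on (funs V)) (funs V)" "inj_on (to_nat_on (rels V)) (rels V)"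
      using assms by (auto simp: countable_vocab_def)
    show "\<phi> = \<psi>"
      by (rule fm.inj_map_strong[OF _ _ *(3)]) (use *(1,2) fm_in_symbols i in \<open>blast dest: inj_onD\<close>)+
  qed
  then show ?thesis by (rule countableI')
qed

lemma countable_tm_in:
  assumes "countable_vocab V"
  shows "countable {t :: 'f tm. tm_in (V :: ('f, 'r) vocab) t}"
proof -
  have "inj_on (\<lambda>t. Eq t t :: ('f, 'r) fm) {t. tm_in V t}" by (auto simp: inj_on_def)
  moreover have "countable ((\<lambda>t. Eq t t :: ('f, 'r) fm) ` {t. tm_in V t})"
    by (rule countable_subset[OF _ countable_fm_in[OF assms]]) auto
  ultimately show ?thesis by (rule countable_image_inj_on[rotated])
qed

section \<open>The term model of a complete set with witnesses\<close>

locale henkin =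
  fixes V :: "('f, 'r) vocab" and \<Gamma> :: "('f, 'r) fm set"
  assumes cons: "\<not> derives V \<Gamma> Fls"
    and complete: "fm_in V \<phi> \<Longrightarrow> derives V \<Gamma> \<phi> \<or> derives V \<Gamma> (Neg \<phi>)"
    and witness: "fm_in V (All \<psi>) \<Longrightarrow> \<not> derives V \<Gamma> (All \<psi>) \<Longrightarrow> \<exists>k. \<not> derives V \<Gamma> (inst (Var k) \<psi>)"
begin

abbreviation prv :: "('f, 'r) fm \<Rightarrow> bool" where "prv \<equiv> derives V \<Gamma>"

lemma prv_Imp:
  assumes "fm_in V \<phi>" "fm_in V \<psi>"
  shows "prv (Imp \<phi> \<psi>) \<longleftrightarrow> (prv \<phi> \<longrightarrow> prv \<psi>)"
proof
  assume "prv (Imp \<phi> \<psi>)"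
  then show "prv \<phi> \<longrightarrow> prv \<psi>" using derives.ImpE by blast
next
  assume *: "prv \<phi> \<longrightarrow> prv \<psi>"
  show "prv (Imp \<phi> \<psi>)"
  proof (cases "prv \<psi>")
    case True
    show ?thesis by (rule derives.ImpI[OF assms(1)], rule derives_mono[OF True]) auto
  next
    case False
    then have neg: "prv (Neg \<phi>)" using * complete assms by blast
    show ?thesis
    proof (rule derives.ImpI[OF assms(1)], rule derives.Contr[OF assms(2)], rule derives.ImpE)
      show "derives V (insert (Neg \<psi>) (insert \<phi> \<Gamma>)) (Neg \<phi>)" by (rule derives_mono[OF neg]) auto
      show "derives V (insert (Neg \<psi>) (insert \<phi> \<Gamma>)) \<phi>" by (rule derives.Assm) (use assms in auto)
    qed
  qed
qed

text \<open>\<open>EqE\<close> acts on index 0 only. The formula with a hole is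
  \<open>\<phi>\<close> with variable \<open>n\<close> sent to index 0 and every other substituted
  term shifted past it, so that filling the hole with \<open>s\<close> gives
  \<open>\<sigma>(n := s)\<close>.\<close>

lemma prv_replace:
  assumes "prv (fm_subst \<sigma> \<phi>)" "prv (Eq (\<sigma> n) t)"
  shows "prv (fm_subst (\<sigma>(n := t)) \<phi>)"
proof -
  let ?\<phi> = "fm_subst (\<lambda>m. if m = n then Var 0 else tm_subst (\<lambda>k. Var (Suc k)) (\<sigma> m)) \<phi>"
  have *: "inst s ?\<phi> = fm_subst (\<sigma>(n := s)) \<phi>" for s
    unfolding inst_def fm_subst_subst by (rule fm_subst_cong) (simp add: tm_subst_subst)
  have "prv (inst (\<sigma> n) ?\<phi>)" using assms(1) unfolding * by simp
  from derives.EqE[OF assms(2) this] show ?thesis unfolding * .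
qed

lemma prv_replace_finite:
  assumes "finite S" "prv (fm_subst \<sigma> \<phi>)" "\<And>n. n \<in> S \<Longrightarrow> prv (Eq (\<sigma> n) (\<tau> n))"
  shows "prv (fm_subst (\<lambda>n. if n \<in> S then \<tau> n else \<sigma> n) \<phi>)"
  using assms(1,3)
proof (induction S)
  case empty
  then show ?case using assms(2) by simp
next
  case (insert n S)
  let ?\<sigma> = "\<lambda>m. if m \<in> S then \<tau> m else \<sigma> m"
  have "prv (fm_subst (?\<sigma>(n := \<tau> n)) \<phi>)"
    by (rule prv_replace) (use insert in auto)
  moreover have "?\<sigma>(n := \<tau> n) = (\<lambda>m. if m \<in> insert n S then \<tau> m else \<sigma> m)" by auto
  ultimately show ?case by simp
qed

lemma prv_replace_list:
  assumes "length ts = l" "length us = l" "\<And>i. i < l \<Longrightarrow> prv (Eq (ts ! i) (us ! i))"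
    and "prv (fm_subst (\<lambda>n. if n < l then ts ! n else Var n) \<phi>)"
  shows "prv (fm_subst (\<lambda>n. if n < l then us ! n else Var n) \<phi>)"
proof -
  have "prv (fm_subst (\<lambda>n. if n \<in> {..<l} then (\<lambda>n. us ! n) n else (if n < l then ts ! n else Var n)) \<phi>)"
    by (rule prv_replace_finite) (use assms in auto)
  moreover have "(\<lambda>n. if n \<in> {..<l} then (\<lambda>n. us ! n) n else (if n < l then ts ! n else Var n)) =
      (\<lambda>n. if n < l then us ! n else Var n)" by auto
  ultimately show ?thesis by simp
qed

lemma prv_Fn_cong:
  assumes "length us = length ts" "\<And>i. i < length ts \<Longrightarrow> prv (Eq (ts ! i) (us ! i))" "tm_in V (Fn f ts)"
  shows "prv (Eq (Fn f ts) (Fn f us))"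
proof -
  let ?l = "length ts"
  \<comment> \<open>Two disjoint blocks of variables: starting from the reflexive instance for
    \<open>ts\<close>, only the second block is rewritten to \<open>us\<close>.\<close>
  let ?\<phi> = "Eq (Fn f (map Var [0..<?l])) (Fn f (map Var [?l..<2 * ?l]))"
  have *: "fm_subst (\<lambda>n. if n < 2 * ?l then (ts @ vs) ! n else Var n) ?\<phi> = Eq (Fn f ts) (Fn f vs)"
    if "length vs = ?l" for vs
    using that by (auto intro!: nth_equalityI simp: nth_append)
  have "prv (fm_subst (\<lambda>n. if n < 2 * ?l then (ts @ us) ! n else Var n) ?\<phi>)"
  proof (rule prv_replace_list[where ts = "ts @ ts"])
    show "prv (Eq ((ts @ ts) ! i) ((ts @ us) ! i))" if "i < 2 * ?l" for i
    proof (cases "i < ?l")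
      case True
      then show ?thesis using assms(3) by (auto simp: nth_append list_all_length intro: derives.EqI)
    qed (use assms(2)[of "i - ?l"] that in \<open>auto simp: nth_append\<close>)
    show "prv (fm_subst (\<lambda>n. if n < 2 * ?l then (ts @ ts) ! n else Var n) ?\<phi>)"
      using *[of ts] derives.EqI[OF assms(3)] by simp
  qed (use assms in auto)
  then show ?thesis using *[OF assms(1)] by simp
qed

lemma prv_Rel_cong:
  assumes "length us = length ts" "\<And>i. i < length ts \<Longrightarrow> prv (Eq (ts ! i) (us ! i))" "prv (Rel r ts)"
  shows "prv (Rel r us)"
proof -
  let ?l = "length ts"
  have *: "fm_subst (\<lambda>n. if n < ?l then vs ! n else Var n) (Rel r (map Var [0..<?l])) = Rel r vs"
    if "length vs = ?l" for vs using that by (auto intro!: nth_equalityI)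
  show ?thesis
    using prv_replace_list[OF refl assms(1,2), of "Rel r (map Var [0..<?l])"] assms(3)
    unfolding *[OF assms(1)] *[OF refl] by blast
qed

lemma prv_sym: "tm_in V s \<Longrightarrow> prv (Eq s t) \<Longrightarrow> prv (Eq t s)"
  using prv_replace[of "Var(0 := s, 1 := s)" "Eq (Var 0) (Var 1)" 0 t] derives.EqI[of V s \<Gamma>] by simp

lemma prv_trans: "prv (Eq r s) \<Longrightarrow> prv (Eq s t) \<Longrightarrow> prv (Eq r t)"
  using prv_replace[of "Var(0 := r, 1 := s)" "Eq (Var 0) (Var 1)" 1 t] by simp

text \<open>Representatives in place of classes keep the universe inside the type of terms. The
  choice depends only on the class of \<open>t\<close>, since provably equal terms satisfy the same
  predicate.\<close>

definition rep :: "'f tm \<Rightarrow> 'f tm" where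
  "rep t = (SOME s. tm_in V s \<and> prv (Eq t s))"

lemma rep: "tm_in V t \<Longrightarrow> tm_in V (rep t) \<and> prv (Eq t (rep t))"
  unfolding rep_def by (rule someI[of _ t]) (simp add: derives.EqI)

lemma rep_eq_iff: "tm_in V s \<Longrightarrow> tm_in V t \<Longrightarrow> rep s = rep t \<longleftrightarrow> prv (Eq s t)"
proof
  assume "tm_in V s" "tm_in V t" "rep s = rep t"
  then show "prv (Eq s t)" using rep[of s] rep[of t] prv_sym prv_trans by metis
next
  assume st: "tm_in V s" "tm_in V t" "prv (Eq s t)"
  have "prv (Eq s u) \<longleftrightarrow> prv (Eq t u)" for u
    using st prv_sym prv_trans by blast
  then show "rep s = rep t" by (simp add: rep_def)
qed

definition term_model :: "('f, 'r, 'f tm) fo_struct" where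
  "term_model = \<lparr>universe = rep ` {t. tm_in V t}, finterp = (\<lambda>f ts. rep (Fn f ts)),
    rinterp = (\<lambda>r ts. prv (Rel r ts))\<rparr>"

lemma term_model_simps [simp]:
  "finterp term_model f ts = rep (Fn f ts)" "rinterp term_model r ts = prv (Rel r ts)"
  by (simp_all add: term_model_def)

lemma universe_in: "a \<in> universe term_model \<Longrightarrow> tm_in V a \<and> rep a = a"
proof -
  assume "a \<in> universe term_model"
  then obtain t where t: "tm_in V t" "a = rep t" by (auto simp: term_model_def)
  then have "prv (Eq a t)" using rep[of t] prv_sym by blast
  then show ?thesis using t rep[of t] rep_eq_iff[of a t] by blast
qed

lemma rep_in: "tm_in V t \<Longrightarrow> rep t \<in> universe term_model"
  by (auto simp: term_model_def)

lemma tm_val_term_model: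
  assumes e: "\<And>n. e n \<in> universe term_model"
  shows "tm_in V t \<Longrightarrow> tm_val term_model e t = rep (tm_subst e t)"
proof (induction t)
  case (Var n)
  then show ?case using universe_in[OF e, of n] by simp
next
  case (Fn f ts)
  let ?ts = "map (tm_subst e) ts" and ?us = "map (\<lambda>t. rep (tm_subst e t)) ts"
  have tsV: "tm_in V (tm_subst e t)" if "t \<in> set ts" for t
    using that Fn.prems universe_in[OF e] by (auto simp: list_all_iff intro: tm_in_subst)
  have vals: "map (tm_val term_model e) ts = ?us"
    using Fn by (auto simp: list_all_iff)
  have FV: "tm_in V (Fn f ?ts)" "tm_in V (Fn f ?us)"
    using Fn.prems tsV rep by (auto simp: list_all_iff)
  have "prv (Eq (Fn f ?ts) (Fn f ?us))"
    by (rule prv_Fn_cong) (use FV tsV rep in auto)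
  then have "rep (Fn f ?us) = rep (Fn f ?ts)" using rep_eq_iff[OF FV] by simp
  then show ?case by (simp only: tm_val.simps vals term_model_simps tm_subst.simps)
qed

lemma truth:
  assumes "\<And>n. e n \<in> universe term_model" "fm_in V \<phi>"
  shows "fm_sat term_model e \<phi> \<longleftrightarrow> prv (fm_subst e \<phi>)"
  using assms
proof (induction \<phi> arbitrary: e)
  case Fls
  then show ?case using cons by simp
next
  case (Eq s t)
  have "tm_in V (tm_subst e s)" "tm_in V (tm_subst e t)"
    using Eq universe_in[OF Eq.prems(1)] by (auto intro: tm_in_subst)
  then show ?case using Eq by (simp add: tm_val_term_model rep_eq_iff)
next
  case (Rel r ts)
  let ?ts = "map (tm_subst e) ts" and ?us = "map (\<lambda>t. rep (tm_subst e t)) ts"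
  have tsV: "tm_in V (tm_subst e t)" if "t \<in> set ts" for t
    using that Rel.prems universe_in[OF Rel.prems(1)] by (auto simp: list_all_iff intro: tm_in_subst)
  have "map (tm_val term_model e) ts = ?us"
    using Rel tm_val_term_model by (auto simp: list_all_iff)
  moreover have "prv (Rel r ?us) \<longleftrightarrow> prv (Rel r ?ts)"
  proof
    assume *: "prv (Rel r ?us)"
    show "prv (Rel r ?ts)" by (rule prv_Rel_cong[OF _ _ *]) (use tsV rep prv_sym in auto)
  next
    assume *: "prv (Rel r ?ts)"
    show "prv (Rel r ?us)" by (rule prv_Rel_cong[OF _ _ *]) (use tsV rep in auto)
  qed
  ultimately show ?case by (simp only: fm_sat.simps term_model_simps fm_subst.simps)
next
  case (Imp \<phi> \<psi>)
  have "fm_in V (fm_subst e \<phi>)" "fm_in V (fm_subst e \<psi>)"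
    using Imp.prems universe_in[OF Imp.prems(1)] by (auto intro: fm_in_subst)
  then show ?case using Imp by (simp add: prv_Imp)
next
  case (All \<phi>)
  let ?\<psi> = "fm_subst (lift_subst e) \<phi>"
  have eV: "tm_in V (e n)" for n using universe_in[OF All.prems(1)] by blast
  have "tm_in V (lift_subst e n)" for n by (cases n) (simp_all add: tm_in_subst eV)
  then have \<psi>V: "fm_in V (All ?\<psi>)" using All.prems(2) by (simp add: fm_in_subst)
  have inst: "inst a ?\<psi> = fm_subst (case_nat a e) \<phi>" for a
    unfolding inst_def fm_subst_subst
    by (rule fm_subst_cong) (simp add: lift_subst_def tm_subst_subst split: nat.split)
  have sat: "fm_sat term_model (case_nat a e) \<phi> \<longleftrightarrow> prv (inst a ?\<psi>)" if "a \<in> universe term_model" for a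
    unfolding inst using All that by (intro All.IH) (auto split: nat.split)
  show ?case
  proof
    assume "prv (fm_subst e (All \<phi>))"
    then have "prv (inst a ?\<psi>)" if "tm_in V a" for a using that derives.AllE by fastforce
    then show "fm_sat term_model e (All \<phi>)" using sat universe_in by auto
  next
    assume "fm_sat term_model e (All \<phi>)"
    then have a: "prv (inst (rep (Var k)) ?\<psi>)" for k using sat rep_in[of "Var k"] by simp
    \<comment> \<open>A variable need not represent itself: truth is known at
      \<open>rep (Var k)\<close>, and replacement of equals carries it to
      \<open>Var k\<close>.\<close>
    have "prv (inst (Var k) ?\<psi>)" for k
      by (rule derives.EqE[OF _ a[of k]]) (use rep[of "Var k"] prv_sym[of "Var k"] in simp)
    then show "prv (fm_subst e (All \<phi>))" using witness[OF \<psi>V] by auto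
  qed
qed

lemma term_model_struct: "is_struct V term_model"
proof -
  have "rep (Fn f xs) \<in> universe term_model"
    if "f \<in> funs V" "length xs = farity V f" "set xs \<subseteq> universe term_model" for f xs
    by (rule rep_in) (use that universe_in in \<open>auto simp: list_all_iff\<close>)
  then show ?thesis using rep_in[of "Var 0"] unfolding is_struct_def by auto
qed

end

text \<open>Stage \<open>n\<close> decides the \<open>n\<close>-th formula and names a
  counterexample if a universal formula is refuted. Each stage stays finite over \<open>T\<close>,
  so fresh variables remain.\<close>

theorem model_existence:
  fixes T :: "('f, 'r) fm set"
  assumes V: "countable_vocab V" and T: "is_theory V T" "consistent V T"
  shows "\<exists>A :: ('f, 'r, 'f tm) fo_struct. is_model V T A \<and> countable (universe A)"
proof -
  let ?\<phi> = "from_nat_into {\<phi> :: ('f, 'r) fm. fm_in V \<phi>}"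
  have ne: "{\<phi> :: ('f, 'r) fm. fm_in V \<phi>} \<noteq> {}" using fm_in.simps(1) by blast
  have inV: "fm_in V (?\<phi> n)" for n using from_nat_into[OF ne, of n] by simp
  have enum: "\<exists>n. \<phi> = ?\<phi> n" if "fm_in V \<phi>" for \<phi>
    using from_nat_into_surj[OF countable_fm_in[OF V], of \<phi>] that by auto
  have closed: "fm_vars \<gamma> = {}" if "\<gamma> \<in> T" for \<gamma> using T that by (simp add: is_theory_def)
  have "\<exists>F. \<forall>n. (finite (F n) \<and> consistent V (T \<union> F n)) \<and> (F n \<subseteq> F (Suc n) \<and>
    (?\<phi> n \<in> F (Suc n) \<or> Neg (?\<phi> n) \<in> F (Suc n) \<and>
      (\<forall>\<psi>. ?\<phi> n = All \<psi> \<longrightarrow> (\<exists>k. Neg (inst (Var k) \<psi>) \<in> F (Suc n)))))"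
  proof (rule dependent_nat_choice)
    show "\<exists>F. finite F \<and> consistent V (T \<union> F)" using T(2) by (intro exI[of _ "{}"]) simp
    fix F n assume "finite F \<and> consistent V (T \<union> F)"
    then show "\<exists>F'. (finite F' \<and> consistent V (T \<union> F')) \<and> F \<subseteq> F' \<and> (?\<phi> n \<in> F' \<or> Neg (?\<phi> n) \<in> F' \<and>
      (\<forall>\<psi>. ?\<phi> n = All \<psi> \<longrightarrow> (\<exists>k. Neg (inst (Var k) \<psi>) \<in> F')))"
      using henkin_step[of T F V "?\<phi> n", OF closed _ _ inV[of n]] by meson
  qed
  then obtain F where F0: "\<forall>n. (finite (F n) \<and> consistent V (T \<union> F n)) \<and> (F n \<subseteq> F (Suc n) \<and>
    (?\<phi> n \<in> F (Suc n) \<or> Neg (?\<phi> n) \<in> F (Suc n) \<and>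
      (\<forall>\<psi>. ?\<phi> n = All \<psi> \<longrightarrow> (\<exists>k. Neg (inst (Var k) \<psi>) \<in> F (Suc n)))))" ..
  have F: "finite (F n)" "consistent V (T \<union> F n)" "F n \<subseteq> F (Suc n)"
    "?\<phi> n \<in> F (Suc n) \<or> Neg (?\<phi> n) \<in> F (Suc n) \<and>
      (\<forall>\<psi>. ?\<phi> n = All \<psi> \<longrightarrow> (\<exists>k. Neg (inst (Var k) \<psi>) \<in> F (Suc n)))" for n
    by (rule F0[THEN spec, of n, THEN conjunct1, THEN conjunct1]
        F0[THEN spec, of n, THEN conjunct1, THEN conjunct2] F0[THEN spec, of n, THEN conjunct2, THEN conjunct1]
        F0[THEN spec, of n, THEN conjunct2, THEN conjunct2])+
  define \<Gamma> where "\<Gamma> = T \<union> (\<Union>n. F n)"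
  have mono: "F m \<subseteq> F n" if "m \<le> n" for m n using lift_Suc_mono_le[of F, OF F(3) that] .
  have cons: "\<not> derives V \<Gamma> Fls"
  proof
    assume "derives V \<Gamma> Fls"
    then obtain \<Delta> where \<Delta>: "\<Delta> \<subseteq> \<Gamma>" "finite \<Delta>" "derives V \<Delta> Fls"
      using derives_finite[of V \<Gamma> Fls] by auto
    have "\<exists>n. \<Delta> \<subseteq> T \<union> F n"
      using \<Delta>(2,1)
    proof (induction \<Delta>)
      case (insert \<gamma> \<Delta>)
      from insert.prems have "\<Delta> \<subseteq> \<Gamma>" "\<gamma> \<in> \<Gamma>" by simp_all
      then obtain n m where n: "\<Delta> \<subseteq> T \<union> F n" and "\<gamma> \<in> T \<union> F m"
        using insert.IH unfolding \<Gamma>_def by blast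
      then have "insert \<gamma> \<Delta> \<subseteq> T \<union> F (max m n)" using n mono[of m "max m n"] mono[of n "max m n"] by auto
      then show ?case by blast
    qed simp
    then obtain n where "\<Delta> \<subseteq> T \<union> F n" ..
    from derives_mono[OF \<Delta>(3) this] show False using F(2)[of n] by (simp add: consistent_def)
  qed
  interpret henkin V \<Gamma>
  proof
    show "\<not> derives V \<Gamma> Fls" by (rule cons)
  next
    fix \<phi> :: "('f, 'r) fm" assume \<phi>: "fm_in V \<phi>"
    then obtain n where "\<phi> = ?\<phi> n" using enum by blast
    then have "\<phi> \<in> \<Gamma> \<or> Neg \<phi> \<in> \<Gamma>" using F(4)[of n] unfolding \<Gamma>_def by blast
    then show "derives V \<Gamma> \<phi> \<or> derives V \<Gamma> (Neg \<phi>)" using \<phi> by (auto intro: derives.Assm)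
  next
    fix \<psi> :: "('f, 'r) fm" assume \<psi>: "fm_in V (All \<psi>)" "\<not> derives V \<Gamma> (All \<psi>)"
    then obtain n where n: "All \<psi> = ?\<phi> n" using enum by blast
    have "All \<psi> \<notin> F (Suc n)" using \<psi> derives.Assm[of "All \<psi>" \<Gamma> V] unfolding \<Gamma>_def by blast
    then have "\<exists>k. Neg (inst (Var k) \<psi>) \<in> F (Suc n)" using F(4)[of n] unfolding n[symmetric] by simp
    then obtain k where k: "Neg (inst (Var k) \<psi>) \<in> \<Gamma>" unfolding \<Gamma>_def by blast
    have "fm_in V (Neg (inst (Var k) \<psi>))"
      using \<psi> unfolding inst_def by (auto intro!: fm_in_subst split: nat.split)
    then have "derives V \<Gamma> (Neg (inst (Var k) \<psi>))" using k by (intro derives.Assm)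
    then have "\<not> derives V \<Gamma> (inst (Var k) \<psi>)" using cons derives.ImpE[of V \<Gamma> _ Fls] by meson
    then show "\<exists>k. \<not> derives V \<Gamma> (inst (Var k) \<psi>)" ..
  qed
  have "fm_sat term_model e \<phi>" if "\<phi> \<in> T" "range e \<subseteq> universe term_model" for \<phi> e
  proof -
    have "fm_subst e \<phi> = fm_subst Var \<phi>"
      by (rule fm_subst_cong) (use closed[OF that(1)] in simp)
    moreover have \<phi>: "fm_in V \<phi>" using that(1) T(1) by (simp add: is_theory_def)
    ultimately have "prv (fm_subst e \<phi>)" using that(1) by (auto simp: \<Gamma>_def intro: derives.Assm)
    then show ?thesis using truth[of e \<phi>] that(2) \<phi> by auto
  qed
  then have "is_model V T term_model" using term_model_struct by (simp add: is_model_def)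
  moreover have "countable (universe term_model)"
    by (simp add: term_model_def countable_tm_in[OF V])
  ultimately show ?thesis by blast
qed

subsection \<open>Isomorphisms\<close>

definition iso_map ::
    "('f, 'r) vocab \<Rightarrow> ('f, 'r, 'u) fo_struct \<Rightarrow> ('f, 'r, 'v) fo_struct \<Rightarrow> ('u \<Rightarrow> 'v) \<Rightarrow> bool" where
  "iso_map V A B h \<longleftrightarrow> bij_betw h (universe A) (universe B) \<and>
    (\<forall>f\<in>funs V. \<forall>xs. length xs = farity V f \<longrightarrow> set xs \<subseteq> universe A \<longrightarrow>
      h (finterp A f xs) = finterp B f (map h xs)) \<and>
    (\<forall>r\<in>rels V. \<forall>xs. length xs = rarity V r \<longrightarrow> set xs \<subseteq> universe A \<longrightarrow>
      rinterp A r xs = rinterp B r (map h xs))"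

lemma isomorphic_iff: "isomorphic V A B \<longleftrightarrow> (\<exists>h. iso_map V A B h)"
  by (simp add: isomorphic_def iso_map_def)

lemma iso_map_bij: "iso_map V A B h \<Longrightarrow> bij_betw h (universe A) (universe B)"
  by (simp add: iso_map_def)

lemma iso_tm_val:
  assumes "iso_map V A B h" "is_struct V A" "range e \<subseteq> universe A" "tm_in V t"
  shows "h (tm_val A e t) = tm_val B (\<lambda>n. h (e n)) t"
  using assms(4)
proof (induction t)
  case (Fn f ts)
  have "set (map (tm_val A e) ts) \<subseteq> universe A"
    using Fn.prems tm_val_in[OF assms(2) _ assms(3)] by (auto simp: list_all_iff)
  moreover have "map h (map (tm_val A e) ts) = map (tm_val B (\<lambda>n. h (e n))) ts"
    using Fn by (simp add: list_all_iff)
  ultimately show ?case using assms(1) Fn.prems unfolding iso_map_def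
    by (metis length_map tm_in.simps(2) tm_val.simps(2))
qed simp

lemma iso_atomic:
  assumes "iso_map V A B h" "is_struct V A" "range e \<subseteq> universe A"
  shows "tm_in V s \<Longrightarrow> tm_in V t \<Longrightarrow> tm_val A e s = tm_val A e t \<longleftrightarrow> tm_val B (\<lambda>n. h (e n)) s = tm_val B (\<lambda>n. h (e n)) t"
    and "r \<in> rels V \<Longrightarrow> length ts = rarity V r \<Longrightarrow> list_all (tm_in V) ts \<Longrightarrow>
      rinterp A r (map (tm_val A e) ts) \<longleftrightarrow> rinterp B r (map (tm_val B (\<lambda>n. h (e n))) ts)"
proof -
  assume "tm_in V s" "tm_in V t"
  then show "tm_val A e s = tm_val A e t \<longleftrightarrow> tm_val B (\<lambda>n. h (e n)) s = tm_val B (\<lambda>n. h (e n)) t"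
    using iso_tm_val[OF assms] tm_val_in[OF assms(2) _ assms(3)] iso_map_bij[OF assms(1)]
    by (metis bij_betw_def inj_onD)
next
  assume r: "r \<in> rels V" "length ts = rarity V r" "list_all (tm_in V) ts"
  have "map h (map (tm_val A e) ts) = map (tm_val B (\<lambda>n. h (e n))) ts"
    using r iso_tm_val[OF assms] by (simp add: list_all_iff)
  moreover have "set (map (tm_val A e) ts) \<subseteq> universe A"
    using r tm_val_in[OF assms(2) _ assms(3)] by (auto simp: list_all_iff)
  ultimately show "rinterp A r (map (tm_val A e) ts) \<longleftrightarrow> rinterp B r (map (tm_val B (\<lambda>n. h (e n))) ts)"
    using assms(1) r unfolding iso_map_def by (metis length_map)
qed

lemma comp_case_nat: "(\<lambda>n. h (case_nat a e n)) = case_nat (h a) (\<lambda>n. h (e n))"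
  by (rule ext) (simp split: nat.split)

lemma iso_fm_sat:
  assumes "iso_map V A B h" "is_struct V A" "range e \<subseteq> universe A" "fm_in V \<phi>"
  shows "fm_sat A e \<phi> \<longleftrightarrow> fm_sat B (\<lambda>n. h (e n)) \<phi>"
  using assms(3,4)
proof (induction \<phi> arbitrary: e)
  case (Eq s t)
  then show ?case using iso_atomic(1)[OF assms(1,2)] by simp
next
  case (Rel r ts)
  then show ?case using iso_atomic(2)[OF assms(1,2)] by simp
next
  case (All \<phi>)
  have "fm_sat A (case_nat a e) \<phi> \<longleftrightarrow> fm_sat B (case_nat (h a) (\<lambda>n. h (e n))) \<phi>" if "a \<in> universe A" for a
    using All.IH[OF case_nat_range[OF that All.prems(1)]] All.prems(2) by (simp add: comp_case_nat)
  moreover have "universe B = h ` universe A" using iso_map_bij[OF assms(1)] by (simp add: bij_betw_def)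
  ultimately show ?case by simp
qed auto

lemma iso_inf_sat:
  fixes \<phi> :: "('f, 'r, 'k) inf_fm"
  assumes "iso_map V A B h" "is_struct V A" "range e \<subseteq> universe A" "inf_in V \<phi>"
  shows "inf_sat A e \<phi> \<longleftrightarrow> inf_sat B (\<lambda>n. h (e n)) \<phi>"
  using assms(3,4)
proof (induction \<phi> arbitrary: e)
  case (IEq s t)
  then show ?case using iso_atomic(1)[OF assms(1,2)] by simp
next
  case (IRel r ts)
  then show ?case using iso_atomic(2)[OF assms(1,2)] by simp
next
  case (IEx \<phi>)
  have "inf_sat A (case_nat a e) \<phi> \<longleftrightarrow> inf_sat B (case_nat (h a) (\<lambda>n. h (e n))) \<phi>" if "a \<in> universe A" for a
    using IEx.IH[OF case_nat_range[OF that IEx.prems(1)]] IEx.prems(2) by (simp add: comp_case_nat)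
  moreover have "universe B = h ` universe A" using iso_map_bij[OF assms(1)] by (simp add: bij_betw_def)
  ultimately show ?case by simp
qed auto

lemma iso_map_inv:
  assumes "iso_map V A B h" "is_struct V A"
  shows "iso_map V B A (inv_into (universe A) h)"
proof -
  let ?g = "inv_into (universe A) h"
  have bij: "bij_betw h (universe A) (universe B)" using iso_map_bij[OF assms(1)] .
  have g: "bij_betw ?g (universe B) (universe A)" using bij by (rule bij_betw_inv_into)
  have hg: "map h (map ?g ys) = ys" if "set ys \<subseteq> universe B" for ys
    using that bij by (auto simp: bij_betw_inv_into_right intro!: map_idI)
  have gA: "set (map ?g ys) \<subseteq> universe A" if "set ys \<subseteq> universe B" for ys
    using that g by (auto simp: bij_betw_def)
  have "?g (finterp B f ys) = finterp A f (map ?g ys)"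
    if f: "f \<in> funs V" "length ys = farity V f" "set ys \<subseteq> universe B" for f ys
  proof -
    have "h (finterp A f (map ?g ys)) = finterp B f ys"
      using assms(1) f gA[OF f(3)] hg[OF f(3)] unfolding iso_map_def by (metis length_map)
    moreover have "finterp A f (map ?g ys) \<in> universe A"
      using assms(2) f gA[OF f(3)] unfolding is_struct_def by simp
    ultimately show ?thesis using bij by (metis bij_betw_inv_into_left)
  qed
  moreover have "rinterp B r ys = rinterp A r (map ?g ys)"
    if r: "r \<in> rels V" "length ys = rarity V r" "set ys \<subseteq> universe B" for r ys
    using assms(1) r gA[OF r(3)] hg[OF r(3)] unfolding iso_map_def by (metis length_map)
  ultimately show ?thesis using g unfolding iso_map_def by blast
qed

lemma iso_map_comp:
  assumes "iso_map V A B h" "iso_map V B C g"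
  shows "iso_map V A C (g \<circ> h)"
proof -
  have hB: "set (map h xs) \<subseteq> universe B" if "set xs \<subseteq> universe A" for xs
    using that iso_map_bij[OF assms(1)] by (auto simp: bij_betw_def)
  have "bij_betw (g \<circ> h) (universe A) (universe C)"
    by (rule bij_betw_trans[OF iso_map_bij[OF assms(1)] iso_map_bij[OF assms(2)]])
  moreover have "(g \<circ> h) (finterp A f xs) = finterp C f (map (g \<circ> h) xs)"
    if "f \<in> funs V" "length xs = farity V f" "set xs \<subseteq> universe A" for f xs
    using assms that hB[OF that(3)] unfolding iso_map_def by (metis comp_apply length_map map_map)
  moreover have "rinterp A r xs = rinterp C r (map (g \<circ> h) xs)"
    if "r \<in> rels V" "length xs = rarity V r" "set xs \<subseteq> universe A" for r xs
    using assms that hB[OF that(3)] unfolding iso_map_def by (metis length_map map_map)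
  ultimately show ?thesis unfolding iso_map_def by blast
qed

text \<open>Moves a countable structure onto the natural numbers: the term model at the start, the
  two extensions at the end. Off the image of \<open>h\<close> the interpretations are
  arbitrary.\<close>

definition copy_struct :: "('u \<Rightarrow> 'v) \<Rightarrow> ('f, 'r, 'u) fo_struct \<Rightarrow> ('f, 'r, 'v) fo_struct" where
  "copy_struct h A = \<lparr>universe = h ` universe A,
    finterp = (\<lambda>f ys. h (finterp A f (map (inv_into (universe A) h) ys))),
    rinterp = (\<lambda>r ys. rinterp A r (map (inv_into (universe A) h) ys))\<rparr>"

lemma universe_copy [simp]: "universe (copy_struct h A) = h ` universe A"
  by (simp add: copy_struct_def)

lemma iso_copy:
  assumes "inj_on h (universe A)"
  shows "iso_map V A (copy_struct h A) h"
proof -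
  have "map (inv_into (universe A) h) (map h xs) = xs" if "set xs \<subseteq> universe A" for xs
    using that assms by (auto intro!: map_idI)
  then show ?thesis
    using assms by (simp add: iso_map_def copy_struct_def bij_betw_def)
qed

lemma iso_is_struct:
  assumes "iso_map V A B h" "is_struct V A"
  shows "is_struct V B"
proof -
  let ?g = "inv_into (universe A) h"
  have bij: "bij_betw h (universe A) (universe B)" using iso_map_bij[OF assms(1)] .
  have "finterp B f ys \<in> universe B"
    if f: "f \<in> funs V" "length ys = farity V f" "set ys \<subseteq> universe B" for f ys
  proof -
    have gA: "set (map ?g ys) \<subseteq> universe A"
      using f bij_betw_inv_into[OF bij] by (auto simp: bij_betw_def)
    have "map h (map ?g ys) = ys"
      using f bij by (auto simp: bij_betw_inv_into_right intro!: map_idI)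
    then have "finterp B f ys = h (finterp A f (map ?g ys))"
      using assms(1) f gA unfolding iso_map_def by (metis length_map)
    moreover have "finterp A f (map ?g ys) \<in> universe A"
      using assms(2) f gA unfolding is_struct_def by simp
    ultimately show ?thesis using bij by (auto simp: bij_betw_def)
  qed
  then show ?thesis using assms(2) bij unfolding is_struct_def bij_betw_def by auto
qed

lemma iso_is_model:
  assumes "iso_map V A B h" "is_theory V T" "is_model V T A"
  shows "is_model V T B"
proof -
  let ?g = "inv_into (universe A) h"
  have A: "is_struct V A" using assms(3) by (simp add: is_model_def)
  have bij: "bij_betw h (universe A) (universe B)" using iso_map_bij[OF assms(1)] .
  have "fm_sat B e \<phi>" if "\<phi> \<in> T" "range e \<subseteq> universe B" for \<phi> e
  proof -
    have ge: "range (\<lambda>n. ?g (e n)) \<subseteq> universe A"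
      using that(2) bij_betw_inv_into[OF bij] by (auto simp: bij_betw_def)
    have "(\<lambda>n. h (?g (e n))) = e"
    proof
      fix n have "e n \<in> universe B" using that(2) by blast
      then show "h (?g (e n)) = e n" using bij by (simp add: bij_betw_inv_into_right)
    qed
    then show ?thesis
      using iso_fm_sat[OF assms(1) A ge, of \<phi>] that(1) assms(2,3) ge
      by (auto simp: is_theory_def is_model_def)
  qed
  then show ?thesis using iso_is_struct[OF assms(1) A] by (simp add: is_model_def)
qed

lemma iso_inf_true_imp:
  fixes \<phi> :: "('f, 'r, 'k) inf_fm"
  assumes "iso_map V A B h" "is_struct V A" "inf_in V \<phi>" "inf_true B \<phi>"
  shows "inf_true A \<phi>"
proof -
  have "inf_sat A e \<phi>" if e: "range e \<subseteq> universe A" for e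
  proof -
    have "range (\<lambda>n. h (e n)) \<subseteq> universe B"
      using e iso_map_bij[OF assms(1)] by (auto simp: bij_betw_def)
    then show ?thesis using iso_inf_sat[OF assms(1,2) e assms(3)] assms(4) by (simp add: inf_true_def)
  qed
  then show ?thesis by (simp add: inf_true_def)
qed

lemma iso_inf_true:
  fixes \<phi> :: "('f, 'r, 'k) inf_fm"
  assumes "iso_map V A B h" "is_struct V A" "inf_in V \<phi>"
  shows "inf_true A \<phi> \<longleftrightarrow> inf_true B \<phi>"
  using iso_inf_true_imp[OF assms]
    iso_inf_true_imp[OF iso_map_inv[OF assms(1,2)] iso_is_struct[OF assms(1,2)] assms(3)] by blast

lemma iso_delta_equiv:
  assumes "iso_map V A A' h" "is_struct V A" "iso_map V B B' g" "is_struct V B"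
    and "delta_equiv TYPE('k) V \<delta> A B"
  shows "delta_equiv TYPE('k) V \<delta> A' B'"
  using assms(5) iso_inf_true[OF assms(1,2)] iso_inf_true[OF assms(3,4)] unfolding delta_equiv_def by blast

lemma iso_isomorphic:
  assumes "iso_map V A A' h" "is_struct V A" "iso_map V B B' g" "is_struct V B" "isomorphic V A' B'"
  shows "isomorphic V A B"
  using assms iso_map_comp iso_map_inv unfolding isomorphic_iff by meson

subsection \<open>Well-orders of multisets\<close>

text \<open>The \<open>n\<close>-th element of \<open>A\<close> has weight 2^(-n), and a point is
  sent to the total weight of \<open>A\<close> below it; for \<open>x\<close> in \<open>A\<close>
  with \<open>lt x y\<close> the sum for \<open>y\<close> contains the weight of \<open>x\<close> in
  addition. The total is at most 2, which leaves 3 as an exponent above all others. The multiset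
  order requires a linearly ordered type, whereas \<delta> is only a relation.\<close>

lemma countable_linear_embedding:
  fixes lt :: "'a \<Rightarrow> 'a \<Rightarrow> bool"
  assumes A: "countable A" and irrefl: "\<And>x. \<not> lt x x"
    and trans: "\<And>x y z. lt x y \<Longrightarrow> lt y z \<Longrightarrow> lt x z"
    and total: "\<And>x y. x \<in> A \<Longrightarrow> y \<in> A \<Longrightarrow> lt x y \<or> x = y \<or> lt y x"
  shows "\<exists>f :: 'a \<Rightarrow> real. (\<forall>x\<in>A. \<forall>y\<in>A. lt x y \<longleftrightarrow> f x < f y) \<and> (\<forall>x. f x < 3)"
proof -
  define g where "g x n = (if \<exists>y\<in>A. to_nat_on A y = n \<and> lt y x then (1 / 2) ^ n else (0 :: real))" for x n
  have half: "summable (\<lambda>n. (1 / 2) ^ n :: real)" by (rule summable_geometric) simp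
  have sg: "summable (g x)" for x
    by (rule summable_comparison_test[OF _ half]) (auto simp: g_def)
  have less: "suminf (g x) < suminf (g y)" if "x \<in> A" "lt x y" for x y
  proof -
    let ?n = "to_nat_on A x"
    let ?s = "\<lambda>n. if n = ?n then (1 / 2) ^ n else (0 :: real)"
    have s: "?s sums (1 / 2) ^ ?n" by (rule sums_single)
    have "g x n + ?s n \<le> g y n" for n
    proof (cases "n = ?n")
      case True
      have "\<not> (\<exists>z\<in>A. to_nat_on A z = ?n \<and> lt z x)"
        using inj_onD[OF inj_on_to_nat_on[OF A]] that(1) irrefl by blast
      then show ?thesis using True that by (auto simp: g_def)
    next
      case False
      then show ?thesis using trans[OF _ that(2)] by (auto simp: g_def)
    qed
    then have "(\<Sum>n. g x n + ?s n) \<le> suminf (g y)"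
      by (rule suminf_le[OF _ summable_add[OF sg sums_summable[OF s]] sg])
    moreover have "(\<Sum>n. g x n + ?s n) = suminf (g x) + (1 / 2) ^ ?n"
      using suminf_add[OF sg sums_summable[OF s]] sums_unique[OF s] by simp
    moreover have "(1 / 2 :: real) ^ ?n > 0" by simp
    ultimately show ?thesis by linarith
  qed
  have "lt x y \<longleftrightarrow> suminf (g x) < suminf (g y)" if "x \<in> A" "y \<in> A" for x y
    using less[OF that(1), of y] less[OF that(2), of x] total[OF that] by (metis order_less_asym order_less_irrefl)
  moreover have "suminf (g x) < 3" for x
  proof -
    have "suminf (g x) \<le> (\<Sum>n. (1 / 2) ^ n)" by (rule suminf_le[OF _ sg half]) (simp add: g_def)
    also have "\<dots> = 2" using suminf_geometric[of "1 / 2 :: real"] by simp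
    finally show ?thesis by simp
  qed
  ultimately show ?thesis by (intro exI[of _ "\<lambda>x. suminf (g x)"]) blast
qed

text \<open>Read as Cantor normal forms, the multisets over a well-ordered set of type \<open>\<delta>\<close> are the ordinals
  below \<open>\<omega>\<^sup>\<delta>\<close>, with coordinatewise sum; \<open>hi c x\<close> consists of the terms of \<open>x\<close> with exponent at least \<open>c\<close>.\<close>

definition hi :: "'c::linorder \<Rightarrow> 'c multiset \<Rightarrow> 'c multiset" where "hi c = filter_mset (\<lambda>k. c \<le> k)"
definition lo :: "'c::linorder \<Rightarrow> 'c multiset \<Rightarrow> 'c multiset" where "lo c = filter_mset (\<lambda>k. k < c)"

lemma count_hi: "count (hi c x) k = (if c \<le> k then count x k else 0)"
  by (simp add: hi_def)

lemma count_lo: "count (lo c x) k = (if k < c then count x k else 0)"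
  by (simp add: lo_def)

lemma hi_lo: "hi c x + lo c x = x"
  by (rule multiset_eqI) (auto simp: count_hi count_lo)

lemma set_hi: "set_mset (hi c x) = set_mset x \<inter> {c..}"
  by (auto simp: hi_def)

lemma set_lo: "set_mset (lo c x) = set_mset x \<inter> {..<c}"
  by (auto simp: lo_def)

lemma hi_empty [simp]: "hi c {#} = {#}" and lo_empty [simp]: "lo c {#} = {#}"
  by (simp_all add: hi_def lo_def)

text \<open>Where \<open>h'\<close> has the larger count the exponent is at least \<open>c\<close>,
  and there \<open>a\<close> and \<open>b\<close> contribute nothing; such places decide the
  comparison, as the leading terms of normal forms do.\<close>

lemma hi_less_add:
  fixes h h' a b :: "'c::linorder multiset"
  assumes "set_mset h' \<subseteq> {c..}" "set_mset a \<subseteq> {..<c}" "set_mset b \<subseteq> {..<c}" "h < h'"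
  shows "h + a < h' + b"
proof -
  have ne: "h \<noteq> h'" and HO: "\<And>y. count h' y < count h y \<Longrightarrow> \<exists>x>y. count h x < count h' x"
    using assms(4) unfolding less_multiset\<^sub>H\<^sub>O by blast+
  obtain x where x: "count h x < count h' x"
    using ne HO by (metis multiset_eqI linorder_neqE_nat)
  have above: "c \<le> x \<and> count (h + a) x < count (h' + b) x" if "count h x < count h' x" for x
  proof -
    have "x \<in># h'" using that by (metis count_inI not_less0)
    then have "c \<le> x" using assms(1) by auto
    then have "count a x = 0" "count b x = 0" using assms(2,3) by (auto simp: not_in_iff[symmetric])
    then show ?thesis using that \<open>c \<le> x\<close> by simp
  qed
  show ?thesis unfolding less_multiset\<^sub>H\<^sub>O
  proof (intro conjI allI impI)
    show "h + a \<noteq> h' + b" using above[OF x] by (metis less_irrefl)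
    fix y assume y: "count (h' + b) y < count (h + a) y"
    show "\<exists>x>y. count (h + a) x < count (h' + b) x"
    proof (cases "c \<le> y")
      case True
      then have "count a y = 0" "count b y = 0" using assms(2,3) by (auto simp: not_in_iff[symmetric])
      then show ?thesis using y HO[of y] above by auto
    next
      case False
      then show ?thesis using above[OF x] by (intro exI[of _ x]) auto
    qed
  qed
qed

lemma hi_less_imp_less: "hi c x < hi c y \<Longrightarrow> x < y"
  using hi_less_add[of "hi c y" c "lo c x" "lo c y" "hi c x"] by (simp add: hi_lo set_hi set_lo)

lemma hi_hi: "c' \<le> c \<Longrightarrow> hi c (hi c' x) = hi c x"
  by (rule multiset_eqI) (auto simp: count_hi)

lemma hi_less_mono: "c' \<le> c \<Longrightarrow> hi c x < hi c y \<Longrightarrow> hi c' x < hi c' y"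
  using hi_less_imp_less[of c "hi c' x" "hi c' y"] by (simp add: hi_hi)

lemma hi_eq_mono: "c' \<le> c \<Longrightarrow> hi c' x = hi c' y \<Longrightarrow> hi c x = hi c y"
  by (metis hi_hi)

lemma hi_mono: "c' \<le> c \<Longrightarrow> hi c' x < hi c' y \<Longrightarrow> hi c x \<le> hi c y"
  using hi_less_mono[of c' c y x] by (meson less_asym not_le)

lemma less_imp_hi_le: "x < y \<Longrightarrow> hi c x \<le> hi c y"
  using hi_less_imp_less[of c y x] by (meson less_asym not_le)

lemma less_replicate_mset:
  fixes m :: "'c::linorder multiset"
  assumes "\<And>k. k \<in># m \<Longrightarrow> k \<le> \<kappa>" "count m \<kappa> < n"
  shows "m < replicate_mset n \<kappa>"
  unfolding less_multiset\<^sub>H\<^sub>O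
proof (intro conjI allI impI)
  show "m \<noteq> replicate_mset n \<kappa>" using assms(2) by auto
  fix y assume y: "count (replicate_mset n \<kappa>) y < count m y"
  then have "y \<in># m" by (metis count_inI not_less0)
  then have "y \<le> \<kappa>" using assms(1) by blast
  moreover have "y \<noteq> \<kappa>" using y assms(2) by auto
  ultimately have "y < \<kappa>" by simp
  then show "\<exists>x>y. count m x < count (replicate_mset n \<kappa>) x" using assms(2) by (intro exI[of _ \<kappa>]) simp
qed

text \<open>Only \<open>C\<close> is well-ordered, not its type, so the multiset extension is taken
  of the order restricted to \<open>C\<close>. The removed elements \<open>X\<close> and the added
  elements \<open>Y\<close> of a descent stay inside \<open>C\<close>.\<close>

lemma wf_multisets_over:
  fixes C :: "'c::linorder set"
  assumes "wf {(x, y). x \<in> C \<and> y \<in> C \<and> x < y}"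
  shows "wf {(m, n). set_mset m \<subseteq> C \<and> set_mset n \<subseteq> C \<and> m < n}"
proof (rule wf_subset[OF wf_mult[OF assms]], rule subsetI)
  fix p assume "p \<in> {(m, n). set_mset m \<subseteq> C \<and> set_mset n \<subseteq> C \<and> m < n}"
  then obtain m n where p: "p = (m, n)" "set_mset m \<subseteq> C" "set_mset n \<subseteq> C" "m < n" by blast
  obtain X Y where XY: "X \<noteq> {#}" "X \<subseteq># n" "m = n - X + Y" "\<forall>k. k \<in># Y \<longrightarrow> (\<exists>a. a \<in># X \<and> k < a)"
    using p(4) unfolding less_multiset\<^sub>D\<^sub>M by blast
  have "\<forall>k\<in>#Y. \<exists>j\<in>#X. (k, j) \<in> {(x, y). x \<in> C \<and> y \<in> C \<and> x < y}"
  proof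
    fix k assume k: "k \<in># Y"
    then obtain a where a: "a \<in># X" "k < a" using XY(4) by blast
    have "k \<in> C" "a \<in> C" using k a(1) p(2,3) XY(3) mset_subset_eqD[OF XY(2)] by auto
    then show "\<exists>j\<in>#X. (k, j) \<in> {(x, y). x \<in> C \<and> y \<in> C \<and> x < y}" using a by blast
  qed
  from one_step_implies_mult[OF XY(1) this, of "n - X"]
  show "p \<in> mult {(x, y). x \<in> C \<and> y \<in> C \<and> x < y}" using XY(2,3) p(1) by simp
qed

text \<open>Above \<open>y0\<close> lie the ordinals \<omega>^t * N + m for all multisets
  \<open>m\<close> over \<open>C\<close>, and above these \<omega>^t * (N + 1). An embedding
  \<open>g\<close> would make m \<mapsto> g (\<omega>^t * N + m) a strictly increasing self-map of a
  well-order, hence nowhere below the identity, and yet bounded by the value at the last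
  point.\<close>

lemma no_embedding:
  fixes C :: "'c::linorder set"
  assumes wf: "wf {(x, y). x \<in> C \<and> y \<in> C \<and> x < y}" and t: "\<And>c. c \<in> C \<Longrightarrow> c < t"
    and y0: "set_mset y0 \<subseteq> insert t C"
    and g: "g ` {y \<in> {m. set_mset m \<subseteq> insert t C}. y0 \<le> y} \<subseteq> {m. set_mset m \<subseteq> C}"
  shows "\<not> strict_mono_on {y \<in> {m. set_mset m \<subseteq> insert t C}. y0 \<le> y} g"
proof
  let ?U = "{y \<in> {m. set_mset m \<subseteq> insert t C}. y0 \<le> y}"
  assume mono: "strict_mono_on ?U g"
  \<comment> \<open>One more copy of \<open>t\<close> than in \<open>y0\<close>, so that \<omega>^t
    * N exceeds \<open>y0\<close>.\<close>
  let ?N = "Suc (count y0 t)"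
  let ?j = "\<lambda>m. replicate_mset ?N t + m"
  have y0j: "y0 < replicate_mset ?N t" by (rule less_replicate_mset) (use y0 t in \<open>auto intro: less_imp_le\<close>)
  have jU: "?j m \<in> ?U" if "set_mset m \<subseteq> C" for m
  proof -
    have "replicate_mset ?N t \<le> ?j m" by (rule subset_eq_imp_le_multiset) simp
    then have "y0 \<le> ?j m" using y0j by (meson less_imp_le order_trans)
    then show ?thesis using that by (auto simp del: replicate_mset_Suc)
  qed
  let ?y = "?j {#t#}"
  have yU: "?y \<in> ?U"
  proof -
    have "replicate_mset ?N t \<le> ?y" by (rule subset_eq_imp_le_multiset) simp
    then have "y0 \<le> ?y" using y0j by (meson less_imp_le order_trans)
    then show ?thesis by (auto simp del: replicate_mset_Suc)
  qed
  have jy: "?j m < ?y" if "set_mset m \<subseteq> C" for m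
  proof -
    have "m < {#t#}" by (rule ex_gt_imp_less_multiset) (use that t in auto)
    then show ?thesis by simp
  qed
  let ?l = "g ?y"
  have bad: "g (?j m) < ?l" if "set_mset m \<subseteq> C" for m
    by (rule strict_mono_onD[OF mono jU[OF that] yU jy[OF that]])
  have gC: "set_mset (g y) \<subseteq> C" if "y \<in> ?U" for y using g that by blast
  have "\<not> g (?j m) < m" if "set_mset m \<subseteq> C" for m
    using that
  proof (induction m rule: wf_induct_rule[OF wf_multisets_over[OF wf]])
    case (1 m)
    show ?case
    proof
      assume *: "g (?j m) < m"
      have m': "set_mset (g (?j m)) \<subseteq> C" by (rule gC[OF jU[OF 1(2)]])
      have "g (?j (g (?j m))) < g (?j m)"
        by (rule strict_mono_onD[OF mono jU[OF m'] jU[OF 1(2)]]) (use * in simp)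
      then show False using 1(1)[OF _ m'] m' 1(2) * by blast
    qed
  qed
  \<comment> \<open>The bound \<open>?l\<close> is itself a multiset over \<open>C\<close>; at
    \<open>m = ?l\<close> the two estimates collide.\<close>
  then show False using bad[OF gC[OF yU]] gC[OF yU] by blast
qed

text \<open>With x = \<omega>^c * q + r, paired ordinals have the same remainder r, and their
  quotients q are ordered alike. A set of pairs keeps the notion symmetric, so that forth also
  yields back; the pair of zeros guarantees a matched quotient below every ordinal.\<close>

definition part_iso :: "'c::linorder set \<Rightarrow> 'c set \<Rightarrow> 'c \<Rightarrow> ('c multiset \<times> 'c multiset) set \<Rightarrow> bool" where
  "part_iso A B c \<pi> \<longleftrightarrow> finite \<pi> \<and> ({#}, {#}) \<in> \<pi> \<and>
    (\<forall>(x, x')\<in>\<pi>. set_mset x \<subseteq> A \<and> set_mset x' \<subseteq> B \<and> lo c x = lo c x') \<and>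
    (\<forall>(x, x')\<in>\<pi>. \<forall>(y, y')\<in>\<pi>. hi c x < hi c y \<longleftrightarrow> hi c x' < hi c y')"

lemma part_isoD:
  assumes "part_iso A B c \<pi>" "(x, x') \<in> \<pi>"
  shows "set_mset x \<subseteq> A" "set_mset x' \<subseteq> B" "lo c x = lo c x'"
    and "(y, y') \<in> \<pi> \<Longrightarrow> hi c x < hi c y \<longleftrightarrow> hi c x' < hi c y'"
    and "(y, y') \<in> \<pi> \<Longrightarrow> hi c x = hi c y \<longleftrightarrow> hi c x' = hi c y'"
proof -
  show "set_mset x \<subseteq> A" "set_mset x' \<subseteq> B" "lo c x = lo c x'"
    using assms unfolding part_iso_def by fast+
  have iff: "hi c u < hi c v \<longleftrightarrow> hi c u' < hi c v'" if "(u, u') \<in> \<pi>" "(v, v') \<in> \<pi>" for u u' v v'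
    using assms(1) that unfolding part_iso_def by fast
  show "(y, y') \<in> \<pi> \<Longrightarrow> hi c x < hi c y \<longleftrightarrow> hi c x' < hi c y'" using iff[OF assms(2)] .
  show "(y, y') \<in> \<pi> \<Longrightarrow> hi c x = hi c y \<longleftrightarrow> hi c x' = hi c y'"
    using iff[OF assms(2), of y y'] iff[OF _ assms(2), of y y'] by (metis less_irrefl linorder_less_linear)
qed

lemma part_iso_converse: "part_iso A B c \<pi> \<Longrightarrow> part_iso B A c (\<pi>\<inverse>)"
proof -
  assume \<pi>: "part_iso A B c \<pi>"
  show ?thesis
    unfolding part_iso_def
  proof (intro conjI)
    show "finite (\<pi>\<inverse>)" "({#}, {#}) \<in> \<pi>\<inverse>" using \<pi> unfolding part_iso_def by simp_all
  qed (use part_isoD(1-4)[OF \<pi>] in \<open>auto dest!: subsetD\<close>)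
qed

lemma part_iso_less:
  assumes "part_iso A B c \<pi>" "(x, x') \<in> \<pi>" "(y, y') \<in> \<pi>" "x < y"
  shows "x' < y'"
proof (cases "hi c x = hi c y")
  case True
  then have "lo c x < lo c y" using assms(4) by (metis add_less_cancel_left hi_lo)
  moreover have "hi c x' = hi c y'" using True part_isoD(5)[OF assms(1,2,3)] by blast
  ultimately show ?thesis
    using part_isoD(3)[OF assms(1,2)] part_isoD(3)[OF assms(1,3)] by (metis add_less_cancel_left hi_lo)
next
  case False
  then have "hi c x < hi c y" using less_imp_hi_le[OF assms(4), of c] by simp
  then show ?thesis using part_isoD(4)[OF assms(1,2,3)] hi_less_imp_less by blast
qed

text \<open>An element \<open>z\<close> whose high part at \<open>c\<close> is not in the domain is sent just above everything whose high part
  is the image of the next smaller one: \<open>N\<close> and \<open>\<kappa>\<close> are chosen so that \<open>N\<close> copies of \<open>\<kappa>\<close> exceed all terms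
  used between \<open>c'\<close> and \<open>c\<close>, and \<open>r z\<close> further copies keep the order among such \<open>z\<close>.\<close>

lemma part_iso_extend:
  assumes \<pi>: "part_iso A B c \<pi>" and c': "c' < c" "c' \<in> B" and AB: "A \<inter> {..<c} \<subseteq> B"
    and d: "finite d" "\<And>z. z \<in> d \<Longrightarrow> set_mset z \<subseteq> A"
  shows "\<exists>\<pi>'. part_iso A B c' \<pi>' \<and> \<pi> \<subseteq> \<pi>' \<and> d \<subseteq> fst ` \<pi>'"
proof -
  \<comment> \<open>Old and new elements are mapped by the same recipe \<open>E\<close>, so that the
    order is checked once; \<open>E_\<pi>\<close> confirms that the old pairs are kept.\<close>
  define X where "X = d \<union> fst ` \<pi>"
  have fin: "finite \<pi>" and zero: "({#}, {#}) \<in> \<pi>" using \<pi> unfolding part_iso_def by auto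
  have X: "finite X" "{#} \<in> X" using fin zero d(1) by (force simp: X_def)+
  have XA: "set_mset z \<subseteq> A" if "z \<in> X" for z using that d(2) part_isoD(1)[OF \<pi>] by (force simp: X_def)
  \<comment> \<open>The member \<open>c'\<close> makes \<open>K\<close> nonempty and supplies an
    exponent in \<open>B\<close> when no element of \<open>X\<close> has a term between
    \<open>c'\<close> and \<open>c\<close>.\<close>
  define K where "K = insert c' ((\<Union>z\<in>X. set_mset z) \<inter> {c'..<c})"
  have K: "finite K" "K \<noteq> {}" using X(1) by (auto simp: K_def)
  define \<kappa> where "\<kappa> = Max K"
  have \<kappa>K: "\<kappa> \<in> K" unfolding \<kappa>_def by (rule Max_in[OF K])
  have \<kappa>: "c' \<le> \<kappa>" "\<kappa> < c" using \<kappa>K c'(1) by (auto simp: K_def)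
  have \<kappa>B: "\<kappa> \<in> B" using \<kappa>K c'(2) XA AB by (auto simp: K_def)
  have \<kappa>_ge: "k \<le> \<kappa>" if "z \<in> X" "k \<in># z" "c' \<le> k" "k < c" for z k
    unfolding \<kappa>_def by (rule Max_ge[OF K(1)]) (use that in \<open>auto simp: K_def\<close>)
  obtain N where N: "\<And>z. z \<in> X \<Longrightarrow> count z \<kappa> < N"
    using finite_nat_set_iff_bounded[of "(\<lambda>z. count z \<kappa>) ` X"] X(1) by auto
  define r where "r z = card {h \<in> hi c' ` X. h < hi c' z}" for z
  have r_less: "r z < r w" if "z \<in> X" "hi c' z < hi c' w" for z w
    unfolding r_def by (rule psubset_card_mono) (use X(1) that in auto)
  have "\<exists>x x'. (x, x') \<in> \<pi> \<and> hi c x \<le> hi c z \<and> (\<forall>(y, y')\<in>\<pi>. hi c y \<le> hi c z \<longrightarrow> hi c y \<le> hi c x)" for z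
  proof -
    let ?S = "{h \<in> (\<lambda>(x, x'). hi c x) ` \<pi>. h \<le> hi c z}"
    have S: "finite ?S" using fin by simp
    have "hi c {#} \<in> ?S" using zero by force
    then have "Max ?S \<in> ?S" using Max_in[OF S] by blast
    then obtain x x' where x: "(x, x') \<in> \<pi>" "hi c x = Max ?S" "hi c x \<le> hi c z" by auto
    have "hi c y \<le> hi c x" if "(y, y') \<in> \<pi>" "hi c y \<le> hi c z" for y y'
      unfolding x(2) by (rule Max_ge[OF S]) (use that in force)
    then show ?thesis using x by blast
  qed
  then obtain p p' where p: "\<And>z. (p z, p' z) \<in> \<pi>" "\<And>z. hi c (p z) \<le> hi c z"
    and p_max: "\<And>z y y'. (y, y') \<in> \<pi> \<Longrightarrow> hi c y \<le> hi c z \<Longrightarrow> hi c y \<le> hi c (p z)"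
    by (metis (no_types, lifting) case_prodD)
  let ?ex = "\<lambda>z. hi c (p z) = hi c z"
  \<comment> \<open>A matched quotient keeps its middle terms, which reproduces the old pairs; an
    unmatched one needs a fresh place above the largest matched quotient below it.\<close>
  define mid where "mid z = (if ?ex z then filter_mset (\<lambda>k. c' \<le> k \<and> k < c) z else replicate_mset (N + r z) \<kappa>)" for z
  define E where "E z = hi c (p' z) + mid z + lo c' z" for z
  have mid_set: "set_mset (mid z) \<subseteq> {c'..<c}" for z unfolding mid_def using \<kappa> by auto
  have hi_E: "hi c' (E z) = hi c (p' z) + mid z" for z
  proof -
    have "hi c' (hi c (p' z)) = hi c (p' z)" using c'(1) by (intro multiset_eqI) (auto simp: count_hi)
    moreover have "hi c' (mid z) = mid z" unfolding hi_def filter_mset_eq_conv using mid_set by fastforce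
    moreover have "hi c' (lo c' z) = {#}" by (rule multiset_eqI) (auto simp: count_hi count_lo)
    ultimately show ?thesis unfolding E_def by (simp add: hi_def)
  qed
  have lo_E: "lo c' (E z) = lo c' z" for z
  proof -
    have "lo c' (hi c (p' z)) = {#}" using c'(1) by (intro multiset_eqI) (auto simp: count_hi count_lo)
    moreover have "lo c' (mid z) = {#}" unfolding lo_def filter_mset_eq_conv using mid_set by fastforce
    moreover have "lo c' (lo c' z) = lo c' z" by (rule multiset_eqI) (auto simp: count_lo)
    ultimately show ?thesis unfolding E_def by (simp add: lo_def)
  qed
  have hi_z: "hi c' z = hi c z + filter_mset (\<lambda>k. c' \<le> k \<and> k < c) z" for z
    using c'(1) by (intro multiset_eqI) (auto simp: hi_def)
  have E_\<pi>: "E x = x'" if x: "(x, x') \<in> \<pi>" for x x'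
  proof -
    have ex: "?ex x" using p(2)[of x] p_max[OF x, of x] by simp
    then have "hi c (p' x) = hi c x'" using part_isoD(5)[OF \<pi> p(1) x] by blast
    moreover have "filter_mset (\<lambda>k. c' \<le> k \<and> k < c) x + lo c' x = lo c x"
      using c'(1) by (intro multiset_eqI) (auto simp: lo_def)
    ultimately have "E x = hi c x' + lo c x" using ex by (simp add: E_def mid_def add.assoc)
    then show ?thesis using part_isoD(3)[OF \<pi> x] hi_lo by metis
  qed
  have p_eq: "hi c (p z) = hi c (p w)" if "hi c z = hi c w" for z w
    using p_max[OF p(1), of z w] p_max[OF p(1), of w z] p(2)[of z] p(2)[of w] that by simp
  have E_eq: "hi c' (E z) = hi c' (E w)" if eq: "hi c' z = hi c' w" for z w
  proof -
    have eqc: "hi c z = hi c w" using hi_eq_mono[OF less_imp_le[OF c'(1)] eq] .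
    then have "hi c (p' z) = hi c (p' w)" using part_isoD(5)[OF \<pi> p(1) p(1)] p_eq by blast
    moreover have "filter_mset (\<lambda>k. c' \<le> k \<and> k < c) z = filter_mset (\<lambda>k. c' \<le> k \<and> k < c) w"
      using eq eqc unfolding hi_z by simp
    moreover have "r z = r w" unfolding r_def eq ..
    ultimately show ?thesis using eqc p_eq[OF eqc] unfolding hi_E mid_def by simp
  qed
  have E_less: "hi c' (E z) < hi c' (E w)" if z: "z \<in> X" and w: "w \<in> X" and lt: "hi c' z < hi c' w" for z w
  proof -
    have le: "hi c z \<le> hi c w" using hi_mono[OF less_imp_le[OF c'(1)] lt] .
    have ple: "hi c (p z) \<le> hi c (p w)" by (rule p_max[OF p(1)]) (use p(2)[of z] le in simp)
    show ?thesis
    proof (cases "hi c (p z) = hi c (p w)")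
      case False
      then have "hi c (p' z) < hi c (p' w)" using ple part_isoD(4)[OF \<pi> p(1)[of z] p(1)[of w]] by (metis order_le_less)
      then show ?thesis unfolding hi_E
        by (intro hi_less_add[of _ c]) (use mid_set[of z] mid_set[of w] in \<open>auto simp: set_hi\<close>)
    next
      case True
      then have eq: "hi c (p' z) = hi c (p' w)" using part_isoD(5)[OF \<pi> p(1) p(1)] by blast
      have "mid z < mid w"
      proof (cases "?ex z")
        case exz: True
        show ?thesis
        proof (cases "?ex w")
          case exw: True
          then have "hi c z = hi c w" using exz True by simp
          then show ?thesis using lt exz exw unfolding hi_z mid_def by simp
        next
          case False
          have "filter_mset (\<lambda>k. c' \<le> k \<and> k < c) z < replicate_mset (N + r w) \<kappa>"
            by (rule less_replicate_mset) (use \<kappa>_ge[OF z] N[OF z] in \<open>auto\<close>)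
          then show ?thesis using exz False by (simp add: mid_def)
        qed
      next
        case exz: False
        \<comment> \<open>Otherwise the quotient of \<open>w\<close> would equal the matched
          quotient below \<open>z\<close>, so those of \<open>z\<close> and \<open>w\<close> would
          coincide and \<open>z\<close> would be matched too.\<close>
        have exw: "\<not> ?ex w"
        proof
          assume "?ex w"
          then have "hi c w \<le> hi c z" using True p(2)[of z] by simp
          then show False using exz le True \<open>?ex w\<close> by simp
        qed
        have "replicate_mset (N + r z) \<kappa> < replicate_mset (N + r w) \<kappa>"
          by (rule less_replicate_mset) (use r_less[OF z lt] in \<open>auto split: if_splits\<close>)
        then show ?thesis using exz exw by (simp add: mid_def)
      qed
      then show ?thesis unfolding hi_E eq by simp
    qed
  qed
  have EB: "set_mset (E z) \<subseteq> B" if "z \<in> X" for z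
  proof -
    have "set_mset (hi c (p' z)) \<subseteq> B" using part_isoD(2)[OF \<pi> p(1)] by (auto simp: set_hi)
    moreover have "set_mset (mid z) \<subseteq> B" unfolding mid_def using XA[OF that] AB \<kappa>B by auto
    moreover have "set_mset (lo c' z) \<subseteq> B" using XA[OF that] AB c'(1) by (auto simp: set_lo)
    ultimately show ?thesis unfolding E_def by simp
  qed
  have E_iff: "hi c' z < hi c' w \<longleftrightarrow> hi c' (E z) < hi c' (E w)" if "z \<in> X" "w \<in> X" for z w
    using E_less[OF that] E_less[OF that(2,1)] E_eq[of z w] by (metis less_asym less_irrefl linorder_less_linear)
  let ?\<pi> = "(\<lambda>z. (z, E z)) ` X"
  have "part_iso A B c' ?\<pi>"
    unfolding part_iso_def using X XA EB lo_E E_iff E_\<pi>[OF zero] by force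
  moreover have "\<pi> \<subseteq> ?\<pi>" using E_\<pi> by (force simp: X_def)
  moreover have "d \<subseteq> fst ` ?\<pi>" by (auto simp: X_def image_image)
  ultimately show ?thesis by blast
qed

text \<open>Two distinct images of one element would be strictly ordered, but the converse relation
  preserves order as well.\<close>

lemma part_iso_fun:
  assumes "part_iso A B c \<pi>"
  shows "\<exists>p. \<pi> = (\<lambda>x. (x, p x)) ` (fst ` \<pi>)"
proof -
  have "x' = x''" if "(x, x') \<in> \<pi>" "(x, x'') \<in> \<pi>" for x x' x''
    using part_iso_less[OF part_iso_converse[OF assms], of x' x x'' x]
      part_iso_less[OF part_iso_converse[OF assms], of x'' x x' x] that
    by (metis converse_iff less_irrefl linorder_less_linear)
  then have "(THE x'. (x, x') \<in> \<pi>) = x'" if "(x, x') \<in> \<pi>" for x x' using that by blast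
  then show ?thesis by (intro exI[of _ "\<lambda>x. THE x'. (x, x') \<in> \<pi>"]) force
qed

lemma countable_multisets_over: "countable C \<Longrightarrow> countable {m. set_mset m \<subseteq> C}"
proof -
  assume "countable C"
  then have "countable (mset ` lists C)" by simp
  moreover have "{m. set_mset m \<subseteq> C} \<subseteq> mset ` lists C"
  proof
    fix m :: "'a multiset" assume m: "m \<in> {m. set_mset m \<subseteq> C}"
    obtain xs where "mset xs = m" using ex_mset by blast
    then show "m \<in> mset ` lists C" using m by (intro image_eqI[of _ _ xs]) auto
  qed
  ultimately show ?thesis using countable_subset by blast
qed

subsection \<open>Definability in a model with the least element property\<close>

text \<open>Natural numbers serve merely as names of elements; the order of \<open>M\<close> is that
  of \<open>lt\<close>, unrelated to the usual one. With the whole type as universe, the quantifiers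
  of \<open>M\<close> are those of HOL and every assignment is admissible.\<close>

locale lnp_model =
  fixes V :: "('f, 'r) vocab" and lt :: 'r and M :: "('f, 'r, nat) fo_struct"
  assumes countable_V: "countable_vocab V"
    and struct_M: "is_struct V M"
    and universe_M: "universe M = UNIV"
    and lt_in: "lt \<in> rels V" "rarity V lt = 2"
    and lnp: "fm_in V \<phi> \<Longrightarrow> fm_sat M (case_nat x e) \<phi> \<Longrightarrow>
      \<exists>x. fm_sat M (case_nat x e) \<phi> \<and> (\<forall>y. rinterp M lt [y, x] \<longrightarrow> \<not> fm_sat M (case_nat y e) \<phi>)"
    and lt_irrefl: "\<not> rinterp M lt [x, x]"
    and lt_trans: "rinterp M lt [x, y] \<Longrightarrow> rinterp M lt [y, z] \<Longrightarrow> rinterp M lt [x, z]"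
    and lt_total: "rinterp M lt [x, y] \<or> x = y \<or> rinterp M lt [y, x]"
    and lt_pred: "rinterp M lt [y, x] \<Longrightarrow>
      \<exists>y. rinterp M lt [y, x] \<and> \<not> (\<exists>z. rinterp M lt [y, z] \<and> rinterp M lt [z, x])"
    and lt_unbounded: "\<exists>y. rinterp M lt [x, y]"
begin

definition lss :: "nat \<Rightarrow> nat \<Rightarrow> bool" (infix "\<sqsubset>" 50) where "x \<sqsubset> y \<longleftrightarrow> rinterp M lt [x, y]"
definition leq :: "nat \<Rightarrow> nat \<Rightarrow> bool" (infix "\<sqsubseteq>" 50) where "x \<sqsubseteq> y \<longleftrightarrow> x = y \<or> x \<sqsubset> y"

sublocale ord: linorder leq lss
proof
  fix x y z
  show "x \<sqsubset> y \<longleftrightarrow> x \<sqsubseteq> y \<and> \<not> y \<sqsubseteq> x"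
    using lt_irrefl lt_trans unfolding leq_def lss_def by metis
  show "x \<sqsubseteq> x" by (simp add: leq_def)
  show "x \<sqsubseteq> y \<Longrightarrow> y \<sqsubseteq> z \<Longrightarrow> x \<sqsubseteq> z"
    using lt_trans unfolding leq_def lss_def by metis
  show "x \<sqsubseteq> y \<Longrightarrow> y \<sqsubseteq> x \<Longrightarrow> x = y"
    using lt_irrefl lt_trans unfolding leq_def lss_def by metis
  show "x \<sqsubseteq> y \<or> y \<sqsubseteq> x"
    using lt_total unfolding leq_def lss_def by metis
qed

text \<open>\<open>dfn P\<close>: the relation \<open>P\<close>, with argument places indexed by an arbitrary type, is definable in \<open>M\<close> with
  parameters. Quantification over one more place is over the index type extended by \<open>None\<close>.\<close>

definition dfn :: "(('i \<Rightarrow> nat) \<Rightarrow> bool) \<Rightarrow> bool" where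
  "dfn P \<longleftrightarrow> (\<exists>\<phi> \<rho>. fm_in V \<phi> \<and> P = (\<lambda>e. fm_sat M (\<lambda>n. case_sum e id (\<rho> n)) \<phi>))"

lemma dfnI: "fm_in V \<phi> \<Longrightarrow> P = (\<lambda>e. fm_sat M (\<lambda>n. case_sum e id (\<rho> n)) \<phi>) \<Longrightarrow> dfn P"
  unfolding dfn_def by blast

text \<open>Arguments that are places or constants can be substituted by renaming alone;
  substituting a definable function costs a quantifier and is the subject of
  \<open>dfn_subst_dtm\<close>.\<close>

definition var_or_const :: "(('i \<Rightarrow> nat) \<Rightarrow> nat) \<Rightarrow> bool" where
  "var_or_const t \<longleftrightarrow> (\<exists>x. t = (\<lambda>e. case_sum e id x))"

lemma voc_var: "var_or_const (\<lambda>e. e i)"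
  unfolding var_or_const_def by (rule exI[of _ "Inl i"]) simp

lemma voc_const: "var_or_const (\<lambda>e. a)"
  unfolding var_or_const_def by (rule exI[of _ "Inr a"]) simp

lemma voc_option:
  "var_or_const s \<Longrightarrow> (\<And>i. var_or_const (t i)) \<Longrightarrow> var_or_const (\<lambda>e. case x of None \<Rightarrow> s e | Some i \<Rightarrow> t i e)"
  by (cases x) simp_all

lemma dfn_fm:
  assumes "fm_in V \<phi>" "\<And>n. var_or_const (t n)"
  shows "dfn (\<lambda>e. fm_sat M (\<lambda>n. t n e) \<phi>)"
proof -
  obtain \<rho> where "t n = (\<lambda>e. case_sum e id (\<rho> n))" for n
    using assms(2) unfolding var_or_const_def by metis
  then show ?thesis unfolding dfn_def using assms(1) by auto
qed

lemma voc_comp: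
  assumes "var_or_const s" "\<And>j. var_or_const (t j)"
  shows "var_or_const (\<lambda>e. s (\<lambda>j. t j e))"
proof -
  obtain x where x: "s = (\<lambda>e. case_sum e id x)" using assms(1) unfolding var_or_const_def by blast
  show ?thesis
  proof (cases x)
    case (Inl j)
    then show ?thesis using assms(2)[of j] x by simp
  next
    case (Inr a)
    then show ?thesis using voc_const[of a] x by simp
  qed
qed

lemma dfn_subst:
  assumes "dfn P" "\<And>j. var_or_const (t j)"
  shows "dfn (\<lambda>e. P (\<lambda>j. t j e))"
proof -
  obtain \<phi> \<rho> where *: "fm_in V \<phi>" "P = (\<lambda>e. fm_sat M (\<lambda>n. case_sum e id (\<rho> n)) \<phi>)"
    using assms(1) unfolding dfn_def by blast
  have "var_or_const (\<lambda>e. case_sum (\<lambda>j. t j e) id (\<rho> n))" for n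
    by (rule voc_comp[OF _ assms(2)]) (auto simp: var_or_const_def)
  from dfn_fm[OF *(1) this] show ?thesis by (simp add: *(2))
qed

section \<open>Closure of definability under connectives and quantifiers\<close>

lemma dfn_imp:
  assumes "dfn P" "dfn Q"
  shows "dfn (\<lambda>e. P e \<longrightarrow> Q e)"
proof -
  obtain \<phi> \<rho> where *: "fm_in V \<phi>" "P = (\<lambda>e. fm_sat M (\<lambda>n. case_sum e id (\<rho> n)) \<phi>)"
    using assms(1) unfolding dfn_def by blast
  obtain \<psi> \<rho>' where **: "fm_in V \<psi>" "Q = (\<lambda>e. fm_sat M (\<lambda>n. case_sum e id (\<rho>' n)) \<psi>)"
    using assms(2) unfolding dfn_def by blast
  \<comment> \<open>Even and odd variables keep the two formulas apart, each with its own places and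
    parameters.\<close>
  let ?\<rho> = "\<lambda>n. if even n then \<rho> (n div 2) else \<rho>' (n div 2)"
  let ?\<chi> = "Imp (fm_subst (\<lambda>n. Var (2 * n)) \<phi>) (fm_subst (\<lambda>n. Var (2 * n + 1)) \<psi>)"
  have "fm_in V ?\<chi>" using * ** by (simp add: fm_in_subst)
  moreover have "(\<lambda>e. P e \<longrightarrow> Q e) = (\<lambda>e. fm_sat M (\<lambda>n. case_sum e id (?\<rho> n)) ?\<chi>)"
    by (simp add: *(2) **(2) fm_sat_subst)
  ultimately show ?thesis by (rule dfnI)
qed

lemma dfn_const: "dfn (\<lambda>e. c)"
proof -
  have "dfn (\<lambda>e. fm_sat M (\<lambda>n. 0) (if c then Neg Fls else Fls))"
    by (rule dfn_fm) (auto intro: voc_const)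
  then show ?thesis by (cases c) auto
qed

text \<open>Turns the place \<open>None\<close> into de Bruijn index 0, so that quantification over
  it is the quantifier of the language. The value \<open>Inr 0\<close> in \<open>\<rho>'\<close> is
  a dummy, as the variables concerned are renamed to 0.\<close>

lemma dfn_optionE:
  assumes "dfn (\<lambda>e :: 'i option \<Rightarrow> nat. P (e None) (\<lambda>i. e (Some i)))"
  obtains \<phi> \<rho> where "fm_in V \<phi>" "\<And>a e. P a e = fm_sat M (case_nat a (\<lambda>n. case_sum e id (\<rho> n))) \<phi>"
proof -
  obtain \<phi> \<rho> where *: "fm_in V \<phi>"
    "(\<lambda>e :: 'i option \<Rightarrow> nat. P (e None) (\<lambda>i. e (Some i))) = (\<lambda>e. fm_sat M (\<lambda>n. case_sum e id (\<rho> n)) \<phi>)"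
    using assms unfolding dfn_def by blast
  define \<rho>' :: "nat \<Rightarrow> 'i + nat" where
    "\<rho>' n = (case \<rho> n of Inl (Some i) \<Rightarrow> Inl i | Inl None \<Rightarrow> Inr 0 | Inr a \<Rightarrow> Inr a)" for n
  let ?\<sigma> = "\<lambda>n. if \<rho> n = Inl None then Var 0 else Var (Suc n)"
  have "(\<lambda>n. tm_val M (case_nat a (\<lambda>n. case_sum e id (\<rho>' n))) (?\<sigma> n)) = (\<lambda>n. case_sum (case_option a e) id (\<rho> n))" for a e
    by (rule ext) (auto simp: \<rho>'_def split: sum.split option.split)
  then have "P a e = fm_sat M (case_nat a (\<lambda>n. case_sum e id (\<rho>' n))) (fm_subst ?\<sigma> \<phi>)" for a e
    using fun_cong[OF *(2), of "case_option a e"] by (simp add: fm_sat_subst)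
  moreover have "fm_in V (fm_subst ?\<sigma> \<phi>)" using *(1) by (simp add: fm_in_subst)
  ultimately show ?thesis using that by blast
qed

lemma dfn_all:
  assumes "dfn (\<lambda>e :: 'i option \<Rightarrow> nat. P (e None) (\<lambda>i. e (Some i)))"
  shows "dfn (\<lambda>e. \<forall>a. P a e)"
proof -
  obtain \<phi> \<rho> where "fm_in V \<phi>" "\<And>a e. P a e = fm_sat M (case_nat a (\<lambda>n. case_sum e id (\<rho> n))) \<phi>"
    using dfn_optionE[OF assms] by metis
  then show ?thesis using dfnI[of "All \<phi>" "\<lambda>e. \<forall>a. P a e" \<rho>] by (simp add: universe_M)
qed

lemma dfn_not: "dfn P \<Longrightarrow> dfn (\<lambda>e. \<not> P e)"
  using dfn_imp[OF _ dfn_const[of False]] by simp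

lemma dfn_disj: "dfn P \<Longrightarrow> dfn Q \<Longrightarrow> dfn (\<lambda>e. P e \<or> Q e)"
  using dfn_imp[OF dfn_not] by (simp add: disj_imp)

lemma dfn_conj: "dfn P \<Longrightarrow> dfn Q \<Longrightarrow> dfn (\<lambda>e. P e \<and> Q e)"
  using dfn_not[OF dfn_imp[OF _ dfn_not]] by simp

lemma dfn_iff: "dfn P \<Longrightarrow> dfn Q \<Longrightarrow> dfn (\<lambda>e. P e \<longleftrightarrow> Q e)"
  using dfn_conj[OF dfn_imp dfn_imp] by (simp add: iff_conv_conj_imp)

lemma dfn_ex:
  assumes "dfn (\<lambda>e :: 'i option \<Rightarrow> nat. P (e None) (\<lambda>i. e (Some i)))"
  shows "dfn (\<lambda>e. \<exists>a. P a e)"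
  using dfn_not[OF dfn_all[of "\<lambda>a e. \<not> P a e", OF dfn_not[OF assms]]] by simp

section \<open>Definable functions\<close>

definition dtm :: "(('i \<Rightarrow> nat) \<Rightarrow> nat) \<Rightarrow> bool" where
  "dtm t \<longleftrightarrow> dfn (\<lambda>e :: 'i option \<Rightarrow> nat. e None = t (\<lambda>i. e (Some i)))"

lemma dfn_eq_voc: "var_or_const s \<Longrightarrow> var_or_const t \<Longrightarrow> dfn (\<lambda>e. s e = t e)"
  using dfn_fm[of "Eq (Var 0) (Var 1)" "\<lambda>n. if n = 0 then s else t"] by simp

lemma dtm_voc: "var_or_const t \<Longrightarrow> dtm t"
  unfolding dtm_def by (rule dfn_eq_voc[OF voc_var voc_comp[OF _ voc_var]])

lemma dtm_var: "dtm (\<lambda>e. e i)" and dtm_const: "dtm (\<lambda>e. a)"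
  by (auto intro: dtm_voc voc_var voc_const)

lemma dfn_let:
  assumes "dfn (\<lambda>e :: 'i option \<Rightarrow> nat. P (e None) (\<lambda>i. e (Some i)))" "dtm t"
  shows "dfn (\<lambda>e. P (t e) e)"
  using dfn_ex[of "\<lambda>a e. a = t e \<and> P a e"] dfn_conj[OF assms(2)[unfolded dtm_def] assms(1)] by simp

lemma dtm_lift:
  assumes "dtm t"
  shows "dtm (\<lambda>e. t (\<lambda>i. e (g i)))"
proof -
  from dfn_subst[OF assms[unfolded dtm_def], of "\<lambda>x e. case x of None \<Rightarrow> e None | Some i \<Rightarrow> e (Some (g i))",
      OF voc_option[OF voc_var voc_var]]
  show ?thesis unfolding dtm_def by simp
qed

lemma dfn_upd:
  assumes "dfn P"
  shows "dfn (\<lambda>e. P ((\<lambda>i. e (Some i))(j := e None)))"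
proof -
  have "var_or_const (\<lambda>e :: 'a option \<Rightarrow> nat. ((\<lambda>i. e (Some i))(j := e None)) i)" for i
    by (cases "i = j") (simp_all add: voc_var)
  from dfn_subst[OF assms, of "\<lambda>i e. ((\<lambda>i. e (Some i))(j := e None)) i", OF this]
  show ?thesis .
qed

lemma dfn_ex_at: "dfn P \<Longrightarrow> dfn (\<lambda>e. \<exists>a. P (e(j := a)))"
  by (rule dfn_ex) (rule dfn_upd)

text \<open>One variable of \<open>\<phi>\<close> after the other is bound and required to equal the
  value of its function. Places \<open>Inl\<close> hold the arguments of the result,
  \<open>Inr n\<close> the variables not yet replaced; \<open>\<phi>\<close> has finitely many, so
  the process ends.\<close>

lemma dfn_fm_dtm:
  fixes t :: "nat \<Rightarrow> ('i \<Rightarrow> nat) \<Rightarrow> nat"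
  assumes "fm_in V \<phi>" "\<And>n. dtm (t n)"
  shows "dfn (\<lambda>e. fm_sat M (\<lambda>n. t n e) \<phi>)"
proof -
  define Q where "Q S e = fm_sat M (\<lambda>n. if n \<in> S then t n (\<lambda>i. e (Inl i)) else e (Inr n)) \<phi>"
    for S and e :: "'i + nat \<Rightarrow> nat"
  have Q: "dfn (Q S)" if "finite S" for S
    using that
  proof (induction S)
    case empty
    have "Q {} = (\<lambda>e. fm_sat M (\<lambda>n. e (Inr n)) \<phi>)" by (rule ext) (simp add: Q_def)
    then show ?case using dfn_fm[OF assms(1), of "\<lambda>n e. e (Inr n)", OF voc_var] by simp
  next
    case (insert m S)
    have graph: "dfn (\<lambda>e :: 'i + nat \<Rightarrow> nat. e (Inr m) = t m (\<lambda>i. e (Inl i)))"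
      using dfn_subst[OF assms(2)[unfolded dtm_def, of m],
          of "\<lambda>x e. case x of None \<Rightarrow> e (Inr m) | Some i \<Rightarrow> e (Inl i)", OF voc_option[OF voc_var voc_var]]
      by simp
    have "Q (insert m S) = (\<lambda>e. \<exists>a. (e(Inr m := a)) (Inr m) = t m (\<lambda>i. (e(Inr m := a)) (Inl i)) \<and> Q S (e(Inr m := a)))"
    proof (rule ext)
      fix e :: "'i + nat \<Rightarrow> nat"
      have "(\<lambda>n. if n \<in> S then t n (\<lambda>i. (e(Inr m := t m (\<lambda>i. e (Inl i)))) (Inl i))
          else (e(Inr m := t m (\<lambda>i. e (Inl i)))) (Inr n)) =
        (\<lambda>n. if n \<in> insert m S then t n (\<lambda>i. e (Inl i)) else e (Inr n))"
        using insert.hyps by auto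
      then show "Q (insert m S) e = (\<exists>a. (e(Inr m := a)) (Inr m) = t m (\<lambda>i. (e(Inr m := a)) (Inl i)) \<and> Q S (e(Inr m := a)))"
        by (simp add: Q_def)
    qed
    then show ?case using dfn_ex_at[OF dfn_conj[OF graph insert.IH], of "Inr m"] by (simp only:)
  qed
  have "var_or_const (\<lambda>e :: 'i \<Rightarrow> nat. case_sum e (\<lambda>_. 0) x)" for x
    by (cases x) (simp_all add: voc_var voc_const)
  from dfn_subst[OF Q[OF finite_fm_vars], of "\<lambda>x e. case_sum e (\<lambda>_. 0) x", OF this]
  have "dfn (\<lambda>e :: 'i \<Rightarrow> nat. Q (fm_vars \<phi>) (\<lambda>x. case_sum e (\<lambda>_. 0) x))" .
  moreover have "Q (fm_vars \<phi>) (\<lambda>x. case_sum e (\<lambda>_. 0) x) = fm_sat M (\<lambda>n. t n e) \<phi>" for e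
    unfolding Q_def by (rule fm_sat_cong) simp
  ultimately show ?thesis by simp
qed

lemma dfn_subst_dtm:
  assumes "dfn P" "\<And>j. dtm (t j)"
  shows "dfn (\<lambda>e. P (\<lambda>j. t j e))"
proof -
  obtain \<phi> \<rho> where *: "fm_in V \<phi>" "P = (\<lambda>e. fm_sat M (\<lambda>n. case_sum e id (\<rho> n)) \<phi>)"
    using assms(1) unfolding dfn_def by blast
  have "dtm (\<lambda>e. case_sum (\<lambda>j. t j e) id (\<rho> n))" for n
    by (cases "\<rho> n") (simp_all add: assms(2) dtm_const)
  from dfn_fm_dtm[OF *(1) this] show ?thesis by (simp add: *(2))
qed

lemma dtm_subst:
  assumes "dtm s" "\<And>j. dtm (t j)"
  shows "dtm (\<lambda>e. s (\<lambda>j. t j e))"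
proof -
  have "dtm (\<lambda>e :: 'b option \<Rightarrow> nat. case x of None \<Rightarrow> e None | Some j \<Rightarrow> t j (\<lambda>i. e (Some i)))" for x
    by (cases x) (simp_all add: dtm_var dtm_lift assms(2))
  from dfn_subst_dtm[OF assms(1)[unfolded dtm_def],
      of "\<lambda>x e. case x of None \<Rightarrow> e None | Some j \<Rightarrow> t j (\<lambda>i. e (Some i))", OF this]
  show ?thesis unfolding dtm_def by simp
qed

lemma dtm_finterp:
  assumes "f \<in> funs V" "length ts = farity V f" "\<And>t. t \<in> set ts \<Longrightarrow> dtm t"
  shows "dtm (\<lambda>e. finterp M f (map (\<lambda>t. t e) ts))"
proof -
  let ?l = "length ts"
  let ?\<phi> = "Eq (Var 0) (Fn f (map (\<lambda>n. Var (Suc n)) [0..<?l]))"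
  let ?t = "\<lambda>n. case n of 0 \<Rightarrow> (\<lambda>e. e None) | Suc n \<Rightarrow> (if n < ?l then (\<lambda>e. (ts ! n) (\<lambda>i. e (Some i))) else (\<lambda>e. 0))"
  have "dfn (\<lambda>e. fm_sat M (\<lambda>n. ?t n e) ?\<phi>)"
    by (rule dfn_fm_dtm)
      (use assms in \<open>auto simp: list_all_iff dtm_var dtm_const dtm_lift split: nat.split\<close>)
  moreover have "map (tm_val M (\<lambda>n. ?t n e)) (map (\<lambda>n. Var (Suc n)) [0..<?l]) = map (\<lambda>t. t (\<lambda>i. e (Some i))) ts" for e
    by (auto intro: nth_equalityI)
  ultimately show ?thesis unfolding dtm_def by (simp add: comp_def)
qed

lemma dfn_rinterp:
  assumes "r \<in> rels V" "length ts = rarity V r" "\<And>t. t \<in> set ts \<Longrightarrow> dtm t"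
  shows "dfn (\<lambda>e. rinterp M r (map (\<lambda>t. t e) ts))"
proof -
  let ?l = "length ts"
  let ?t = "\<lambda>n. if n < ?l then ts ! n else (\<lambda>e. 0)"
  have "dfn (\<lambda>e. fm_sat M (\<lambda>n. ?t n e) (Rel r (map Var [0..<?l])))"
    by (rule dfn_fm_dtm) (use assms in \<open>auto simp: list_all_iff dtm_const\<close>)
  moreover have "map (tm_val M (\<lambda>n. ?t n e)) (map Var [0..<?l]) = map (\<lambda>t. t e) ts" for e
    by (auto intro: nth_equalityI)
  ultimately show ?thesis by (simp add: comp_def)
qed

lemma dfn_lss: "dtm s \<Longrightarrow> dtm t \<Longrightarrow> dfn (\<lambda>e. s e \<sqsubset> t e)"
  using dfn_rinterp[of lt "[s, t]"] lt_in unfolding lss_def by auto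

lemma dfn_eq: "dtm s \<Longrightarrow> dtm t \<Longrightarrow> dfn (\<lambda>e. s e = t e)"
  using dfn_fm_dtm[of "Eq (Var 0) (Var 1)" "\<lambda>n. if n = 0 then s else t"] by simp

lemma dfn_leq: "dtm s \<Longrightarrow> dtm t \<Longrightarrow> dfn (\<lambda>e. s e \<sqsubseteq> t e)"
  unfolding leq_def by (intro dfn_disj dfn_eq dfn_lss)

definition dfn1 :: "(nat \<Rightarrow> bool) \<Rightarrow> bool" where "dfn1 X \<longleftrightarrow> dfn (\<lambda>e :: nat \<Rightarrow> nat. X (e 0))"
definition dfn2 :: "(nat \<Rightarrow> nat \<Rightarrow> bool) \<Rightarrow> bool" where "dfn2 R \<longleftrightarrow> dfn (\<lambda>e :: nat \<Rightarrow> nat. R (e 0) (e 1))"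
definition dfn3 :: "(nat \<Rightarrow> nat \<Rightarrow> nat \<Rightarrow> bool) \<Rightarrow> bool" where
  "dfn3 R \<longleftrightarrow> dfn (\<lambda>e :: nat \<Rightarrow> nat. R (e 0) (e 1) (e 2))"
definition dfun1 :: "(nat \<Rightarrow> nat) \<Rightarrow> bool" where "dfun1 f \<longleftrightarrow> dtm (\<lambda>e :: nat \<Rightarrow> nat. f (e 0))"

lemma dfn1D: "dfn1 X \<Longrightarrow> dtm s \<Longrightarrow> dfn (\<lambda>e. X (s e))"
  unfolding dfn1_def by (drule dfn_subst_dtm[where t = "\<lambda>_. s"]) auto

lemma dfn2D: "dfn2 R \<Longrightarrow> dtm s \<Longrightarrow> dtm t \<Longrightarrow> dfn (\<lambda>e. R (s e) (t e))"
  unfolding dfn2_def by (drule dfn_subst_dtm[where t = "\<lambda>n. if n = 0 then s else t"]) auto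

lemma dfn3D: "dfn3 R \<Longrightarrow> dtm s \<Longrightarrow> dtm t \<Longrightarrow> dtm u \<Longrightarrow> dfn (\<lambda>e. R (s e) (t e) (u e))"
  unfolding dfn3_def
  by (drule dfn_subst_dtm[where t = "\<lambda>n. if n = 0 then s else if n = 1 then t else u"]) auto

lemma dfun1D: "dfun1 f \<Longrightarrow> dtm s \<Longrightarrow> dtm (\<lambda>e. f (s e))"
  unfolding dfun1_def by (drule dtm_subst[where t = "\<lambda>_. s"]) auto

lemmas dfn_intros = dfn_imp dfn_not dfn_disj dfn_conj dfn_iff dfn_all dfn_ex dfn_eq dfn_lss dfn_leq
  dtm_var dtm_const

section \<open>Least elements, induction and definable choice\<close>

lemma least_dfn:
  assumes "dfn1 X" "X a"
  obtains x where "X x" "\<And>y. y \<sqsubset> x \<Longrightarrow> \<not> X y"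
proof -
  obtain \<phi> \<rho> where *: "fm_in V \<phi>" "(\<lambda>e :: nat \<Rightarrow> nat. X (e 0)) = (\<lambda>e. fm_sat M (\<lambda>n. case_sum e id (\<rho> n)) \<phi>)"
    using assms(1) unfolding dfn1_def dfn_def by blast
  let ?\<sigma> = "\<lambda>n. case \<rho> n of Inl _ \<Rightarrow> Var 0 | Inr _ \<Rightarrow> Var (Suc n)"
  let ?e = "\<lambda>n. case_sum (\<lambda>_. 0) id (\<rho> n)"
  have "(\<lambda>n. tm_val M (case_nat x ?e) (?\<sigma> n)) = (\<lambda>n. case_sum (\<lambda>_. x) id (\<rho> n))" for x
    by (rule ext) (simp split: sum.split)
  then have X: "X x \<longleftrightarrow> fm_sat M (case_nat x ?e) (fm_subst ?\<sigma> \<phi>)" for x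
    using fun_cong[OF *(2), of "\<lambda>_. x"] by (simp add: fm_sat_subst)
  have "fm_in V (fm_subst ?\<sigma> \<phi>)" using *(1) by (auto intro!: fm_in_subst split: sum.split)
  from lnp[OF this] assms(2) that show ?thesis unfolding X lss_def by blast
qed

text \<open>A least counterexample is not minimal, and its immediate predecessor satisfies
  \<open>P\<close>. The predecessor \<open>y\<close> of \<open>x\<close> is described by the order,
  as the vocabulary need not have a successor function.\<close>

lemma dfn_induct:
  assumes "dfn1 P" and "\<And>x. (\<And>y. \<not> y \<sqsubset> x) \<Longrightarrow> P x"
    and "\<And>x y. y \<sqsubset> x \<Longrightarrow> (\<And>z. z \<sqsubset> x \<Longrightarrow> z \<sqsubseteq> y) \<Longrightarrow> P y \<Longrightarrow> P x"
  shows "P a"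
proof (rule ccontr)
  assume "\<not> P a"
  moreover have "dfn1 (\<lambda>x. \<not> P x)" using assms(1) unfolding dfn1_def by (rule dfn_not)
  ultimately obtain x where x: "\<not> P x" "\<And>y. y \<sqsubset> x \<Longrightarrow> P y" using least_dfn[of "\<lambda>x. \<not> P x"] by metis
  show False
  proof (cases "\<exists>y. y \<sqsubset> x")
    case True
    then obtain y where "y \<sqsubset> x" "\<not> (\<exists>z. y \<sqsubset> z \<and> z \<sqsubset> x)" using lt_pred unfolding lss_def by blast
    then show False using assms(3)[of y x] x ord.not_less by blast
  qed (use assms(2) x in blast)
qed

text \<open>The source of definable Skolem functions: witnesses for the existential quantifier are
  chosen as least ones throughout.\<close>

definition mu :: "(nat \<Rightarrow> bool) \<Rightarrow> nat" where "mu X = (THE x. X x \<and> (\<forall>y. y \<sqsubset> x \<longrightarrow> \<not> X y))"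

lemma mu_eq: "X x \<Longrightarrow> (\<And>y. y \<sqsubset> x \<Longrightarrow> \<not> X y) \<Longrightarrow> mu X = x"
  unfolding mu_def by (rule the_equality) (use ord.less_linear in blast)+

lemma mu: assumes "dfn1 X" "X a" shows mu_holds: "X (mu X)" and mu_le: "X b \<Longrightarrow> mu X \<sqsubseteq> b"
proof -
  obtain x where "X x" "\<And>y. y \<sqsubset> x \<Longrightarrow> \<not> X y" using least_dfn[OF assms] by metis
  then show "X (mu X)" "X b \<Longrightarrow> mu X \<sqsubseteq> b" using mu_eq[of X x] ord.not_less by auto
qed

lemma dtm_mu:
  assumes "dfn (\<lambda>e :: 'i option \<Rightarrow> nat. P (e None) (\<lambda>i. e (Some i)))" "\<And>e. \<exists>a. P a e"
  shows "dtm (\<lambda>e. mu (\<lambda>a. P a e))"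
proof -
  have d: "dfn1 (\<lambda>a. P a e)" for e
    using dfn_subst[OF assms(1), of "\<lambda>x e'. case x of None \<Rightarrow> e' 0 | Some i \<Rightarrow> e i",
        OF voc_option[OF voc_var voc_const]]
    unfolding dfn1_def by simp
  have eq: "a = mu (\<lambda>a. P a e) \<longleftrightarrow> P a e \<and> (\<forall>b. b \<sqsubset> a \<longrightarrow> \<not> P b e)" for a e
    using assms(2)[of e] mu[OF d[of e]] mu_eq[of "\<lambda>a. P a e"] ord.not_less by metis
  have "dfn (\<lambda>e :: 'i option option \<Rightarrow> nat. P (e None) (\<lambda>i. e (Some (Some i))))"
    using dfn_subst[OF assms(1), of "\<lambda>x e'. case x of None \<Rightarrow> e' None | Some i \<Rightarrow> e' (Some (Some i))",
        OF voc_option[OF voc_var voc_var]]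
    by simp
  then show ?thesis unfolding dtm_def eq by (intro dfn_intros assms(1))
qed

lemma dfn_finite_support:
  assumes "dfn P"
  shows "\<exists>S. finite S \<and> (\<forall>e e'. (\<forall>i\<in>S. e i = e' i) \<longrightarrow> P e = P e')"
proof -
  obtain \<phi> \<rho> where *: "fm_in V \<phi>" "P = (\<lambda>e. fm_sat M (\<lambda>n. case_sum e id (\<rho> n)) \<phi>)"
    using assms(1) unfolding dfn_def by blast
  let ?S = "\<Union>n\<in>fm_vars \<phi>. case_sum (\<lambda>i. {i}) (\<lambda>_. {}) (\<rho> n)"
  have "finite ?S" by (rule finite_UN_I[OF finite_fm_vars]) (simp split: sum.split)
  moreover have "P e = P e'" if "\<forall>i\<in>?S. e i = e' i" for e e'
    unfolding *(2) by (rule fm_sat_cong) (use that in \<open>force split: sum.splits\<close>)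
  ultimately show ?thesis by blast
qed

end

subsection \<open>A definable minimal type\<close>

context lnp_model
begin

section \<open>Cofinal sets and the pigeonhole principle on boxes\<close>

definition cof :: "(nat \<Rightarrow> bool) \<Rightarrow> bool" where "cof X \<longleftrightarrow> (\<forall>w. \<exists>z. w \<sqsubseteq> z \<and> X z)"

lemma cof_mono: "cof X \<Longrightarrow> (\<And>z. X z \<Longrightarrow> Y z) \<Longrightarrow> cof Y"
  unfolding cof_def by blast

lemma cof_split: "cof X \<Longrightarrow> cof (\<lambda>z. X z \<and> P z) \<or> cof (\<lambda>z. X z \<and> \<not> P z)"
  unfolding cof_def by (metis ord.linear ord.order_trans)

lemma dfn_all_at: "dfn P \<Longrightarrow> dfn (\<lambda>e. \<forall>a. P (e(j := a)))"
  using dfn_not[OF dfn_ex_at[OF dfn_not, of P j]] by simp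

text \<open>\<open>boxeq R js w z z' e\<close>: the sets \<open>R z\<close> and \<open>R z'\<close> agree at all points whose coordinates in \<open>js\<close> are
  bounded by \<open>w\<close> and whose other coordinates are those of \<open>e\<close>.\<close>

primrec boxeq :: "(nat \<Rightarrow> (nat \<Rightarrow> nat) \<Rightarrow> bool) \<Rightarrow> nat list \<Rightarrow> nat \<Rightarrow> nat \<Rightarrow> nat \<Rightarrow> (nat \<Rightarrow> nat) \<Rightarrow> bool" where
  "boxeq R [] w z z' e = (R z e \<longleftrightarrow> R z' e)"
| "boxeq R (j # js) w z z' e = (\<forall>a. a \<sqsubseteq> w \<longrightarrow> boxeq R js w z z' (e(j := a)))"

lemma boxeq_refl: "boxeq R js w z z e"
  by (induction js arbitrary: e) auto

lemma boxeq_sym: "boxeq R js w z z' e \<Longrightarrow> boxeq R js w z' z e"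
  by (induction js arbitrary: e) auto

lemma boxeq_trans: "boxeq R js w z z' e \<Longrightarrow> boxeq R js w z' z'' e \<Longrightarrow> boxeq R js w z z'' e"
  by (induction js arbitrary: e) auto

lemma boxeq_mono: "boxeq R js w z z' e \<Longrightarrow> v \<sqsubseteq> w \<Longrightarrow> boxeq R js v z z' e"
  by (induction js arbitrary: e) (auto intro: ord.order_trans)

lemma boxeqD:
  "boxeq R js w z z' e \<Longrightarrow> (\<And>j. j \<in> set js \<Longrightarrow> e' j \<sqsubseteq> w) \<Longrightarrow> (\<And>n. n \<notin> set js \<Longrightarrow> e' n = e n) \<Longrightarrow>
    R z e' \<longleftrightarrow> R z' e'"
proof (induction js arbitrary: e)
  case Nil
  then have "e' = e" by auto
  then show ?case using Nil by simp
next
  case (Cons j js)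
  have "boxeq R js w z z' (e(j := e' j))" using Cons.prems(1,2) by simp
  then show ?case by (rule Cons.IH) (use Cons.prems(2,3) in auto)
qed

definition dfnR :: "(nat \<Rightarrow> (nat \<Rightarrow> nat) \<Rightarrow> bool) \<Rightarrow> bool" where
  "dfnR R \<longleftrightarrow> dfn (\<lambda>e :: nat option \<Rightarrow> nat. R (e None) (\<lambda>n. e (Some n)))"

lemma dtm_option: "dtm s \<Longrightarrow> (\<And>i. dtm (t i)) \<Longrightarrow> dtm (\<lambda>e. case x of None \<Rightarrow> s e | Some i \<Rightarrow> t i e)"
  by (cases x) simp_all

lemma dfnRD: "dfnR R \<Longrightarrow> dtm s \<Longrightarrow> (\<And>n. dtm (t n)) \<Longrightarrow> dfn (\<lambda>e. R (s e) (\<lambda>n. t n e))"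
  using dfn_subst_dtm[of "\<lambda>e :: nat option \<Rightarrow> nat. R (e None) (\<lambda>n. e (Some n))"
      "\<lambda>x e. case x of None \<Rightarrow> s e | Some n \<Rightarrow> t n e", OF _ dtm_option] unfolding dfnR_def by simp

lemma dfn_boxeq_base:
  assumes "dfnR R"
  shows "dfn (\<lambda>x :: nat + nat \<Rightarrow> nat. boxeq R js (x (Inr 0)) (x (Inr 1)) (x (Inr 2)) (\<lambda>n. x (Inl n)))"
proof (induction js)
  case Nil
  show ?case unfolding boxeq.simps by (intro dfn_iff dfnRD[OF assms] dtm_var)
next
  case (Cons j js)
  have "dfn (\<lambda>x :: nat + nat \<Rightarrow> nat. x (Inl j) \<sqsubseteq> x (Inr 0) \<longrightarrow>
      boxeq R js (x (Inr 0)) (x (Inr 1)) (x (Inr 2)) (\<lambda>n. x (Inl n)))"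
    by (intro dfn_imp dfn_leq dtm_var Cons.IH)
  from dfn_all_at[OF this, of "Inl j"]
  have "dfn (\<lambda>x :: nat + nat \<Rightarrow> nat. \<forall>a. a \<sqsubseteq> x (Inr 0) \<longrightarrow>
      boxeq R js (x (Inr 0)) (x (Inr 1)) (x (Inr 2)) (\<lambda>n. (x(Inl j := a)) (Inl n)))" by simp
  moreover have "(\<lambda>n. (x(Inl j := a)) (Inl n)) = (\<lambda>n. x (Inl n))(j := a)" for a and x :: "nat + nat \<Rightarrow> nat"
    by auto
  ultimately show ?case by simp
qed

lemma dfn_boxeq:
  assumes "dfnR R" "dtm w" "dtm z" "dtm z'" "\<And>n. dtm (t n)"
  shows "dfn (\<lambda>x. boxeq R js (w x) (z x) (z' x) (\<lambda>n. t n x))"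
proof -
  have "dtm (\<lambda>x. case y of Inl n \<Rightarrow> t n x | Inr k \<Rightarrow> if k = 0 then w x else if k = 1 then z x else z' x)"
    for y :: "nat + nat"
    using assms by (cases y; cases "y = Inr 0"; cases "y = Inr 1") simp_all
  from dfn_subst_dtm[OF dfn_boxeq_base[OF assms(1), of js],
      of "\<lambda>y x. case y of Inl n \<Rightarrow> t n x | Inr k \<Rightarrow> if k = 0 then w x else if k = 1 then z x else z' x", OF this]
  show ?thesis by simp
qed

lemma dtm_upd: "dtm s \<Longrightarrow> (\<And>m. dtm (t m)) \<Longrightarrow> dtm (\<lambda>x. ((\<lambda>m. t m x)(j := s x)) n)"
  by (cases "n = j") simp_all

text \<open>Subsets of a box cannot be counted inside \<open>M\<close>, so induction on the number
  of coordinates takes the place of counting. For a coordinate \<open>j\<close>, definable induction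
  on \<open>b\<close> secures agreement at all values up to \<open>b\<close>, shrinking the cofinal
  set once per step; the statement is definable because cofinality is first-order.\<close>

lemma boxeq_pigeonhole:
  assumes R: "dfnR R"
  shows "dfn1 X \<Longrightarrow> cof X \<Longrightarrow> \<exists>z. X z \<and> cof (\<lambda>z'. X z' \<and> boxeq R js w z z' e)"
proof (induction js arbitrary: X e)
  case Nil
  show ?case
  proof (cases "cof (\<lambda>z. X z \<and> R z e)")
    case True
    then obtain z where "X z \<and> R z e" unfolding cof_def by blast
    then show ?thesis using cof_mono[OF True, of "\<lambda>z'. X z' \<and> boxeq R [] w z z' e"] by auto
  next
    case False
    then have *: "cof (\<lambda>z. X z \<and> \<not> R z e)" using cof_split[OF Nil(2), of "\<lambda>z. R z e"] by blast
    then obtain z where "X z \<and> \<not> R z e" unfolding cof_def by blast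
    then show ?thesis using cof_mono[OF *, of "\<lambda>z'. X z' \<and> boxeq R [] w z z' e"] by auto
  qed
next
  case (Cons j js)
  let ?E = "\<lambda>b z z'. \<forall>a. a \<sqsubseteq> b \<longrightarrow> boxeq R js w z z' (e(j := a))"
  have dE: "dfn (\<lambda>x. ?E (s x) (t x) (u x))" if "dtm s" "dtm t" "dtm u" for s t u :: "('i \<Rightarrow> nat) \<Rightarrow> nat"
    by (rule dfn_all, rule dfn_imp, rule dfn_leq[OF dtm_var dtm_lift[OF that(1)]],
        rule dfn_boxeq[OF R dtm_const dtm_lift[OF that(2)] dtm_lift[OF that(3)]],
        rule dtm_upd[OF dtm_var dtm_const])
  have "\<exists>z. X z \<and> cof (\<lambda>z'. X z' \<and> ?E b z z')" for b
  proof (rule dfn_induct[where P = "\<lambda>b. \<exists>z. X z \<and> cof (\<lambda>z'. X z' \<and> ?E b z z')"])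
    show "dfn1 (\<lambda>b. \<exists>z. X z \<and> cof (\<lambda>z'. X z' \<and> ?E b z z'))"
      unfolding dfn1_def cof_def
      by (intro dfn_ex dfn_conj dfn_all dfn_leq dfn1D[OF Cons.prems(1)] dtm_var dE)
  next
    fix b assume b: "\<And>y. \<not> y \<sqsubset> b"
    obtain z where z: "X z" "cof (\<lambda>z'. X z' \<and> boxeq R js w z z' (e(j := b)))"
      using Cons.IH[OF Cons.prems, of "e(j := b)"] by blast
    have "a = b" if "a \<sqsubseteq> b" for a using that b unfolding leq_def by blast
    then have "cof (\<lambda>z'. X z' \<and> ?E b z z')" by (intro cof_mono[OF z(2)]) auto
    then show "\<exists>z. X z \<and> cof (\<lambda>z'. X z' \<and> ?E b z z')" using z(1) by blast
  next
    fix b c assume bc: "c \<sqsubset> b" "\<And>a. a \<sqsubset> b \<Longrightarrow> a \<sqsubseteq> c" and "\<exists>z. X z \<and> cof (\<lambda>z'. X z' \<and> ?E c z z')"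
    then obtain z0 where z0: "X z0" "cof (\<lambda>z'. X z' \<and> ?E c z0 z')" by blast
    have d: "dfn1 (\<lambda>z'. X z' \<and> ?E c z0 z')"
      unfolding dfn1_def by (intro dfn_conj dfn1D[OF Cons.prems(1)] dtm_var dE dtm_const)
    \<comment> \<open>The outer induction hypothesis is applied to the cofinal set of points
      agreeing with \<open>z0\<close> up to \<open>c\<close>; the only new value is
      \<open>b\<close>.\<close>
    obtain z where z: "X z \<and> ?E c z0 z" "cof (\<lambda>z'. (X z' \<and> ?E c z0 z') \<and> boxeq R js w z z' (e(j := b)))"
      using Cons.IH[OF d z0(2), of "e(j := b)"] by blast
    have "?E b z z'" if z': "?E c z0 z'" "boxeq R js w z z' (e(j := b))" for z'
    proof (intro allI impI)
      fix a assume "a \<sqsubseteq> b"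
      then have "a \<sqsubseteq> c \<or> a = b" using bc(2) unfolding leq_def by blast
      then show "boxeq R js w z z' (e(j := a))"
        using boxeq_trans[OF boxeq_sym, of R js w z0 z "e(j := a)" z'] z(1) z' by auto
    qed
    then have "cof (\<lambda>z'. X z' \<and> ?E b z z')" by (intro cof_mono[OF z(2)]) blast
    then show "\<exists>z. X z \<and> cof (\<lambda>z'. X z' \<and> ?E b z z')" using z(1) by blast
  qed
  from this[of w] show ?case by simp
qed

text \<open>The cofinal classes of the relations \<open>E w\<close> form a tree under refinement,
  and the pigeonhole says that it has no dead ends. Its leftmost branch, with classes ordered by
  their least elements, is definable without codes for branches: comparing two points at the first
  level that separates them is a first-order condition.\<close>

lemma branch:
  assumes E: "dfn3 E" "\<And>w z. E w z z" "\<And>w z z'. E w z z' \<Longrightarrow> E w z' z"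
    "\<And>w z z' z''. E w z z' \<Longrightarrow> E w z' z'' \<Longrightarrow> E w z z''"
    "\<And>v w z z'. v \<sqsubseteq> w \<Longrightarrow> E w z z' \<Longrightarrow> E v z z'"
    and pigeonhole: "\<And>w X. dfn1 X \<Longrightarrow> cof X \<Longrightarrow> \<exists>z. X z \<and> cof (\<lambda>z'. X z' \<and> E w z z')"
  obtains B where "dfn2 B" "\<And>w. cof (B w)" "\<And>w z z'. B w z \<Longrightarrow> B w z' \<Longrightarrow> E w z z'"
    "\<And>v w z. v \<sqsubseteq> w \<Longrightarrow> B w z \<Longrightarrow> B v z"
proof -
  define G where "G w z = cof (E w z)" for w z
  define m where "m w z = mu (E w z)" for w z
  \<comment> \<open>The class of \<open>z\<close> lies on the leftmost branch up to
    \<open>w\<close>: no cofinal competitor has a smaller least element at the first level of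
    disagreement.\<close>
  define K where "K w z \<longleftrightarrow> G w z \<and> (\<forall>z'. G w z' \<longrightarrow> (\<forall>v. v \<sqsubseteq> w \<longrightarrow> (\<forall>u. u \<sqsubset> v \<longrightarrow> E u z z') \<longrightarrow> m v z \<sqsubseteq> m v z'))" for w z
  have Ed: "dfn1 (E w z)" for w z
    unfolding dfn1_def by (intro dfn3D[OF E(1)] dtm_const dtm_var)
  have E_cong: "E w z = E w z'" if "E w z z'" for w z z'
    using that E(3,4) by blast
  have m_cong: "m v z = m v z'" if "E w z z'" "v \<sqsubseteq> w" for v w z z'
    using E_cong[OF E(5)[OF that(2,1)]] by (simp add: m_def)
  have m_E: "E v z (m v z)" for v z
    unfolding m_def by (rule mu_holds[OF Ed E(2)])
  have G_cong: "G w z' = G w z" if "E w z z'" for w z z'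
    using E_cong[OF that] by (simp add: G_def)
  have G_mono: "G v z" if "G w z" "v \<sqsubseteq> w" for v w z
    using that cof_mono[of "E w z" "E v z"] E(5) unfolding G_def by blast
  \<comment> \<open>The pigeonhole inside the cofinal class of \<open>z\<close> at level
    \<open>v\<close>: no dead ends.\<close>
  have G_ext: "\<exists>z'. E v z z' \<and> G w z'" if G: "G v z" for v w z
  proof -
    obtain z' where "E v z z'" "cof (\<lambda>y. E v z y \<and> E w z' y)"
      using pigeonhole[OF Ed G[unfolded G_def], of w] by blast
    then show ?thesis using cof_mono[of "\<lambda>y. E v z y \<and> E w z' y" "E w z'"] unfolding G_def by blast
  qed
  have dG: "dfn (\<lambda>x. G (s x) (t x))" if "dtm s" "dtm t" for s t :: "('i \<Rightarrow> nat) \<Rightarrow> nat"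
    unfolding G_def cof_def
    by (intro dfn_intros dfn3D[OF E(1)] dtm_lift[OF that(1)] dtm_lift[OF that(2)])
  have dm0: "dtm (\<lambda>x :: nat \<Rightarrow> nat. mu (\<lambda>a. E (x 0) (x 1) a))"
    by (rule dtm_mu) (auto intro!: dfn3D[OF E(1)] dtm_var intro: E(2))
  have dm: "dtm (\<lambda>x. m (s x) (t x))" if "dtm s" "dtm t" for s t :: "('i \<Rightarrow> nat) \<Rightarrow> nat"
    unfolding m_def using dtm_subst[OF dm0, of "\<lambda>n. if n = 0 then s else t"] that by simp
  have dK: "dfn2 K"
    unfolding dfn2_def K_def by (intro dfn_intros dG dm dfn3D[OF E(1)])
  have K_cong: "K w z'" if "K w z" "E w z z'" for w z z'
    unfolding K_def
  proof (intro conjI allI impI)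
    show "G w z'" using that G_cong unfolding K_def by blast
    fix y v assume y: "G w y" "v \<sqsubseteq> w" "\<forall>u. u \<sqsubset> v \<longrightarrow> E u z' y"
    have "E u z y" if "u \<sqsubset> v" for u
      using y(2,3) that \<open>E w z z'\<close> E(4,5) by (meson ord.less_imp_le ord.order_trans)
    then have "m v z \<sqsubseteq> m v y" using \<open>K w z\<close> y unfolding K_def by blast
    then show "m v z' \<sqsubseteq> m v y" using m_cong[OF \<open>E w z z'\<close> y(2)] by simp
  qed
  have K_unique: "E w z z'" if "K w z" "K w z'" for w z z'
  proof (rule ccontr)
    assume "\<not> E w z z'"
    moreover have "dfn1 (\<lambda>v. \<not> E v z z')"
      unfolding dfn1_def by (intro dfn_not dfn3D[OF E(1)] dtm_const dtm_var)
    ultimately obtain v where v: "\<not> E v z z'" "\<And>u. u \<sqsubset> v \<Longrightarrow> E u z z'"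
      using least_dfn[of "\<lambda>v. \<not> E v z z'"] by metis
    have "v \<sqsubseteq> w" using v(2)[of w] \<open>\<not> E w z z'\<close> ord.not_less by blast
    then have "m v z = m v z'"
      using that v(2) E(3) unfolding K_def by (meson ord.order_antisym)
    then show False using v(1) m_E[of v z] m_E[of v z'] E(3,4) by metis
  qed
  have K_mono: "K v z" if "K w z" "v \<sqsubseteq> w" for v w z
    unfolding K_def
  proof (intro conjI allI impI)
    show "G v z" using that G_mono unfolding K_def by blast
    fix z' v' assume z': "G v z'" "v' \<sqsubseteq> v" "\<forall>u. u \<sqsubset> v' \<longrightarrow> E u z z'"
    obtain z'' where z'': "E v z' z''" "G w z''" using G_ext[OF z'(1)] by blast
    have "E u z z''" if "u \<sqsubset> v'" for u
      using z'(2,3) that z''(1) E(4,5) by (meson ord.less_imp_le ord.order_trans)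
    then have "m v' z \<sqsubseteq> m v' z''"
      using that z''(2) z'(2) unfolding K_def by (meson ord.order_trans)
    then show "m v' z \<sqsubseteq> m v' z'" using m_cong[OF z''(1) z'(2)] by simp
  qed
  \<comment> \<open>Among the candidates \<open>Y\<close> with a cofinal class at level
    \<open>w\<close>, one whose class has the least minimum is taken. By \<open>step\<close>, a
    competitor is itself a candidate at level \<open>w\<close> or does not win.\<close>
  have K_step: "\<exists>z. K w z"
    if Y: "dfn1 Y" "Y y" "G w y"
      and step: "\<And>z z' v. Y z \<Longrightarrow> G w z \<Longrightarrow> G w z' \<Longrightarrow> v \<sqsubseteq> w \<Longrightarrow> (\<And>u. u \<sqsubset> v \<Longrightarrow> E u z z') \<Longrightarrow>
        v = w \<and> Y z' \<or> m v z \<sqsubseteq> m v z'" for w Y y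
  proof -
    let ?S = "\<lambda>a. \<exists>z. Y z \<and> G w z \<and> a = m w z"
    have "dfn1 ?S" unfolding dfn1_def by (intro dfn_intros dfn1D[OF Y(1)] dG dm)
    moreover have "?S (m w y)" using Y by blast
    ultimately obtain a where a: "?S a" "\<And>b. b \<sqsubset> a \<Longrightarrow> \<not> ?S b" using least_dfn[of ?S] by metis
    then obtain z where z: "Y z" "G w z" "a = m w z" by blast
    have "K w z" unfolding K_def
    proof (intro conjI allI impI)
      fix z' v assume z': "G w z'" "v \<sqsubseteq> w" "\<forall>u. u \<sqsubset> v \<longrightarrow> E u z z'"
      have "m w z \<sqsubseteq> m w z'" if "Y z'"
        using a(2)[of "m w z'"] that z'(1) ord.not_less unfolding z(3) by blast
      moreover have "v = w \<and> Y z' \<or> m v z \<sqsubseteq> m v z'" by (rule step[OF z(1,2) z'(1,2)]) (use z'(3) in simp)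
      ultimately show "m v z \<sqsubseteq> m v z'" by auto
    qed (rule z(2))
    then show ?thesis ..
  qed
  have K_ex: "\<exists>z. K w z" for w
  proof (rule dfn_induct[where P = "\<lambda>w. \<exists>z. K w z"])
    show "dfn1 (\<lambda>w. \<exists>z. K w z)" unfolding dfn1_def by (intro dfn_intros dfn2D[OF dK])
  next
    fix w assume w: "\<And>y. \<not> y \<sqsubset> w"
    have "cof (\<lambda>_. True)" unfolding cof_def by auto
    then obtain y where "cof (\<lambda>z'. True \<and> E w y z')"
      using pigeonhole[of "\<lambda>_. True" w] dfn_const unfolding dfn1_def by blast
    then have "G w y" by (simp add: G_def)
    moreover have "v = w" if "v \<sqsubseteq> w" for v using that w unfolding leq_def by blast
    ultimately show "\<exists>z. K w z"
      by (intro K_step[of "\<lambda>_. True"]) (auto simp: dfn1_def dfn_const)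
  next
    fix w v assume vw: "v \<sqsubset> w" "\<And>z. z \<sqsubset> w \<Longrightarrow> z \<sqsubseteq> v" and "\<exists>z. K v z"
    then obtain z0 where z0: "K v z0" by blast
    obtain y where y: "E v z0 y" "G w y" using G_ext[of v z0] z0 unfolding K_def by blast
    \<comment> \<open>The candidates are the points in the class chosen one level below. Limit
      levels do not occur, by the predecessor property.\<close>
    show "\<exists>z. K w z"
    proof (rule K_step[OF Ed[of v z0] y])
      fix z z' v' assume z: "E v z0 z" "G w z" "G w z'" "v' \<sqsubseteq> w" and u: "\<And>u. u \<sqsubset> v' \<Longrightarrow> E u z z'"
      show "v' = w \<and> E v z0 z' \<or> m v' z \<sqsubseteq> m v' z'"
      proof (cases "v' = w")
        case True
        then show ?thesis using u[of v] vw(1) z(1) E(4) by blast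
      next
        case False
        then have v': "v' \<sqsubseteq> v" using z(4) vw(2) unfolding leq_def by blast
        have "G v z'" using G_mono[OF z(3)] vw(1) by (simp add: leq_def)
        moreover have "K v z" using K_cong[OF z0 z(1)] .
        ultimately show ?thesis using v' u unfolding K_def by blast
      qed
    qed
  qed
  have "cof (K w)" for w
  proof -
    obtain z where z: "K w z" using K_ex by blast
    then show ?thesis using cof_mono[of "E w z" "K w"] K_cong[OF z] unfolding K_def G_def by blast
  qed
  then show ?thesis using that[OF dK] K_unique K_mono by blast
qed

text \<open>For every bound \<open>w\<close> some \<open>boxeq\<close>-class is cofinal; choosing the lexicographically least coherent
  branch through these classes makes the limit definable.\<close>

lemma uniform_limit:
  assumes R: "dfnR R" and dep: "\<And>z e e'. \<forall>n\<in>set js. e n = e' n \<Longrightarrow> R z e = R z e'"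
  shows "\<exists>th D. dfun1 th \<and> (\<forall>w. w \<sqsubseteq> th w) \<and> (\<forall>v w. v \<sqsubseteq> w \<longrightarrow> th v \<sqsubseteq> th w) \<and>
    (\<forall>w e. (\<forall>n\<in>set js. e n \<sqsubseteq> w) \<longrightarrow> R (th w) e = D e)"
proof -
  let ?E = "\<lambda>w z z'. boxeq R js w z z' (\<lambda>_. 0)"
  have "\<exists>B. dfn2 B \<and> (\<forall>w. cof (B w)) \<and> (\<forall>w z z'. B w z \<longrightarrow> B w z' \<longrightarrow> ?E w z z') \<and>
    (\<forall>v w z. v \<sqsubseteq> w \<longrightarrow> B w z \<longrightarrow> B v z)"
  proof (rule branch[of ?E])
    show "dfn3 ?E" unfolding dfn3_def by (rule dfn_boxeq[OF R dtm_var dtm_var dtm_var dtm_const])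
    show "?E w z z" for w z by (rule boxeq_refl)
    show "?E w z' z" if "?E w z z'" for w z z' using that by (rule boxeq_sym)
    show "?E w z z''" if "?E w z z'" "?E w z' z''" for w z z' z'' using that by (rule boxeq_trans)
    show "?E v z z'" if "v \<sqsubseteq> w" "?E w z z'" for v w z z' using that(2,1) by (rule boxeq_mono)
    show "\<exists>z. X z \<and> cof (\<lambda>z'. X z' \<and> ?E w z z')" if "dfn1 X" "cof X" for w X
      by (rule boxeq_pigeonhole[OF R that])
  qed blast
  then obtain B where B: "dfn2 B" "\<And>w. cof (B w)" "\<And>w z z'. B w z \<Longrightarrow> B w z' \<Longrightarrow> ?E w z z'"
    "\<And>v w z. v \<sqsubseteq> w \<Longrightarrow> B w z \<Longrightarrow> B v z"
    by (elim exE conjE) simp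
  \<comment> \<open>A diagonal through the branch: the condition \<open>w \<sqsubseteq> z\<close>
    makes the sequence tend to infinity, and as the sets \<open>B w\<close> decrease it is
    monotone.\<close>
  define th where "th w = mu (\<lambda>z. w \<sqsubseteq> z \<and> B w z)" for w
  have ex: "\<exists>z. w \<sqsubseteq> z \<and> B w z" for w using B(2)[of w] unfolding cof_def by blast
  have d: "dfn1 (\<lambda>z. w \<sqsubseteq> z \<and> B w z)" for w
    unfolding dfn1_def by (intro dfn_conj dfn_leq dfn2D[OF B(1)] dtm_const dtm_var)
  have th: "w \<sqsubseteq> th w" "B w (th w)" "\<And>z. w \<sqsubseteq> z \<Longrightarrow> B w z \<Longrightarrow> th w \<sqsubseteq> z" for w
    using mu[OF d, of w] ex[of w] unfolding th_def by blast+
  have "dfun1 th"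
    unfolding dfun1_def th_def
    by (rule dtm_mu[where P = "\<lambda>z e. e 0 \<sqsubseteq> z \<and> B (e 0) z"])
      (auto intro!: dfn_conj dfn_leq dfn2D[OF B(1)] dtm_var simp: ex)
  moreover have mono: "th v \<sqsubseteq> th w" if "v \<sqsubseteq> w" for v w
    using th(3)[of v "th w"] th(1,2)[of w] B(4)[OF that] that ord.order_trans by blast
  moreover define D where "D e \<longleftrightarrow> (\<exists>w. (\<forall>n\<in>set js. e n \<sqsubseteq> w) \<and> R (th w) e)" for e
  have same: "R (th v) e = R (th w) e" if "v \<sqsubseteq> w" "\<And>n. n \<in> set js \<Longrightarrow> e n \<sqsubseteq> v" for v w e
  proof -
    \<comment> \<open>Agreement is stated relative to the base point 0, so coordinates outside
      \<open>js\<close> are reset; by \<open>dep\<close> this does not affect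
      \<open>R\<close>.\<close>
    let ?e = "\<lambda>n. if n \<in> set js then e n else 0"
    have "?E v (th v) (th w)" using B(3,4) th(2) that(1) by blast
    then have "R (th v) ?e = R (th w) ?e" by (rule boxeqD) (use that in auto)
    moreover have "R z ?e = R z e" for z by (rule dep) simp
    ultimately show ?thesis by simp
  qed
  have "R (th w) e = D e" if e: "\<forall>n\<in>set js. e n \<sqsubseteq> w" for w e
  proof
    assume "D e"
    then obtain v where "\<forall>n\<in>set js. e n \<sqsubseteq> v" "R (th v) e" unfolding D_def by blast
    then show "R (th w) e" using same[of v w e] same[of w v e] e ord.linear[of v w] by blast
  qed (use e in \<open>auto simp: D_def\<close>)
  ultimately show ?thesis using th(1) by (intro exI[of _ th] exI[of _ D] conjI) simp_all
qed

section \<open>Sequences along which all formulas converge\<close>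

definition subseqf :: "(nat \<Rightarrow> nat) \<Rightarrow> bool" where
  "subseqf z \<longleftrightarrow> dfun1 z \<and> (\<forall>w. w \<sqsubseteq> z w) \<and> (\<forall>v w. v \<sqsubseteq> w \<longrightarrow> z v \<sqsubseteq> z w)"

lemma dtm_case_nat: "dtm s \<Longrightarrow> (\<And>n. dtm (t n)) \<Longrightarrow> dtm (\<lambda>e. case_nat (s e) (\<lambda>n. t n e) n)"
  by (cases n) simp_all

text \<open>The limit is uniform: as soon as \<open>w\<close> bounds the parameters, the truth value
  at \<open>z' w\<close> is final, and \<open>ult_function\<close> rests on this. As
  \<open>z' w\<close> is a value of \<open>z\<close> at or beyond \<open>w\<close>, whatever holds
  eventually along \<open>z\<close> persists along \<open>z'\<close>.\<close>

lemma refine_step: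
  assumes z: "subseqf z" and \<phi>: "fm_in V \<phi>"
  shows "\<exists>z'. subseqf z' \<and> (\<forall>w. \<exists>e. w \<sqsubseteq> e \<and> z' w = z e) \<and>
    (\<exists>D. \<forall>w e. (\<forall>n\<in>fm_vars (All \<phi>). e n \<sqsubseteq> w) \<longrightarrow> fm_sat M (case_nat (z' w) e) \<phi> = D e)"
proof -
  obtain js where js: "set js = fm_vars (All \<phi>)" using finite_list[OF finite_fm_vars] by blast
  let ?R = "\<lambda>a e. fm_sat M (case_nat (z a) e) \<phi>"
  have "dfun1 z" using z by (simp add: subseqf_def)
  then have dR: "dfnR ?R"
    unfolding dfnR_def by (intro dfn_fm_dtm[OF \<phi>] dtm_case_nat dfun1D[of z] dtm_var)
  have dep: "?R a e = ?R a e'" if "\<forall>n\<in>set js. e n = e' n" for a e e'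
    by (rule fm_sat_cong) (use that js in \<open>auto split: nat.split\<close>)
  have "\<exists>th D. dfun1 th \<and> (\<forall>w. w \<sqsubseteq> th w) \<and> (\<forall>v w. v \<sqsubseteq> w \<longrightarrow> th v \<sqsubseteq> th w) \<and>
    (\<forall>w e. (\<forall>n\<in>set js. e n \<sqsubseteq> w) \<longrightarrow> ?R (th w) e = D e)"
    by (rule uniform_limit[OF dR]) (erule dep)
  then obtain th D where th: "dfun1 th" "\<forall>w. w \<sqsubseteq> th w" "\<forall>v w. v \<sqsubseteq> w \<longrightarrow> th v \<sqsubseteq> th w"
    "\<forall>w e. (\<forall>n\<in>set js. e n \<sqsubseteq> w) \<longrightarrow> ?R (th w) e = D e"
    by (elim exE conjE)
  have "dfun1 (\<lambda>w. z (th w))"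
    unfolding dfun1_def by (rule dfun1D[OF \<open>dfun1 z\<close> dfun1D[OF th(1) dtm_var]])
  moreover have "w \<sqsubseteq> z (th w)" for w
    using z th(2)[rule_format, of w] ord.order_trans[of w "th w" "z (th w)"] unfolding subseqf_def by simp
  moreover have "z (th v) \<sqsubseteq> z (th w)" if "v \<sqsubseteq> w" for v w
    using z th(3)[rule_format, OF that] unfolding subseqf_def by simp
  ultimately have "subseqf (\<lambda>w. z (th w))" unfolding subseqf_def by simp
  moreover have "\<exists>D. \<forall>w e. (\<forall>n\<in>fm_vars (All \<phi>). e n \<sqsubseteq> w) \<longrightarrow> ?R (th w) e = D e"
    using th(4) unfolding js by blast
  moreover have "\<forall>w. \<exists>e. w \<sqsubseteq> e \<and> z (th w) = z e" using th(2) by blast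
  ultimately show ?thesis by (intro exI[of _ "\<lambda>w. z (th w)"] conjI)
qed

abbreviation nth_fm :: "nat \<Rightarrow> ('f, 'r) fm" where "nth_fm \<equiv> from_nat_into {\<phi>. fm_in V \<phi>}"

lemma nth_fm_in: "fm_in V (nth_fm n)"
  using from_nat_into[of "{\<phi>. fm_in V \<phi>}" n] fm_in.simps(1) by blast

lemma nth_fm_surj: "fm_in V \<phi> \<Longrightarrow> \<exists>n. nth_fm n = \<phi>"
  using from_nat_into_surj[OF countable_fm_in[OF countable_V], of \<phi>] by simp

definition good_seq :: "(nat \<Rightarrow> nat \<Rightarrow> nat) \<Rightarrow> bool" where
  "good_seq Z \<longleftrightarrow> (\<forall>n. subseqf (Z n) \<and> (\<forall>w. \<exists>e. w \<sqsubseteq> e \<and> Z (Suc n) w = Z n e) \<and>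
    (\<exists>D. \<forall>w e. (\<forall>k\<in>fm_vars (All (nth_fm n)). e k \<sqsubseteq> w) \<longrightarrow>
      fm_sat M (case_nat (Z (Suc n) w) e) (nth_fm n) = D e))"

lemma good_seq_ex: "\<exists>Z. good_seq Z"
proof -
  have "subseqf (\<lambda>w. w)" unfolding subseqf_def dfun1_def by (simp add: dtm_var)
  then have "\<exists>Z. \<forall>n. subseqf (Z n) \<and> ((\<forall>w. \<exists>e. w \<sqsubseteq> e \<and> Z (Suc n) w = Z n e) \<and>
    (\<exists>D. \<forall>w e. (\<forall>k\<in>fm_vars (All (nth_fm n)). e k \<sqsubseteq> w) \<longrightarrow>
      fm_sat M (case_nat (Z (Suc n) w) e) (nth_fm n) = D e))"
  proof (intro dependent_nat_choice)
    fix z n assume "subseqf z"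
    from refine_step[OF this nth_fm_in[of n]]
    show "\<exists>z'. subseqf z' \<and> ((\<forall>w. \<exists>e. w \<sqsubseteq> e \<and> z' w = z e) \<and>
      (\<exists>D. \<forall>w e. (\<forall>k\<in>fm_vars (All (nth_fm n)). e k \<sqsubseteq> w) \<longrightarrow> fm_sat M (case_nat (z' w) e) (nth_fm n) = D e))" .
  qed blast
  then show ?thesis unfolding good_seq_def .
qed

text \<open>\<open>Z (Suc n)\<close> is a subsequence of \<open>Z n\<close> along which the \<open>n\<close>-th formula converges.\<close>

definition Z :: "nat \<Rightarrow> nat \<Rightarrow> nat" where "Z = (SOME Z. good_seq Z)"

lemma Z: "good_seq Z"
  unfolding Z_def using good_seq_ex by (rule someI_ex)

lemma Z_subseqf: "subseqf (Z n)"
  using Z unfolding good_seq_def by blast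

lemma Z_dfun: "dfun1 (Z n)" and Z_ge: "w \<sqsubseteq> Z n w" and Z_mono: "v \<sqsubseteq> w \<Longrightarrow> Z n v \<sqsubseteq> Z n w"
  using Z_subseqf[of n] unfolding subseqf_def by blast+

lemma Z_Suc: "\<exists>e. w \<sqsubseteq> e \<and> Z (Suc n) w = Z n e"
  using Z[unfolded good_seq_def, THEN spec, of n, THEN conjunct2, THEN conjunct1] by simp

lemma Z_limit:
  "nth_fm n = \<phi> \<Longrightarrow> \<exists>D. \<forall>w e. (\<forall>k\<in>fm_vars (All \<phi>). e k \<sqsubseteq> w) \<longrightarrow> fm_sat M (case_nat (Z (Suc n) w) e) \<phi> = D e"
  using Z[unfolded good_seq_def, THEN spec, of n, THEN conjunct2, THEN conjunct2] by simp

section \<open>The ultrafilter and its minimality\<close>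

definition ult :: "(nat \<Rightarrow> bool) \<Rightarrow> bool" where
  "ult X \<longleftrightarrow> (\<exists>n w. \<forall>e. w \<sqsubseteq> e \<longrightarrow> X (Z n e))"

lemma Z_later:
  assumes "\<And>e. w \<sqsubseteq> e \<Longrightarrow> X (Z n e)" "n \<le> m" "w \<sqsubseteq> e"
  shows "X (Z m e)"
  using assms(2,3)
proof (induction m arbitrary: e rule: dec_induct)
  case base
  then show ?case by (rule assms(1))
next
  case (step m)
  obtain e' where e': "e \<sqsubseteq> e'" "Z (Suc m) e = Z m e'" using Z_Suc by blast
  then have "w \<sqsubseteq> e'" using step.prems ord.order_trans by blast
  then show ?case using step.IH e'(2) by simp
qed

lemma ult_mono: "ult X \<Longrightarrow> (\<And>z. X z \<Longrightarrow> Y z) \<Longrightarrow> ult Y"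
  unfolding ult_def by blast

lemma ult_conj: assumes "ult X" "ult Y" shows "ult (\<lambda>z. X z \<and> Y z)"
proof -
  obtain n w m v where "\<And>e. w \<sqsubseteq> e \<Longrightarrow> X (Z n e)" "\<And>e. v \<sqsubseteq> e \<Longrightarrow> Y (Z m e)"
    using assms unfolding ult_def by blast
  then have "X (Z (max n m) e) \<and> Y (Z (max n m) e)" if "ord.max w v \<sqsubseteq> e" for e
    using Z_later[of w X n "max n m" e] Z_later[of v Y m "max n m" e] that by simp
  then show ?thesis unfolding ult_def by blast
qed

lemma ult_False: "\<not> ult (\<lambda>_. False)"
  unfolding ult_def using ord.order_refl by blast

lemma ult_const [simp]: "ult (\<lambda>_. c) \<longleftrightarrow> c"
  using ult_False by (cases c) (auto simp: ult_def)

lemma ult_gt: "ult (\<lambda>z. v \<sqsubset> z)"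
proof -
  obtain w where "v \<sqsubset> w" using lt_unbounded unfolding lss_def by blast
  then have "v \<sqsubset> Z 0 e" if "w \<sqsubseteq> e" for e using that Z_ge[of e 0] ord.order_trans ord.less_le_trans by blast
  then show ?thesis unfolding ult_def by blast
qed

lemma finite_bound:
  assumes "finite S"
  shows "\<exists>w. \<forall>k\<in>S. f k \<sqsubseteq> w"
  using assms
proof induction
  case (insert k S)
  then obtain w where "\<forall>k\<in>S. f k \<sqsubseteq> w" by blast
  then have "\<forall>i\<in>insert k S. f i \<sqsubseteq> ord.max w (f k)"
    by (auto simp: ord.max.coboundedI1)
  then show ?case by (rule exI)
qed simp

text \<open>A formula has finitely many parameters, so some \<open>w\<close> bounds them; beyond it
  the truth value is the limit \<open>D e\<close>.\<close>

lemma eventually_decided: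
  assumes "nth_fm n = \<phi>"
  shows "(\<exists>w. \<forall>a. w \<sqsubseteq> a \<longrightarrow> fm_sat M (case_nat (Z (Suc n) a) e) \<phi>) \<or>
    (\<exists>w. \<forall>a. w \<sqsubseteq> a \<longrightarrow> \<not> fm_sat M (case_nat (Z (Suc n) a) e) \<phi>)"
proof -
  obtain D where D: "\<forall>w e. (\<forall>k\<in>fm_vars (All \<phi>). e k \<sqsubseteq> w) \<longrightarrow> fm_sat M (case_nat (Z (Suc n) w) e) \<phi> = D e"
    using Z_limit[OF assms] ..
  obtain w where w: "\<forall>k\<in>fm_vars (All \<phi>). e k \<sqsubseteq> w" using finite_bound[OF finite_fm_vars] by blast
  have "fm_sat M (case_nat (Z (Suc n) a) e) \<phi> = D e" if "w \<sqsubseteq> a" for a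
    by (rule D[rule_format]) (use w that ord.order_trans in blast)
  then show ?thesis by (cases "D e") auto
qed

text \<open>Although \<open>ult\<close> refers to all stages, the stage belonging to the formula
  settles it for every assignment at once. The right-hand side is first-order, and this makes
  \<open>ult\<close> definable.\<close>

lemma ult_iff_stage:
  assumes "nth_fm n = \<phi>"
  shows "ult (\<lambda>z. fm_sat M (case_nat z e) \<phi>) \<longleftrightarrow>
    (\<exists>w. \<forall>a. w \<sqsubseteq> a \<longrightarrow> fm_sat M (case_nat (Z (Suc n) a) e) \<phi>)" (is "?L \<longleftrightarrow> ?R")
proof
  assume L: ?L
  show ?R
  proof (rule ccontr)
    assume "\<not> ?R"
    then have "ult (\<lambda>z. \<not> fm_sat M (case_nat z e) \<phi>)"
      using eventually_decided[OF assms, of e] unfolding ult_def by blast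
    from ult_conj[OF L this] show False by simp
  qed
qed (auto simp: ult_def)

lemma dfn_ult:
  assumes "dfn (\<lambda>e :: 'i option \<Rightarrow> nat. P (e None) (\<lambda>i. e (Some i)))"
  shows "dfn (\<lambda>e. ult (\<lambda>z. P z e))"
proof -
  obtain \<phi> \<rho> where \<phi>: "fm_in V \<phi>" "\<And>a e. P a e = fm_sat M (case_nat a (\<lambda>n. case_sum e id (\<rho> n))) \<phi>"
    using dfn_optionE[OF assms] by metis
  obtain n where n: "nth_fm n = \<phi>" using nth_fm_surj[OF \<phi>(1)] by blast
  have "dtm (\<lambda>x :: 'i option option \<Rightarrow> nat. case y of None \<Rightarrow> Z (Suc n) (x None) | Some i \<Rightarrow> x (Some (Some i)))" for y
    by (rule dtm_option[OF dfun1D[OF Z_dfun dtm_var] dtm_var])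
  from dfn_subst_dtm[OF assms, of "\<lambda>y x. case y of None \<Rightarrow> Z (Suc n) (x None) | Some i \<Rightarrow> x (Some (Some i))", OF this]
  have "dfn (\<lambda>x :: 'i option option \<Rightarrow> nat. P (Z (Suc n) (x None)) (\<lambda>i. x (Some (Some i))))" by simp
  then have "dfn (\<lambda>e. \<exists>w. \<forall>a. w \<sqsubseteq> a \<longrightarrow> P (Z (Suc n) a) e)"
    by (intro dfn_ex dfn_all dfn_imp dfn_leq dtm_var)
  then show ?thesis unfolding \<phi>(2) ult_iff_stage[OF n] .
qed

lemma ult_not:
  assumes "dfn1 X"
  shows "ult (\<lambda>z. \<not> X z) \<longleftrightarrow> \<not> ult X"
proof -
  have "dfn (\<lambda>e :: nat option \<Rightarrow> nat. X (e None))" by (rule dfn1D[OF assms dtm_var])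
  then obtain \<phi> \<rho> where \<phi>: "fm_in V \<phi>"
    "\<And>a e :: nat \<Rightarrow> nat. X a = fm_sat M (case_nat a (\<lambda>n. case_sum e id (\<rho> n))) \<phi>"
    using dfn_optionE[of "\<lambda>z _. X z"] by metis
  obtain n where n: "nth_fm n = \<phi>" using nth_fm_surj[OF \<phi>(1)] by blast
  have "ult X \<or> ult (\<lambda>z. \<not> X z)"
    using eventually_decided[OF n] unfolding \<phi>(2)[of _ "\<lambda>_. 0"] ult_def by blast
  moreover have "\<not> (ult X \<and> ult (\<lambda>z. \<not> X z))" using ult_conj[of X "\<lambda>z. \<not> X z"] by auto
  ultimately show ?thesis by blast
qed

text \<open>The uniform limit is applied to \<open>T z e \<sqsubseteq> u\<close> with
  \<open>u\<close> as a further parameter. If for large \<open>w\<close> the value at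
  \<open>?z w\<close> is at most \<open>w\<close>, then with this value as \<open>u\<close> the
  formula is already decided, so \<open>T\<close> stays at most \<open>u\<close> from then on. Hence
  either \<open>T\<close> is bounded modulo \<open>ult\<close>, and then constant at its least
  bound, or for large \<open>w\<close> its value at \<open>?z w\<close> exceeds \<open>w\<close> and
  monotonicity gives \<open>?z w \<sqsubseteq> ?z (T (?z w) e)\<close>. So \<open>h\<close> is the
  sequence itself.\<close>

lemma ult_function:
  assumes T: "dtm (\<lambda>e :: 'i option \<Rightarrow> nat. T (e None) (\<lambda>i. e (Some i)))"
  shows "\<exists>h. dfun1 h \<and> (\<forall>e. (\<exists>v. ult (\<lambda>z. T z e = v)) \<or>
    (\<forall>v. ult (\<lambda>z. v \<sqsubset> T z e)) \<and> ult (\<lambda>z. z \<sqsubseteq> h (T z e)))"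
proof -
  define P where "P z x \<longleftrightarrow> T z (\<lambda>i. x (Some i)) \<sqsubseteq> x None" for z and x :: "'i option \<Rightarrow> nat"
  have dP: "dfn (\<lambda>e :: 'i option option \<Rightarrow> nat. P (e None) (\<lambda>i. e (Some i)))"
    unfolding P_def using dfn_leq[OF dtm_lift[OF T, of "case_option None (\<lambda>i. Some (Some i))"] dtm_var, of "Some None"]
    by simp
  obtain \<phi> \<rho> where \<phi>: "fm_in V \<phi>" "\<And>a e. P a e = fm_sat M (case_nat a (\<lambda>n. case_sum e id (\<rho> n))) \<phi>"
    using dfn_optionE[OF dP] by metis
  obtain n where n: "nth_fm n = \<phi>" using nth_fm_surj[OF \<phi>(1)] by blast
  let ?z = "Z (Suc n)"
  obtain D where D: "\<forall>w e. (\<forall>k\<in>fm_vars (All \<phi>). e k \<sqsubseteq> w) \<longrightarrow> fm_sat M (case_nat (?z w) e) \<phi> = D e"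
    using Z_limit[OF n] ..
  have "(\<exists>v. ult (\<lambda>z. T z e = v)) \<or> (\<forall>v. ult (\<lambda>z. v \<sqsubset> T z e)) \<and> ult (\<lambda>z. z \<sqsubseteq> ?z (T z e))" for e
  proof -
    have Te: "dtm (\<lambda>x :: nat \<Rightarrow> nat. T (x 0) e)"
      using dtm_subst[OF T, of "\<lambda>y x. case y of None \<Rightarrow> x 0 | Some i \<Rightarrow> e i", OF dtm_option[OF dtm_var dtm_const]]
      by simp
    obtain w0 where w0: "\<forall>k\<in>fm_vars (All \<phi>). case_sum (case_option 0 e) id (\<rho> k) \<sqsubseteq> w0"
      using finite_bound[OF finite_fm_vars[of "All \<phi>"], of "\<lambda>k. case_sum (case_option 0 e) id (\<rho> k)"] by blast
    have key: "ult (\<lambda>z. T z e \<sqsubseteq> u)" if u: "T (?z w) e \<sqsubseteq> u" "u \<sqsubseteq> w" "w0 \<sqsubseteq> w" for u w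
    proof -
      let ?a = "\<lambda>k. case_sum (case_option u e) id (\<rho> k)"
      have bound: "?a k \<sqsubseteq> w'" if "k \<in> fm_vars (All \<phi>)" "w \<sqsubseteq> w'" for k w'
      proof (cases "\<rho> k = Inl None")
        case True
        then show ?thesis using u(2) that(2) ord.order_trans by fastforce
      next
        case False
        then have "?a k = case_sum (case_option 0 e) id (\<rho> k)" by (simp split: sum.split option.split)
        then show ?thesis using w0 that u(3) ord.order_trans by metis
      qed
      have val: "T (?z w') e \<sqsubseteq> u \<longleftrightarrow> D ?a" if "w \<sqsubseteq> w'" for w'
        using D[rule_format, of ?a w'] bound[OF _ that] \<phi>(2)[of "?z w'" "case_option u e"] by (simp add: P_def)
      then have "T (?z w') e \<sqsubseteq> u" if "w \<sqsubseteq> w'" for w' using u(1) that ord.order_refl by blast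
      then show ?thesis unfolding ult_def by blast
    qed
    show ?thesis
    proof (cases "\<exists>v. ult (\<lambda>z. T z e \<sqsubseteq> v)")
      case True
      have "dfn1 (\<lambda>v. ult (\<lambda>z. T z e \<sqsubseteq> v))"
        unfolding dfn1_def by (rule dfn_ult, rule dfn_leq[OF dtm_lift[OF Te, of "\<lambda>_. None", simplified] dtm_var])
      then obtain v where v: "ult (\<lambda>z. T z e \<sqsubseteq> v)" "\<And>u. u \<sqsubset> v \<Longrightarrow> \<not> ult (\<lambda>z. T z e \<sqsubseteq> u)"
        using least_dfn[of "\<lambda>v. ult (\<lambda>z. T z e \<sqsubseteq> v)"] True by metis
      \<comment> \<open>By \<open>key\<close>, a value below \<open>v\<close> attained this late
        would itself be a bound, smaller than the least one.\<close>
      have "\<not> T (?z w) e \<sqsubset> v" if "ord.max w0 v \<sqsubseteq> w" for w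
        using key[of w "T (?z w) e"] v(2)[of "T (?z w) e"] that ord.order_refl ord.less_imp_le ord.order_trans
        by (metis ord.max.boundedE)
      then have "ult (\<lambda>z. \<not> T z e \<sqsubset> v)" unfolding ult_def by blast
      from ult_conj[OF v(1) this] have "ult (\<lambda>z. T z e = v)" by (rule ult_mono) (auto simp: leq_def)
      then show ?thesis by blast
    next
      case False
      have "ult (\<lambda>z. v \<sqsubset> T z e)" for v
      proof -
        have "dfn1 (\<lambda>z. T z e \<sqsubseteq> v)" unfolding dfn1_def by (rule dfn_leq[OF Te dtm_const])
        then have "ult (\<lambda>z. \<not> T z e \<sqsubseteq> v)" using ult_not False by blast
        then show ?thesis by (simp add: ord.not_le)
      qed
      moreover have "?z w \<sqsubseteq> ?z (T (?z w) e)" if "w0 \<sqsubseteq> w" for w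
        using key[of w "T (?z w) e"] False that ord.order_refl ord.linear Z_mono by metis
      ultimately show ?thesis unfolding ult_def by blast
    qed
  qed
  then show ?thesis using Z_dfun by blast
qed

end

subsection \<open>Iterated definable ultrapowers\<close>

definition depends_on :: "'i set \<Rightarrow> (('i \<Rightarrow> 'u) \<Rightarrow> 'a) \<Rightarrow> bool" where
  "depends_on S F \<longleftrightarrow> (\<forall>e e'. (\<forall>i\<in>S. e i = e' i) \<longrightarrow> F e = F e')"

lemma depends_onD: "depends_on S F \<Longrightarrow> (\<And>i. i \<in> S \<Longrightarrow> e i = e' i) \<Longrightarrow> F e = F e'"
  unfolding depends_on_def by blast

lemma depends_on_mono: "depends_on S F \<Longrightarrow> S \<subseteq> S' \<Longrightarrow> depends_on S' F"
  unfolding depends_on_def by blast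

context lnp_model
begin

section \<open>The iterated quantifier\<close>

lemma ult_conj_iff: "ult (\<lambda>z. X z \<and> Y z) \<longleftrightarrow> ult X \<and> ult Y"
  using ult_conj ult_mono[of "\<lambda>z. X z \<and> Y z"] by blast

primrec iter :: "'i list \<Rightarrow> (('i \<Rightarrow> nat) \<Rightarrow> bool) \<Rightarrow> ('i \<Rightarrow> nat) \<Rightarrow> bool" where
  "iter [] P e = P e"
| "iter (i # is) P e = ult (\<lambda>a. iter is P (e(i := a)))"

lemma dfn_iter: "dfn P \<Longrightarrow> dfn (iter is P)"
proof (induction "is")
  case (Cons i "is")
  have "dfn (\<lambda>e. ult (\<lambda>a. iter is P (e(i := a))))"
    by (rule dfn_ult, rule dfn_upd) (rule Cons.IH[OF Cons.prems])
  moreover have "iter (i # is) P = (\<lambda>e. ult (\<lambda>a. iter is P (e(i := a))))" by (rule ext) simp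
  ultimately show ?case by (simp only:)
next
  case Nil
  have "iter [] P = P" by (rule ext) simp
  then show ?case using Nil by (simp only:)
qed

lemma dfn1_upd: assumes "dfn P" shows "dfn1 (\<lambda>a. P (e(i := a)))"
proof -
  have "var_or_const (\<lambda>x :: nat \<Rightarrow> nat. (e(i := x 0)) j)" for j
    by (cases "j = i") (simp_all add: voc_var voc_const)
  from dfn_subst[OF assms, of "\<lambda>j x. (e(i := x 0)) j", OF this] show ?thesis unfolding dfn1_def .
qed

lemma iter_conj: "iter is (\<lambda>e. P e \<and> Q e) e \<longleftrightarrow> iter is P e \<and> iter is Q e"
  by (induction "is" arbitrary: e) (simp_all add: ult_conj_iff)

lemma iter_not: "dfn P \<Longrightarrow> iter is (\<lambda>e. \<not> P e) e \<longleftrightarrow> \<not> iter is P e"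
proof (induction "is" arbitrary: e)
  case (Cons i "is")
  then show ?case using ult_not[OF dfn1_upd[OF dfn_iter[OF Cons.prems]]] by simp
qed simp

lemma iter_mono: "(\<And>e. P e \<Longrightarrow> Q e) \<Longrightarrow> iter is P e \<Longrightarrow> iter is Q e"
proof (induction "is" arbitrary: e)
  case (Cons i "is")
  have "ult (\<lambda>a. iter is P (e(i := a)))" using Cons.prems by simp
  then have "ult (\<lambda>a. iter is Q (e(i := a)))" by (rule ult_mono) (rule Cons.IH[OF Cons.prems(1)])
  then show ?case by simp
qed simp

lemma iter_dep:
  "depends_on S P \<Longrightarrow> (\<And>j. j \<in> S \<Longrightarrow> j \<notin> set is \<Longrightarrow> e j = e' j) \<Longrightarrow> iter is P e = iter is P e'"
proof (induction "is" arbitrary: e e')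
  case Nil
  then show ?case using depends_onD[of S P e e'] by simp
next
  case (Cons i "is")
  have "iter is P (e(i := a)) = iter is P (e'(i := a))" for a
    by (rule Cons.IH[OF Cons.prems(1)]) (use Cons.prems(2) in auto)
  then show ?case by simp
qed

lemma iter_filter:
  assumes "depends_on S P"
  shows "iter is P e = iter (filter (\<lambda>i. i \<in> S) is) P e"
proof (induction "is" arbitrary: e)
  case (Cons i "is")
  show ?case
  proof (cases "i \<in> S")
    case True
    then show ?thesis by (simp add: Cons del: fun_upd_apply)
  next
    case False
    have "iter is P (e(i := a)) = iter is P e" for a
      by (rule iter_dep[OF assms]) (use False in auto)
    then show ?thesis using Cons False by simp
  qed
qed simp

text \<open>The iteration of \<open>ult\<close> along the index order, with the quantifier for the smallest index outermost.\<close>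

definition ev :: "(('i::linorder \<Rightarrow> nat) \<Rightarrow> bool) \<Rightarrow> bool" where
  "ev P \<longleftrightarrow> (\<exists>S. finite S \<and> depends_on S P \<and> iter (sorted_list_of_set S) P (\<lambda>_. 0))"

lemma filter_sorted_list_of_set:
  fixes S :: "'i::linorder set"
  assumes "finite S'" "S \<subseteq> S'"
  shows "filter (\<lambda>i. i \<in> S) (sorted_list_of_set S') = sorted_list_of_set S"
proof (rule sorted_distinct_set_unique)
  show "set (filter (\<lambda>i. i \<in> S) (sorted_list_of_set S')) = set (sorted_list_of_set S)"
    using assms finite_subset[OF assms(2,1)] by auto
qed (use assms in \<open>auto intro: sorted_wrt_filter\<close>)

text \<open>Two supports are compared through their union: quantifiers over indices outside a
  support are applied to constants, where \<open>ult\<close> is trivial, and the initial assignment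
  is overwritten on the support.\<close>

lemma ev_iff:
  fixes S :: "'i::linorder set"
  assumes "finite S" "depends_on S P"
  shows "ev P \<longleftrightarrow> iter (sorted_list_of_set S) P e"
proof -
  have *: "iter (sorted_list_of_set S) P e = iter (sorted_list_of_set S') P e'"
    if S: "finite S" "depends_on S P" "finite S'" "depends_on S' P" for S S' :: "'i set" and e e'
  proof -
    have "iter (sorted_list_of_set S) P e = iter (sorted_list_of_set (S \<union> S')) P e"
      using iter_filter[OF S(2), of "sorted_list_of_set (S \<union> S')" e]
      by (simp add: filter_sorted_list_of_set S)
    also have "\<dots> = iter (sorted_list_of_set (S \<union> S')) P e'"
      by (rule iter_dep[OF S(2)]) (use S in auto)
    also have "\<dots> = iter (sorted_list_of_set S') P e'"
      using iter_filter[OF S(4), of "sorted_list_of_set (S \<union> S')" e']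
      by (simp add: filter_sorted_list_of_set S)
    finally show ?thesis .
  qed
  show ?thesis unfolding ev_def using *[OF assms] assms by blast
qed

lemma dfn_depends: "dfn P \<Longrightarrow> \<exists>S. finite S \<and> depends_on S P"
  using dfn_finite_support unfolding depends_on_def .

lemma ev_const [simp]: "ev (\<lambda>_. c) \<longleftrightarrow> c"
  using ev_iff[of "{}" "\<lambda>_. c"] by (simp add: depends_on_def)

lemma common_support:
  assumes "dfn P" "dfn Q"
  shows "\<exists>S. finite S \<and> depends_on S P \<and> depends_on S Q"
proof -
  obtain S S' where "finite S" "depends_on S P" "finite S'" "depends_on S' Q"
    using dfn_depends[OF assms(1)] dfn_depends[OF assms(2)] by blast
  then show ?thesis using depends_on_mono[of S P "S \<union> S'"] depends_on_mono[of S' Q "S \<union> S'"]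
    by (intro exI[of _ "S \<union> S'"]) simp
qed

lemma ev_not: assumes "dfn P" shows "ev (\<lambda>x. \<not> P x) \<longleftrightarrow> \<not> ev P"
proof -
  obtain S where S: "finite S" "depends_on S P" using dfn_depends[OF assms] by blast
  then have "depends_on S (\<lambda>x. \<not> P x)" unfolding depends_on_def by blast
  then show ?thesis using ev_iff[OF S, of "\<lambda>_. 0"] ev_iff[OF S(1), of "\<lambda>x. \<not> P x" "\<lambda>_. 0"] iter_not[OF assms] by simp
qed

lemma ev_conj: assumes "dfn P" "dfn Q" shows "ev (\<lambda>x. P x \<and> Q x) \<longleftrightarrow> ev P \<and> ev Q"
proof -
  obtain S where S: "finite S" "depends_on S P" "depends_on S Q" using common_support[OF assms] by blast
  then have "depends_on S (\<lambda>x. P x \<and> Q x)" unfolding depends_on_def by blast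
  then show ?thesis
    using ev_iff[OF S(1,2), of "\<lambda>_. 0"] ev_iff[OF S(1,3), of "\<lambda>_. 0"] ev_iff[OF S(1), of "\<lambda>x. P x \<and> Q x" "\<lambda>_. 0"]
    by (simp add: iter_conj)
qed

lemma ev_mono: assumes "ev P" "dfn P" "dfn Q" "\<And>x. P x \<Longrightarrow> Q x" shows "ev Q"
proof -
  obtain S where S: "finite S" "depends_on S P" "depends_on S Q" using common_support[OF assms(2,3)] by blast
  then show ?thesis
    using ev_iff[OF S(1,2), of "\<lambda>_. 0"] ev_iff[OF S(1,3), of "\<lambda>_. 0"] iter_mono[of P Q] assms by blast
qed

lemma ev_imp: assumes "ev P" "dfn P" "dfn Q" "dfn R" "ev Q" "\<And>x. P x \<Longrightarrow> Q x \<Longrightarrow> R x" shows "ev R"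
  by (rule ev_mono[of "\<lambda>x. P x \<and> Q x"]) (use assms ev_conj[of P Q] dfn_conj in auto)

lemma dfn_Ball_list: "(\<And>t. t \<in> set ts \<Longrightarrow> dfn (P t)) \<Longrightarrow> dfn (\<lambda>x. \<forall>t\<in>set ts. P t x)"
proof (induction ts)
  case (Cons t ts)
  then have "dfn (\<lambda>x. P t x \<and> (\<forall>t\<in>set ts. P t x))" by (intro dfn_conj) auto
  then show ?case by simp
qed (simp add: dfn_const)

lemma ev_Ball_list:
  "(\<And>t. t \<in> set ts \<Longrightarrow> dfn (P t)) \<Longrightarrow> (\<And>t. t \<in> set ts \<Longrightarrow> ev (P t)) \<Longrightarrow> ev (\<lambda>x. \<forall>t\<in>set ts. P t x)"
proof (induction ts)
  case (Cons t ts)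
  then have "ev (\<lambda>x. P t x \<and> (\<forall>t\<in>set ts. P t x))"
    using ev_conj[of "P t" "\<lambda>x. \<forall>t\<in>set ts. P t x"] dfn_Ball_list[of ts P] by auto
  then show ?case by simp
qed simp

text \<open>The larger index is quantified innermost, hence its value is chosen after that of the
  smaller one and beyond it.\<close>

lemma ev_increasing: assumes "i < j" shows "ev (\<lambda>x. x i \<sqsubset> x j)"
proof -
  have "sorted_list_of_set {i, j} = [i, j]"
    using assms by (auto simp: sorted_list_of_set_insert_remove)
  moreover have "depends_on {i, j} (\<lambda>x. x i \<sqsubset> x j)" by (simp add: depends_on_def)
  ultimately show ?thesis
    using ev_iff[of "{i, j}" "\<lambda>x. x i \<sqsubset> x j" "\<lambda>_. 0"] assms less_imp_neq[OF assms] by (simp add: ult_gt)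
qed

section \<open>The extension and the theorem of Los\<close>

definition Fun :: "'i set \<Rightarrow> (('i::linorder \<Rightarrow> nat) \<Rightarrow> nat) \<Rightarrow> bool" where
  "Fun L F \<longleftrightarrow> dtm F \<and> (\<exists>S\<subseteq>L. finite S \<and> depends_on S F)"

lemma Fun_dtm: "Fun L F \<Longrightarrow> dtm F"
  by (simp add: Fun_def)

definition eqv :: "(('i::linorder \<Rightarrow> nat) \<Rightarrow> nat) \<Rightarrow> (('i \<Rightarrow> nat) \<Rightarrow> nat) \<Rightarrow> bool" where
  "eqv F G \<longleftrightarrow> ev (\<lambda>x. F x = G x)"

lemma eqv_refl: "eqv F F"
  by (simp add: eqv_def)

lemma eqv_sym: "eqv F G \<Longrightarrow> eqv G F"
  by (simp add: eqv_def eq_commute)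

lemma eqv_trans: "dtm F \<Longrightarrow> dtm G \<Longrightarrow> dtm H \<Longrightarrow> eqv F G \<Longrightarrow> eqv G H \<Longrightarrow> eqv F H"
  unfolding eqv_def by (erule ev_imp[where Q = "\<lambda>x. G x = H x"]) (auto intro: dfn_eq)

definition repr :: "'i set \<Rightarrow> (('i::linorder \<Rightarrow> nat) \<Rightarrow> nat) \<Rightarrow> ('i \<Rightarrow> nat) \<Rightarrow> nat" where
  "repr L F = (SOME G. Fun L G \<and> eqv F G)"

lemma repr: "Fun L F \<Longrightarrow> Fun L (repr L F)" "Fun L F \<Longrightarrow> eqv F (repr L F)"
  unfolding repr_def using someI[of "\<lambda>G. Fun L G \<and> eqv F G" F] eqv_refl by blast+

lemma repr_eq_iff: assumes "Fun L F" "Fun L G" shows "repr L F = repr L G \<longleftrightarrow> eqv F G"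
proof
  assume "repr L F = repr L G"
  then show "eqv F G"
    using repr[OF assms(1)] repr[OF assms(2)] eqv_sym eqv_trans Fun_dtm assms by metis
next
  assume *: "eqv F G"
  have "Fun L H \<and> eqv F H \<longleftrightarrow> Fun L H \<and> eqv G H" for H
    using * eqv_sym eqv_trans Fun_dtm assms by metis
  then show "repr L F = repr L G" by (simp add: repr_def)
qed

text \<open>The universe consists of chosen representatives instead of equivalence classes.\<close>

definition NN :: "'i set \<Rightarrow> ('f, 'r, ('i::linorder \<Rightarrow> nat) \<Rightarrow> nat) fo_struct" where
  "NN L = \<lparr>universe = repr L ` {F. Fun L F},
    finterp = (\<lambda>f Fs. repr L (\<lambda>x. finterp M f (map (\<lambda>F. F x) Fs))),
    rinterp = (\<lambda>r Fs. ev (\<lambda>x. rinterp M r (map (\<lambda>F. F x) Fs)))\<rparr>"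

lemma NN_simps [simp]:
  "universe (NN L) = repr L ` {F. Fun L F}"
  "finterp (NN L) f Fs = repr L (\<lambda>x. finterp M f (map (\<lambda>F. F x) Fs))"
  "rinterp (NN L) r Fs = ev (\<lambda>x. rinterp M r (map (\<lambda>F. F x) Fs))"
  by (simp_all add: NN_def)

lemma NN_Fun: "F \<in> universe (NN L) \<Longrightarrow> Fun L F"
  using repr by auto

lemma repr_idem: "F \<in> universe (NN L) \<Longrightarrow> repr L F = F"
proof -
  assume "F \<in> universe (NN L)"
  then obtain G where G: "F = repr L G" "Fun L G" by auto
  show ?thesis unfolding G(1) using repr_eq_iff[OF repr(1)[OF G(2)] G(2)] eqv_sym[OF repr(2)[OF G(2)]] by blast
qed

lemma finite_supports:
  assumes "finite S" "\<And>n. n \<in> S \<Longrightarrow> Fun L (F n)"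
  shows "\<exists>S'\<subseteq>L. finite S' \<and> (\<forall>n\<in>S. depends_on S' (F n))"
  using assms
proof (induction S)
  case (insert n S)
  then obtain S' where S': "S' \<subseteq> L" "finite S'" "\<forall>n\<in>S. depends_on S' (F n)" by blast
  obtain S'' where S'': "S'' \<subseteq> L" "finite S''" "depends_on S'' (F n)"
    using insert.prems[of n] unfolding Fun_def by blast
  show ?case
    by (rule exI[of _ "S' \<union> S''"]) (use S' S'' depends_on_mono in blast)
qed auto

lemma Fun_finterp:
  assumes "f \<in> funs V" "length Fs = farity V f" "\<And>F. F \<in> set Fs \<Longrightarrow> Fun L F"
  shows "Fun L (\<lambda>x. finterp M f (map (\<lambda>F. F x) Fs))"
proof -
  obtain S where S: "S \<subseteq> L" "finite S" "\<forall>F\<in>set Fs. depends_on S F"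
    using finite_supports[of "set Fs" L "\<lambda>F. F"] assms(3) by auto
  have "depends_on S (\<lambda>x. finterp M f (map (\<lambda>F. F x) Fs))"
    unfolding depends_on_def
  proof (intro allI impI)
    fix e e' assume "\<forall>i\<in>S. e i = (e' i :: nat)"
    then have "map (\<lambda>F. F e) Fs = map (\<lambda>F. F e') Fs" using S(3) by (auto intro: depends_onD)
    then show "finterp M f (map (\<lambda>F. F e) Fs) = finterp M f (map (\<lambda>F. F e') Fs)" by (simp only:)
  qed
  then show ?thesis using S dtm_finterp[OF assms(1,2)] assms(3) Fun_dtm unfolding Fun_def by blast
qed

lemma NN_struct: assumes "L \<noteq> {}" shows "is_struct V (NN L)"
proof -
  obtain i where "i \<in> L" using assms by blast
  then have "Fun L (\<lambda>x. x i)" unfolding Fun_def depends_on_def by (intro conjI dtm_var exI[of _ "{i}"]) auto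
  then have "universe (NN L) \<noteq> {}" by auto
  moreover have "Fun L (\<lambda>x. finterp M f (map (\<lambda>F. F x) Fs))"
    if "f \<in> funs V" "length Fs = farity V f" "set Fs \<subseteq> universe (NN L)" for f Fs
    by (rule Fun_finterp) (use that NN_Fun in auto)
  ultimately show ?thesis unfolding is_struct_def by auto
qed

lemma NN_tm_val:
  assumes e: "\<And>n. e n \<in> universe (NN L)"
  shows "tm_in V t \<Longrightarrow> Fun L (\<lambda>x. tm_val M (\<lambda>n. e n x) t) \<and>
    tm_val (NN L) e t = repr L (\<lambda>x. tm_val M (\<lambda>n. e n x) t)"
proof (induction t)
  case (Var n)
  then show ?case using NN_Fun[OF e] repr_idem[OF e] by simp
next
  case (Fn f ts)
  let ?F = "\<lambda>t x. tm_val M (\<lambda>n. e n x) t"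
  have F: "Fun L (?F t)" "tm_val (NN L) e t = repr L (?F t)" if "t \<in> set ts" for t
    using Fn that by (auto simp: list_all_iff)
  have f: "f \<in> funs V" "length ts = farity V f" using Fn.prems by auto
  have Fun1: "Fun L (\<lambda>x. finterp M f (map (\<lambda>F. F x) (map ?F ts)))"
    by (rule Fun_finterp) (use f F in auto)
  have Fun2: "Fun L (\<lambda>x. finterp M f (map (\<lambda>F. F x) (map (\<lambda>t. repr L (?F t)) ts)))"
    by (rule Fun_finterp) (use f F repr in auto)
  have "ev (\<lambda>x. \<forall>t\<in>set ts. repr L (?F t) x = ?F t x)"
    by (rule ev_Ball_list)
      (use Fun_dtm[OF F(1)] Fun_dtm[OF repr(1)[OF F(1)]] eqv_sym[OF repr(2)[OF F(1)]] in
        \<open>simp_all add: eqv_def dfn_eq\<close>)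
  then have "eqv (\<lambda>x. finterp M f (map (\<lambda>F. F x) (map (\<lambda>t. repr L (?F t)) ts)))
      (\<lambda>x. finterp M f (map (\<lambda>F. F x) (map ?F ts)))"
    unfolding eqv_def
  proof (rule ev_mono)
    show "dfn (\<lambda>x. \<forall>t\<in>set ts. repr L (?F t) x = ?F t x)"
      by (rule dfn_Ball_list, rule dfn_eq) (simp_all add: F(1) repr(1) Fun_dtm[where L = L])
    show "dfn (\<lambda>x. finterp M f (map (\<lambda>F. F x) (map (\<lambda>t. repr L (?F t)) ts)) =
        finterp M f (map (\<lambda>F. F x) (map ?F ts)))"
      by (rule dfn_eq) (use Fun1 Fun2 Fun_dtm in auto)
    fix x assume "\<forall>t\<in>set ts. repr L (?F t) x = ?F t x"
    then have "map (\<lambda>F. F x) (map (\<lambda>t. repr L (?F t)) ts) = map (\<lambda>F. F x) (map ?F ts)" by simp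
    then show "finterp M f (map (\<lambda>F. F x) (map (\<lambda>t. repr L (?F t)) ts)) =
        finterp M f (map (\<lambda>F. F x) (map ?F ts))" by (rule arg_cong)
  qed
  then have "repr L (\<lambda>x. finterp M f (map (\<lambda>F. F x) (map (\<lambda>t. repr L (?F t)) ts))) =
      repr L (\<lambda>x. finterp M f (map (\<lambda>F. F x) (map ?F ts)))"
    using repr_eq_iff[OF Fun2 Fun1] by blast
  moreover have "map (tm_val (NN L) e) ts = map (\<lambda>t. repr L (?F t)) ts" using F by simp
  ultimately have "tm_val (NN L) e (Fn f ts) = repr L (\<lambda>x. finterp M f (map (\<lambda>F. F x) (map ?F ts)))"
    by (simp only: tm_val.simps NN_simps)
  then show ?case using Fun1 by (simp add: comp_def)
qed

text \<open>In the quantifier step a counterexample is chosen by \<open>mu\<close>; being definable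
  from finitely many \<open>e n\<close>, it has finite support in \<open>L\<close> and so represents
  an element of the extension.\<close>

lemma los:
  assumes "\<And>n. e n \<in> universe (NN L)" "fm_in V \<phi>"
  shows "fm_sat (NN L) e \<phi> \<longleftrightarrow> ev (\<lambda>x. fm_sat M (\<lambda>n. e n x) \<phi>)"
  using assms
proof (induction \<phi> arbitrary: e)
  case Fls
  then show ?case by simp
next
  case (Eq s t)
  then show ?case using NN_tm_val[of e L s] NN_tm_val[of e L t] repr_eq_iff by (auto simp: eqv_def simp del: NN_simps)
next
  case (Rel r ts)
  let ?F = "\<lambda>t x. tm_val M (\<lambda>n. e n x) t"
  have F: "Fun L (?F t)" "tm_val (NN L) e t = repr L (?F t)" if "t \<in> set ts" for t
    using NN_tm_val[OF Rel.prems(1)] Rel.prems(2) that by (auto simp: list_all_iff)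
  have r: "r \<in> rels V" "length ts = rarity V r" using Rel.prems by auto
  have same: "ev (\<lambda>x. \<forall>t\<in>set ts. repr L (?F t) x = ?F t x)"
    by (rule ev_Ball_list)
      (use Fun_dtm[OF F(1)] Fun_dtm[OF repr(1)[OF F(1)]] eqv_sym[OF repr(2)[OF F(1)]] in
        \<open>simp_all add: eqv_def dfn_eq\<close>)
  have d0: "dfn (\<lambda>x. \<forall>t\<in>set ts. repr L (?F t) x = ?F t x)"
    by (rule dfn_Ball_list, rule dfn_eq) (simp_all add: F(1) repr(1) Fun_dtm[where L = L])
  have d1: "dfn (\<lambda>x. rinterp M r (map (\<lambda>F. F x) (map (\<lambda>t. repr L (?F t)) ts)))"
    using r F(1) repr(1)[where L = L] Fun_dtm[where L = L] by (intro dfn_rinterp) fastforce+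
  have d2: "dfn (\<lambda>x. rinterp M r (map (\<lambda>F. F x) (map ?F ts)))"
    by (rule dfn_rinterp) (use r F Fun_dtm in auto)
  have eq: "map (\<lambda>F. F x) (map (\<lambda>t. repr L (?F t)) ts) = map (\<lambda>F. F x) (map ?F ts)"
    if "\<forall>t\<in>set ts. repr L (?F t) x = ?F t x" for x
    using that by simp
  have "ev (\<lambda>x. rinterp M r (map (\<lambda>F. F x) (map (\<lambda>t. repr L (?F t)) ts))) \<longleftrightarrow>
      ev (\<lambda>x. rinterp M r (map (\<lambda>F. F x) (map ?F ts)))"
  proof
    assume a: "ev (\<lambda>x. rinterp M r (map (\<lambda>F. F x) (map (\<lambda>t. repr L (?F t)) ts)))"
    show "ev (\<lambda>x. rinterp M r (map (\<lambda>F. F x) (map ?F ts)))"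
      by (rule ev_imp[OF same d0 d1 d2 a]) (use eq in \<open>simp only:\<close>)
  next
    assume a: "ev (\<lambda>x. rinterp M r (map (\<lambda>F. F x) (map ?F ts)))"
    show "ev (\<lambda>x. rinterp M r (map (\<lambda>F. F x) (map (\<lambda>t. repr L (?F t)) ts)))"
      by (rule ev_imp[OF same d0 d2 d1 a]) (use eq in \<open>simp only:\<close>)
  qed
  moreover have "map (tm_val (NN L) e) ts = map (\<lambda>t. repr L (?F t)) ts" using F by simp
  ultimately have "fm_sat (NN L) e (Rel r ts) \<longleftrightarrow> ev (\<lambda>x. rinterp M r (map (\<lambda>F. F x) (map ?F ts)))"
    by (simp only: fm_sat.simps NN_simps)
  then show ?case by (simp add: comp_def)
next
  case (Imp \<phi> \<psi>)
  have d: "dfn (\<lambda>x. fm_sat M (\<lambda>n. e n x) \<phi>)" "dfn (\<lambda>x. fm_sat M (\<lambda>n. e n x) \<psi>)"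
    using Imp.prems NN_Fun[OF Imp.prems(1)] Fun_dtm by (auto intro!: dfn_fm_dtm)
  have "ev (\<lambda>x. fm_sat M (\<lambda>n. e n x) \<phi> \<longrightarrow> fm_sat M (\<lambda>n. e n x) \<psi>) \<longleftrightarrow>
      \<not> ev (\<lambda>x. fm_sat M (\<lambda>n. e n x) \<phi> \<and> \<not> fm_sat M (\<lambda>n. e n x) \<psi>)"
    using ev_not[OF dfn_conj[OF d(1) dfn_not[OF d(2)]]] by simp
  then show ?case using Imp ev_conj[OF d(1) dfn_not[OF d(2)]] ev_not[OF d(2)] by simp
next
  case (All \<phi>)
  let ?P = "\<lambda>a x. fm_sat M (case_nat a (\<lambda>n. e n x)) \<phi>"
  have eF: "Fun L (e n)" for n using NN_Fun[OF All.prems(1)] .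
  have \<phi>: "fm_in V \<phi>" using All.prems(2) by simp
  have dP: "dfn (\<lambda>x :: 'a option \<Rightarrow> nat. ?P (x None) (\<lambda>i. x (Some i)))"
    by (intro dfn_fm_dtm[OF \<phi>] dtm_case_nat dtm_var) (rule dtm_lift[OF Fun_dtm[OF eF]])
  have dall: "dfn (\<lambda>x. \<forall>b. ?P b x)" by (rule dfn_all[OF dP])
  have dG: "dfn (\<lambda>x. ?P (G x) x)" if "dtm G" for G by (rule dfn_let[OF dP that])
  have sat: "fm_sat (NN L) (case_nat G e) \<phi> \<longleftrightarrow> ev (\<lambda>x. ?P (G x) x)" if "G \<in> universe (NN L)" for G
  proof -
    have "(\<lambda>x. fm_sat M (\<lambda>n. case_nat G e n x) \<phi>) = (\<lambda>x. ?P (G x) x)"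
      by (rule ext, rule fm_sat_cong) (simp split: nat.split)
    moreover have "case_nat G e n \<in> universe (NN L)" for n
      using that All.prems(1) by (cases n) simp_all
    ultimately show ?thesis using All.IH[of "case_nat G e"] \<phi> by simp
  qed
  have "(\<forall>G\<in>universe (NN L). ev (\<lambda>x. ?P (G x) x)) \<longleftrightarrow> ev (\<lambda>x. \<forall>b. ?P b x)"
  proof
    assume "ev (\<lambda>x. \<forall>b. ?P b x)"
    then show "\<forall>G\<in>universe (NN L). ev (\<lambda>x. ?P (G x) x)"
      by (intro ballI ev_mono[OF _ dall dG[OF Fun_dtm[OF NN_Fun]]]) simp_all
  next
    assume *: "\<forall>G\<in>universe (NN L). ev (\<lambda>x. ?P (G x) x)"
    \<comment> \<open>Where no counterexample exists the second disjunct admits every value, so that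
      \<open>mu\<close> is always applied to a nonempty set.\<close>
    define G where "G x = mu (\<lambda>a. \<not> ?P a x \<or> (\<forall>b. ?P b x))" for x
    have ex: "\<exists>a. \<not> ?P a x \<or> (\<forall>b. ?P b x)" for x by blast
    have dW: "dfn (\<lambda>x :: 'a option \<Rightarrow> nat. \<not> ?P (x None) (\<lambda>i. x (Some i)) \<or> (\<forall>b. ?P b (\<lambda>i. x (Some i))))"
      by (intro dfn_disj dfn_not[OF dP] dfn_subst[OF dall voc_var])
    have "dtm G" unfolding G_def by (rule dtm_mu[OF dW ex])
    moreover obtain S where S: "S \<subseteq> L" "finite S" "\<forall>n\<in>fm_vars (All \<phi>). depends_on S (e n)"
      using finite_supports[OF finite_fm_vars[of "All \<phi>"], of L e] eF by auto
    have "depends_on S G"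
      unfolding depends_on_def
    proof (intro allI impI)
      fix x x' assume "\<forall>i\<in>S. x i = (x' i :: nat)"
      then have "e n x = e n x'" if "n \<in> fm_vars (All \<phi>)" for n using S(3) that depends_onD by blast
      then have "?P a x = ?P a x'" for a
        by (intro fm_sat_cong) (auto split: nat.split)
      then show "G x = G x'" by (simp add: G_def)
    qed
    ultimately have GF: "Fun L G" using S unfolding Fun_def by blast
    have spec: "\<not> ?P (G x) x \<or> (\<forall>b. ?P b x)" for x
    proof -
      have "dfn1 (\<lambda>a. \<not> ?P a x \<or> (\<forall>b. ?P b x))"
        unfolding dfn1_def
        using dfn_subst[OF dW, of "\<lambda>y z. case y of None \<Rightarrow> z 0 | Some i \<Rightarrow> x i", OF voc_option[OF voc_var voc_const]] by simp
      then show ?thesis unfolding G_def using mu_holds ex[of x] by blast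
    qed
    have "repr L G \<in> universe (NN L)" using GF by auto
    then have "ev (\<lambda>x. ?P (repr L G x) x)" using * by blast
    then have "ev (\<lambda>x. ?P (G x) x)"
      by (rule ev_imp[where Q = "\<lambda>x. G x = repr L G x"])
        (use dG[OF Fun_dtm[OF GF]] dG[OF Fun_dtm[OF repr(1)[OF GF]]] repr(2)[OF GF]
          dfn_eq[OF Fun_dtm[OF GF] Fun_dtm[OF repr(1)[OF GF]]] in \<open>simp_all add: eqv_def\<close>)
    then show "ev (\<lambda>x. \<forall>b. ?P b x)"
      by (rule ev_mono) (use dG[OF Fun_dtm[OF GF]] dall spec in blast)+
  qed
  then show ?case using sat by (simp add: universe_M del: NN_simps)
qed

end

lemma depends_on_comp:
  fixes F :: "('a \<Rightarrow> 'b) \<Rightarrow> 'c" and g :: "'a \<Rightarrow> 'd"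
  assumes "depends_on D F" "\<And>i. i \<in> D \<Longrightarrow> g i \<in> E"
  shows "depends_on E (\<lambda>x. F (\<lambda>i. x (g i)))"
  unfolding depends_on_def
proof (intro allI impI)
  fix x x' :: "'d \<Rightarrow> 'b" assume "\<forall>i\<in>E. x i = x' i"
  then show "F (\<lambda>i. x (g i)) = F (\<lambda>i. x' (g i))" by (intro depends_onD[OF assms(1)]) (simp add: assms(2))
qed

lemma assignment_exists: "U \<noteq> {} \<Longrightarrow> \<exists>e :: nat \<Rightarrow> 'u. range e \<subseteq> U"
proof -
  assume "U \<noteq> {}"
  then obtain u where "u \<in> U" by blast
  then have "range (\<lambda>_ :: nat. u) \<subseteq> U" by blast
  then show ?thesis by blast
qed

context lnp_model
begin

section \<open>Transport along order-preserving maps\<close>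

lemma Fun_support: "Fun L F \<Longrightarrow> \<exists>S. S \<subseteq> L \<and> finite S \<and> depends_on S F"
  by (auto simp: Fun_def)

lemma iter_transport:
  assumes "inj_on p D" "depends_on D P"
  shows "set is \<subseteq> D \<Longrightarrow> iter (map p is) (\<lambda>x. P (\<lambda>i. x (p i))) e = iter is P (\<lambda>i. e (p i))"
proof (induction "is" arbitrary: e)
  case (Cons i "is")
  have "iter (map p is) (\<lambda>x. P (\<lambda>i. x (p i))) (e(p i := a)) = iter is P ((\<lambda>i. e (p i))(i := a))" for a
  proof -
    have "iter (map p is) (\<lambda>x. P (\<lambda>i. x (p i))) (e(p i := a)) = iter is P (\<lambda>j. (e(p i := a)) (p j))"
      using Cons by simp
    also have "\<dots> = iter is P ((\<lambda>i. e (p i))(i := a))"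
      by (rule iter_dep[OF assms(2)]) (use assms(1) Cons.prems in \<open>auto dest: inj_onD\<close>)
    finally show ?thesis .
  qed
  then show ?case by (simp del: fun_upd_apply)
qed simp

text \<open>Indiscernibility of the generators: an increasing map carries the sorted list of the
  support to that of its image, so the same quantifiers are applied in the same order.\<close>

lemma ev_transport:
  fixes D :: "'i::linorder set" and p :: "'i \<Rightarrow> 'j::linorder"
  assumes "finite D" "strict_mono_on D p" "depends_on D P"
  shows "ev (\<lambda>x. P (\<lambda>i. x (p i))) \<longleftrightarrow> ev P"
proof -
  have inj: "inj_on p D" by (rule strict_mono_on_imp_inj_on[OF assms(2)])
  have dep: "depends_on (p ` D) (\<lambda>x. P (\<lambda>i. x (p i)))"
    by (rule depends_on_comp[OF assms(3)]) simp
  have "sorted_wrt (<) (map p (sorted_list_of_set D))"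
    unfolding sorted_wrt_map
    by (rule sorted_wrt_mono_rel[OF _ strict_sorted_list_of_set[of D]])
      (use assms(1,2) in \<open>auto dest: strict_mono_onD\<close>)
  moreover have "set (map p (sorted_list_of_set D)) = p ` D" using assms(1) by simp
  ultimately have "sorted_list_of_set (p ` D) = map p (sorted_list_of_set D)"
    using sorted_list_of_set.idem_if_sorted_distinct[of "map p (sorted_list_of_set D)"]
    by (metis strict_sorted_iff)
  then show ?thesis
    using ev_iff[OF finite_imageI[OF assms(1)] dep, of "\<lambda>_. 0"] ev_iff[OF assms(1,3), of "\<lambda>_. 0"]
      iter_transport[OF inj assms(3), of "sorted_list_of_set D"] assms(1) by simp
qed

text \<open>A function obtained by transport is in general not the chosen representative of its
  class; here arbitrary functions may stand behind the first \<open>k\<close> values of the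
  assignment.\<close>

lemma los_repr:
  assumes e: "\<And>n. e n \<in> universe (NN L)" and F: "\<And>n. Fun L (F n)"
    and eF: "\<And>n. n < k \<Longrightarrow> e n = repr L (F n)" and \<phi>: "fm_in V \<phi>" "fm_vars \<phi> \<subseteq> {..<k}"
  shows "fm_sat (NN L) e \<phi> \<longleftrightarrow> ev (\<lambda>x. fm_sat M (\<lambda>n. F n x) \<phi>)"
proof -
  let ?E = "\<lambda>x. \<forall>n\<in>set [0..<k]. e n x = F n x"
  have dt: "dtm (e n)" "dtm (F n)" for n using Fun_dtm[OF NN_Fun[OF e]] Fun_dtm[OF F] .
  have dE: "dfn ?E" by (rule dfn_Ball_list) (simp add: dfn_eq dt)
  have same: "ev ?E"
  proof (rule ev_Ball_list)
    fix n assume "n \<in> set [0..<k]"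
    then show "ev (\<lambda>x. e n x = F n x)" using eF[of n] eqv_sym[OF repr(2)[OF F[of n]]] by (simp add: eqv_def)
  qed (simp add: dfn_eq dt)
  have d: "dfn (\<lambda>x. fm_sat M (\<lambda>n. e n x) \<phi>)" "dfn (\<lambda>x. fm_sat M (\<lambda>n. F n x) \<phi>)"
    by (rule dfn_fm_dtm[OF \<phi>(1) dt(1)], rule dfn_fm_dtm[OF \<phi>(1) dt(2)])
  have eq: "fm_sat M (\<lambda>n. e n x) \<phi> = fm_sat M (\<lambda>n. F n x) \<phi>" if "?E x" for x
    by (rule fm_sat_cong) (use that \<phi>(2) in auto)
  have "ev (\<lambda>x. fm_sat M (\<lambda>n. e n x) \<phi>) \<longleftrightarrow> ev (\<lambda>x. fm_sat M (\<lambda>n. F n x) \<phi>)"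
  proof
    assume a: "ev (\<lambda>x. fm_sat M (\<lambda>n. e n x) \<phi>)"
    show "ev (\<lambda>x. fm_sat M (\<lambda>n. F n x) \<phi>)" by (rule ev_imp[OF same dE d a]) (simp only: eq)
  next
    assume a: "ev (\<lambda>x. fm_sat M (\<lambda>n. F n x) \<phi>)"
    show "ev (\<lambda>x. fm_sat M (\<lambda>n. e n x) \<phi>)" by (rule ev_imp[OF same dE d(2,1) a]) (simp only: eq)
  qed
  then show ?thesis using los[OF e \<phi>(1)] by simp
qed

lemma NN_model:
  fixes L :: "'a::linorder set"
  assumes "L \<noteq> {}" "is_theory V T" "is_model V T M"
  shows "is_model V T (NN L)"
  unfolding is_model_def
proof (intro conjI ballI allI impI)
  fix \<phi> and e :: "nat \<Rightarrow> ('a \<Rightarrow> nat) \<Rightarrow> nat" assume \<phi>: "\<phi> \<in> T" and e: "range e \<subseteq> universe (NN L)"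
  have "fm_sat M x \<phi>" for x using assms(3) \<phi> universe_M unfolding is_model_def by blast
  moreover have "e n \<in> universe (NN L)" for n using e by blast
  ultimately show "fm_sat (NN L) e \<phi>"
    using los[of e L \<phi>] assms(2) \<phi> unfolding is_theory_def by simp
qed (rule NN_struct[OF assms(1)])

text \<open>A definable function is named by a formula and a finite list of argument places and
  parameters. The index type may be uncountable; places outside the support \<open>S\<close> are
  therefore replaced by the constant 0, which does not change the function.\<close>

lemma countable_Fun:
  fixes L :: "'a::linorder set"
  assumes "countable L"
  shows "countable {F. Fun L F}"
proof -
  let ?A = "Inl ` insert None (Some ` L) \<union> range Inr :: ('a option + nat) set"
  define decode :: "('f, 'r) fm \<times> ('a option + nat) list \<Rightarrow> ('a \<Rightarrow> nat) \<Rightarrow> nat" where "decode = (\<lambda>(\<phi>, l) x. THE a.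
    fm_sat M (\<lambda>n. case_sum (case_option a x) id (if n < length l then l ! n else Inr 0)) \<phi>)"
  have "F \<in> decode ` ({\<phi>. fm_in V \<phi>} \<times> lists ?A)" if FF: "Fun L F" for F
  proof -
    obtain S where S: "S \<subseteq> L" "finite S" "depends_on S F" using Fun_support[OF FF] by blast
    obtain \<phi> \<rho> where \<phi>: "fm_in V \<phi>"
      and eq': "(\<lambda>e :: 'a option \<Rightarrow> nat. e None = F (\<lambda>i. e (Some i))) = (\<lambda>e. fm_sat M (\<lambda>n. case_sum e id (\<rho> n)) \<phi>)"
      using Fun_dtm[OF FF] unfolding dtm_def dfn_def by blast
    have eq: "e None = F (\<lambda>i. e (Some i)) \<longleftrightarrow> fm_sat M (\<lambda>n. case_sum e id (\<rho> n)) \<phi>" for e :: "'a option \<Rightarrow> nat"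
      by (rule fun_cong[OF eq'])
    obtain k where k: "fm_vars \<phi> \<subseteq> {..<k}"
      using finite_fm_vars[of \<phi>] finite_nat_iff_bounded by blast
    define \<rho>' where "\<rho>' n = (case \<rho> n of Inl (Some i) \<Rightarrow> if i \<in> S then Inl (Some i) else Inr 0 | y \<Rightarrow> y)" for n
    let ?l = "map \<rho>' [0..<k]"
    have "fm_sat M (\<lambda>n. case_sum (case_option a x) id (if n < length ?l then ?l ! n else Inr 0)) \<phi> \<longleftrightarrow> a = F x" for a x
    proof -
      let ?x = "\<lambda>i. if i \<in> S then x i else 0"
      have "F x = F ?x" by (rule depends_onD[OF S(3)]) simp
      then have "a = F x \<longleftrightarrow> fm_sat M (\<lambda>n. case_sum (case_option a ?x) id (\<rho> n)) \<phi>"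
        using eq[of "case_option a ?x"] by simp
      also have "\<dots> \<longleftrightarrow> fm_sat M (\<lambda>n. case_sum (case_option a x) id (if n < length ?l then ?l ! n else Inr 0)) \<phi>"
        by (rule fm_sat_cong) (use k in \<open>auto simp: \<rho>'_def split: sum.split option.split\<close>)
      finally show ?thesis by simp
    qed
    then have "decode (\<phi>, ?l) = F" unfolding decode_def by (simp add: fun_eq_iff)
    moreover have "\<rho>' n \<in> ?A" for n
      using S(1) by (auto simp: \<rho>'_def split: sum.split option.split)
    then have "set ?l \<subseteq> ?A" unfolding set_map by (rule image_subsetI)
    then have "?l \<in> lists ?A" unfolding in_lists_conv_set by blast
    ultimately show ?thesis using \<phi> by (intro image_eqI[of _ _ "(\<phi>, ?l)"]) simp_all
  qed
  then have "{F. Fun L F} \<subseteq> decode ` ({\<phi>. fm_in V \<phi>} \<times> lists ?A)" by blast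
  moreover have "countable (decode ` ({\<phi>. fm_in V \<phi>} \<times> lists ?A))"
    using countable_fm_in[OF countable_V] assms by (intro countable_image countable_SIGMA countable_lists) auto
  ultimately show ?thesis by (rule countable_subset)
qed

lemma countable_NN: "countable L \<Longrightarrow> countable (universe (NN L))"
  using countable_Fun by auto

text \<open>A position \<open>W a D p\<close> matches finitely many indices, with rank
  \<open>a\<close> left to play. The elements played so far are functions with support in
  \<open>D\<close> on one side and their renamings by \<open>p\<close> on the other. One new element
  may involve several new indices, hence the extension clauses for finite sets; atomic formulas are
  preserved by \<open>ev_transport\<close>.\<close>

lemma back_and_forth:
  fixes L :: "'i::linorder set" and L' :: "'j::linorder set" and \<delta> :: "'o rel"
    and W :: "'o \<Rightarrow> 'i set \<Rightarrow> ('i \<Rightarrow> 'j) \<Rightarrow> bool"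
  assumes W: "\<And>a D p. W a D p \<Longrightarrow> finite D \<and> D \<subseteq> L \<and> p ` D \<subseteq> L' \<and> strict_mono_on D p"
    and forth_ext: "\<And>a b D p S. W a D p \<Longrightarrow> (b, a) \<in> \<delta> - Id \<Longrightarrow> finite S \<Longrightarrow> S \<subseteq> L \<Longrightarrow>
      \<exists>D' p'. W b D' p' \<and> D \<subseteq> D' \<and> S \<subseteq> D' \<and> (\<forall>i\<in>D. p' i = p i)"
    and back_ext: "\<And>a b D p S. W a D p \<Longrightarrow> (b, a) \<in> \<delta> - Id \<Longrightarrow> finite S \<Longrightarrow> S \<subseteq> L' \<Longrightarrow>
      \<exists>D' p'. W b D' p' \<and> D \<subseteq> D' \<and> S \<subseteq> p' ` D' \<and> (\<forall>i\<in>D. p' i = p i)"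
    and start: "\<And>a. a \<in> Field \<delta> \<Longrightarrow> \<exists>D p. W a D p"
    and ne: "L \<noteq> {}" "L' \<noteq> {}"
  shows "delta_equiv TYPE('k) V \<delta> (NN L) (NN L')"
proof -
  let ?tr = "\<lambda>p F x. F (\<lambda>i. x (p i))"
  have FunD: "Fun L F" if "W a D p" "dtm F" "depends_on D F" for a D p F
    unfolding Fun_def using W[OF that(1)] that(2,3) by blast
  have Fun_tr: "Fun L' (?tr p F)" if "W a D p" "dtm F" "depends_on D F" for a D p F
    unfolding Fun_def
  proof (intro conjI exI[of _ "p ` D"])
    show "dtm (?tr p F)" by (rule dtm_lift[OF that(2)])
    show "depends_on (p ` D) (?tr p F)" by (rule depends_on_comp[OF that(3)]) simp
  qed (use W[OF that(1)] in auto)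
  have atomic: "fm_sat (NN L) e \<phi> \<longleftrightarrow> fm_sat (NN L') e' \<phi>"
    if \<phi>: "fm_in V \<phi>" "fm_vars \<phi> \<subseteq> {..<k}" and w: "W a D p"
      and F: "\<And>n. dtm (F n)" "\<And>n. depends_on D (F n)"
      and e: "range e \<subseteq> universe (NN L)" "range e' \<subseteq> universe (NN L')"
      and eF: "\<And>n. n < k \<Longrightarrow> e n = repr L (F n)" "\<And>n. n < k \<Longrightarrow> e' n = repr L' (?tr p (F n))"
    for \<phi> k a D p F e e'
  proof -
    have d: "depends_on D (\<lambda>x. fm_sat M (\<lambda>n. F n x) \<phi>)"
      unfolding depends_on_def
    proof (intro allI impI)
      fix x x' assume "\<forall>i\<in>D. x i = (x' i :: nat)"
      then have "F n x = F n x'" for n using depends_onD[OF F(2)] by blast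
      then show "fm_sat M (\<lambda>n. F n x) \<phi> = fm_sat M (\<lambda>n. F n x') \<phi>" by simp
    qed
    have "fm_sat (NN L) e \<phi> \<longleftrightarrow> ev (\<lambda>x. fm_sat M (\<lambda>n. F n x) \<phi>)"
      by (rule los_repr[OF _ FunD[OF w F] eF(1) \<phi>]) (use e(1) in auto)
    moreover have "fm_sat (NN L') e' \<phi> \<longleftrightarrow> ev (\<lambda>x. fm_sat M (\<lambda>n. ?tr p (F n) x) \<phi>)"
      by (rule los_repr[OF _ Fun_tr[OF w F] eF(2) \<phi>]) (use e(2) in auto)
    moreover have "ev (\<lambda>x. fm_sat M (\<lambda>n. ?tr p (F n) x) \<phi>) \<longleftrightarrow> ev (\<lambda>x. fm_sat M (\<lambda>n. F n x) \<phi>)"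
      using ev_transport[OF _ _ d, of p] W[OF w] by simp
    ultimately show ?thesis by simp
  qed
  have main: "inf_sat (NN L) e \<phi> \<longleftrightarrow> inf_sat (NN L') e' \<phi>"
    if "inf_in V \<phi>" "inf_vars \<phi> \<subseteq> {..<k}" "qr_le \<delta> \<phi> a" "W a D p"
      "\<And>n. dtm (F n)" "\<And>n. depends_on D (F n)"
      "range e \<subseteq> universe (NN L)" "range e' \<subseteq> universe (NN L')"
      "\<And>n. n < k \<Longrightarrow> e n = repr L (F n)" "\<And>n. n < k \<Longrightarrow> e' n = repr L' (?tr p (F n))"
    for \<phi> :: "('f, 'r, 'k) inf_fm" and k a D p F e e'
    using that
  proof (induction \<phi> arbitrary: k a D p F e e')
    case (IEq s t)
    then show ?case using atomic[of "Eq s t" k a D p F e e'] by simp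
  next
    case (IRel r ts)
    then show ?case using atomic[of "Rel r ts" k a D p F e e'] by simp
  next
    case (INeg \<phi>)
    have "inf_sat (NN L) e \<phi> = inf_sat (NN L') e' \<phi>"
      by (rule INeg.IH[OF _ _ _ INeg.prems(4-10)]) (use INeg.prems(1-3) in simp_all)
    then show ?case by simp
  next
    case (IConj I \<Phi>)
    have "inf_sat (NN L) e (\<Phi> i) = inf_sat (NN L') e' (\<Phi> i)" if "i \<in> I" for i
      by (rule IConj.IH[OF rangeI _ _ _ IConj.prems(4-10)]) (use IConj.prems(1-3) that in auto)
    then show ?case by simp
  next
    case (IEx \<phi>)
    obtain b where b: "(b, a) \<in> \<delta> - Id" "qr_le \<delta> \<phi> b" using IEx.prems(3) by auto
    have "n < Suc k" if "n \<in> inf_vars \<phi>" for n using IEx.prems(2) that by (cases n) auto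
    then have vars: "inf_in V \<phi>" "inf_vars \<phi> \<subseteq> {..<Suc k}" using IEx.prems(1) by auto
    have step: "inf_sat (NN L) (case_nat (repr L G) e) \<phi> \<longleftrightarrow> inf_sat (NN L') (case_nat (repr L' (?tr p' G)) e') \<phi>"
      if w: "W b D' p'" and D': "D \<subseteq> D'" "\<forall>i\<in>D. p' i = p i" and G: "dtm G" "depends_on D' G" for D' p' G
    proof (rule IEx.IH[OF vars b(2) w, of "case_nat G F"])
      fix n
      show "dtm (case_nat G F n)" using IEx.prems(5) G by (cases n) simp_all
      show "depends_on D' (case_nat G F n)"
        using depends_on_mono[OF IEx.prems(6) D'(1)] G by (cases n) simp_all
      show "case_nat (repr L G) e n = repr L (case_nat G F n)" if "n < Suc k"
        using IEx.prems(9) that by (cases n) simp_all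
      \<comment> \<open>Extending \<open>p\<close> leaves the earlier moves as they were.\<close>
      have "?tr p' (F m) = ?tr p (F m)" for m
        by (rule ext, rule depends_onD[OF IEx.prems(6)]) (use D'(2) in simp)
      then show "case_nat (repr L' (?tr p' G)) e' n = repr L' (?tr p' (case_nat G F n))" if "n < Suc k"
        using IEx.prems(10) that by (cases n) simp_all
    next
      show "range (case_nat (repr L G) e) \<subseteq> universe (NN L)"
        by (rule case_nat_range[OF _ IEx.prems(7)]) (use FunD[OF w G] in simp)
      show "range (case_nat (repr L' (?tr p' G)) e') \<subseteq> universe (NN L')"
        by (rule case_nat_range[OF _ IEx.prems(8)]) (use Fun_tr[OF w G] in simp)
    qed
    show ?case
    proof
      assume "inf_sat (NN L) e (IEx \<phi>)"
      then obtain G where G: "Fun L G" "inf_sat (NN L) (case_nat (repr L G) e) \<phi>" by auto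
      obtain S where S: "S \<subseteq> L" "finite S" "depends_on S G" using Fun_support[OF G(1)] by blast
      obtain D' p' where D': "W b D' p'" "D \<subseteq> D'" "S \<subseteq> D'" "\<forall>i\<in>D. p' i = p i"
        using forth_ext[OF IEx.prems(4) b(1) S(2,1)] by blast
      have dep: "depends_on D' G" by (rule depends_on_mono[OF S(3) D'(3)])
      have "inf_sat (NN L') (case_nat (repr L' (?tr p' G)) e') \<phi>"
        using step[OF D'(1,2,4) Fun_dtm[OF G(1)] dep] G(2) by blast
      moreover have "repr L' (?tr p' G) \<in> universe (NN L')"
        using Fun_tr[OF D'(1) Fun_dtm[OF G(1)] dep] by auto
      ultimately show "inf_sat (NN L') e' (IEx \<phi>)" unfolding inf_sat.simps by blast
    next
      assume "inf_sat (NN L') e' (IEx \<phi>)"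
      then obtain G where G: "Fun L' G" "inf_sat (NN L') (case_nat (repr L' G) e') \<phi>" by auto
      obtain S where S: "S \<subseteq> L'" "finite S" "depends_on S G" using Fun_support[OF G(1)] by blast
      obtain D' p' where D': "W b D' p'" "D \<subseteq> D'" "S \<subseteq> p' ` D'" "\<forall>i\<in>D. p' i = p i"
        using back_ext[OF IEx.prems(4) b(1) S(2,1)] by blast
      \<comment> \<open>The answer to \<open>G\<close> is its renaming by an inverse of
        \<open>p'\<close>; renaming by \<open>p'\<close> restores \<open>G\<close>, because its
        support lies in the range of \<open>p'\<close>.\<close>
      let ?q = "inv_into D' p'"
      have q: "?q j \<in> D'" "p' (?q j) = j" if "j \<in> S" for j
        using D'(3) that inv_into_into[of j p' D'] f_inv_into_f[of j p' D'] by auto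
      let ?H = "?tr ?q G"
      have dep: "depends_on D' ?H" by (rule depends_on_comp[OF S(3) q(1)])
      have dH: "dtm ?H" by (rule dtm_lift[OF Fun_dtm[OF G(1)]])
      have "?tr p' ?H = G"
        by (rule ext, rule depends_onD[OF S(3)]) (simp add: q(2))
      then have "inf_sat (NN L) (case_nat (repr L ?H) e) \<phi>"
        using step[OF D'(1,2,4) dH dep] G(2) by simp
      moreover have "repr L ?H \<in> universe (NN L)"
        using FunD[OF D'(1) dH dep] by auto
      ultimately show "inf_sat (NN L) e (IEx \<phi>)" unfolding inf_sat.simps by blast
    qed
  qed
  have nonempty: "\<exists>e :: nat \<Rightarrow> _. range e \<subseteq> universe (NN L)" "\<exists>e :: nat \<Rightarrow> _. range e \<subseteq> universe (NN L')"
    by (rule assignment_exists, use NN_struct[OF ne(1)] NN_struct[OF ne(2)] in \<open>simp add: is_struct_def\<close>)+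
  have "inf_true (NN L) \<phi> \<longleftrightarrow> inf_true (NN L') \<phi>"
    if \<phi>: "inf_in V \<phi>" "inf_vars \<phi> = {}" "qr_less \<phi> \<delta>" for \<phi> :: "('f, 'r, 'k) inf_fm"
  proof -
    obtain a where a: "a \<in> Field \<delta>" "qr_le \<delta> \<phi> a" using \<phi>(3) unfolding qr_less_def by blast
    obtain D p where w: "W a D p" using start[OF a(1)] by blast
    have "inf_sat (NN L) e \<phi> \<longleftrightarrow> inf_sat (NN L') e' \<phi>"
      if "range e \<subseteq> universe (NN L)" "range e' \<subseteq> universe (NN L')" for e e'
      by (rule main[OF \<phi>(1) _ a(2) w, of 0 "\<lambda>_ _. 0"])
        (use \<phi>(2) that in \<open>simp_all add: dtm_const depends_on_def\<close>)
    then show ?thesis using nonempty unfolding inf_true_def by meson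
  qed
  then show ?thesis unfolding delta_equiv_def by blast
qed

end

subsection \<open>Elementary cuts\<close>

text \<open>An initial segment passing the Tarski-Vaught test. The notion refers to the structure
  alone, so isomorphisms preserve it. The empty set qualifies; \<open>cut_closed\<close> and
  \<open>cut_same_as_var\<close> demand in addition that the constants, that is \<open>M\<close>,
  lie in the cut.\<close>

definition elem_cut :: "('f, 'r) vocab \<Rightarrow> 'r \<Rightarrow> ('f, 'r, 'u) fo_struct \<Rightarrow> 'u set \<Rightarrow> bool" where
  "elem_cut V lt A J \<longleftrightarrow> J \<subseteq> universe A \<and>
    (\<forall>a\<in>universe A. \<forall>b\<in>J. rinterp A lt [a, b] \<longrightarrow> a \<in> J) \<and>
    (\<forall>\<phi> e. fm_in V \<phi> \<longrightarrow> range e \<subseteq> J \<longrightarrow> (\<exists>a\<in>universe A. fm_sat A (case_nat a e) \<phi>) \<longrightarrow>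
      (\<exists>a\<in>J. fm_sat A (case_nat a e) \<phi>))"

lemma elem_cutD:
  assumes "elem_cut V lt A J"
  shows "J \<subseteq> universe A"
    and "a \<in> universe A \<Longrightarrow> b \<in> J \<Longrightarrow> rinterp A lt [a, b] \<Longrightarrow> a \<in> J"
    and "fm_in V \<phi> \<Longrightarrow> range e \<subseteq> J \<Longrightarrow> a \<in> universe A \<Longrightarrow> fm_sat A (case_nat a e) \<phi> \<Longrightarrow>
      \<exists>a\<in>J. fm_sat A (case_nat a e) \<phi>"
  using assms unfolding elem_cut_def by blast+

lemma iso_elem_cut:
  assumes h: "iso_map V A B h" and A: "is_struct V A" and lt: "lt \<in> rels V" "rarity V lt = 2"
    and J: "elem_cut V lt A J"
  shows "elem_cut V lt B (h ` J)"
  unfolding elem_cut_def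
proof (intro conjI allI impI ballI)
  have im: "h ` universe A = universe B" using iso_map_bij[OF h] by (simp add: bij_betw_def)
  show "h ` J \<subseteq> universe B" using im elem_cutD(1)[OF J] by blast
  fix b b' assume b: "b \<in> universe B" "b' \<in> h ` J" "rinterp B lt [b, b']"
  obtain a a' where a: "a \<in> universe A" "b = h a" "a' \<in> J" "b' = h a'" using b im by blast
  have "set [a, a'] \<subseteq> universe A" using a elem_cutD(1)[OF J] by auto
  then have "rinterp A lt [a, a'] = rinterp B lt (map h [a, a'])"
    using h lt unfolding iso_map_def by (metis length_Cons list.size(3) numeral_2_eq_2)
  then show "b \<in> h ` J" using elem_cutD(2)[OF J a(1,3)] a b(3) by simp
next
  fix \<phi> e assume *: "fm_in V \<phi>" "range e \<subseteq> h ` J" "\<exists>b\<in>universe B. fm_sat B (case_nat b e) \<phi>"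
  have im: "h ` universe A = universe B" using iso_map_bij[OF h] by (simp add: bij_betw_def)
  have "\<forall>n. \<exists>a. a \<in> J \<and> e n = h a" using *(2) by blast
  then obtain d where d: "\<And>n. d n \<in> J" "\<And>n. e n = h (d n)" by metis
  have sat: "fm_sat A (case_nat a d) \<phi> \<longleftrightarrow> fm_sat B (case_nat (h a) e) \<phi>" if "a \<in> universe A" for a
  proof -
    have "range (case_nat a d) \<subseteq> universe A"
      by (rule case_nat_range[OF that]) (use d(1) elem_cutD(1)[OF J] in blast)
    from iso_fm_sat[OF h A this *(1)] show ?thesis
      unfolding comp_case_nat by (simp add: d(2)[symmetric])
  qed
  obtain a where a: "a \<in> universe A" "fm_sat B (case_nat (h a) e) \<phi>" using *(3) unfolding im[symmetric] by blast
  have "range d \<subseteq> J" using d(1) by blast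
  then obtain a' where "a' \<in> J" "fm_sat A (case_nat a' d) \<phi>"
    using elem_cutD(3)[OF J *(1) _ a(1)] sat[OF a(1)] a(2) by blast
  then show "\<exists>b\<in>h ` J. fm_sat B (case_nat b e) \<phi>" using sat elem_cutD(1)[OF J] by blast
qed

context lnp_model
begin

section \<open>Bounds for definable functions\<close>

lemma dfn1_bound: "dfun1 g \<Longrightarrow> dfn1 (\<lambda>u. \<forall>a. a \<sqsubseteq> w \<longrightarrow> g a \<sqsubseteq> u)"
  unfolding dfn1_def by (rule dfn_all) (intro dfn_imp dfn_leq dtm_var dtm_const dfun1D[of g])

lemma collection1: assumes g: "dfun1 g" shows "\<exists>u. \<forall>a. a \<sqsubseteq> w \<longrightarrow> g a \<sqsubseteq> u"
proof (rule dfn_induct[where P = "\<lambda>w. \<exists>u. \<forall>a. a \<sqsubseteq> w \<longrightarrow> g a \<sqsubseteq> u"])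
  show "dfn1 (\<lambda>w. \<exists>u. \<forall>a. a \<sqsubseteq> w \<longrightarrow> g a \<sqsubseteq> u)"
    unfolding dfn1_def by (rule dfn_ex, rule dfn_all) (intro dfn_imp dfn_leq dtm_var dfun1D[OF g])
next
  fix x assume "\<And>y. \<not> y \<sqsubset> x"
  then have "a \<sqsubseteq> x \<longrightarrow> g a \<sqsubseteq> g x" for a by (auto simp: leq_def)
  then show "\<exists>u. \<forall>a. a \<sqsubseteq> x \<longrightarrow> g a \<sqsubseteq> u" by blast
next
  fix x y assume y: "\<And>z. z \<sqsubset> x \<Longrightarrow> z \<sqsubseteq> y" and "\<exists>u. \<forall>a. a \<sqsubseteq> y \<longrightarrow> g a \<sqsubseteq> u"
  then obtain u where u: "\<And>a. a \<sqsubseteq> y \<Longrightarrow> g a \<sqsubseteq> u" by blast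
  have "g a \<sqsubseteq> ord.max u (g x)" if "a \<sqsubseteq> x" for a
  proof (cases "a = x")
    case False
    then have "a \<sqsubseteq> y" using that y unfolding leq_def by blast
    then show ?thesis using u[of a] by (simp add: ord.le_max_iff_disj)
  qed simp
  then show "\<exists>u. \<forall>a. a \<sqsubseteq> x \<longrightarrow> g a \<sqsubseteq> u" by blast
qed

text \<open>The place \<open>None\<close> carries the bound of the box. Treating one coordinate at a
  time avoids codes for tuples: \<open>collection1\<close> bounds the values along coordinate
  \<open>i\<close>, and \<open>mu\<close> picks a bound definably.\<close>

lemma bound_step:
  fixes f :: "('i option \<Rightarrow> nat) \<Rightarrow> nat"
  assumes f: "dtm f"
  shows "\<exists>g. dtm g \<and> (\<forall>e a. a \<sqsubseteq> e None \<longrightarrow> f (e(Some i := a)) \<sqsubseteq> g e)"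
proof -
  have g: "dfun1 (\<lambda>a. f (e(Some i := a)))" for e
  proof -
    have "dtm (\<lambda>x :: nat \<Rightarrow> nat. ((\<lambda>j. e j)(Some i := x 0)) j)" for j
      by (rule dtm_upd[OF dtm_var dtm_const])
    from dtm_subst[OF f, of "\<lambda>j x. ((\<lambda>j. e j)(Some i := x 0)) j", OF this] show ?thesis
      unfolding dfun1_def by (simp del: fun_upd_apply)
  qed
  let ?g = "\<lambda>e. mu (\<lambda>u. \<forall>a. a \<sqsubseteq> e None \<longrightarrow> f (e(Some i := a)) \<sqsubseteq> u)"
  have ex: "\<exists>u. \<forall>a. a \<sqsubseteq> e None \<longrightarrow> f (e(Some i := a)) \<sqsubseteq> u" for e
    by (rule collection1[OF g])
  have "dtm ?g"
  proof (rule dtm_mu[OF _ ex], rule dfn_all, rule dfn_imp)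
    have "dtm (\<lambda>y. ((\<lambda>j. y (Some (Some j)))(Some i := y None)) j)" for j
      by (rule dtm_upd[OF dtm_var dtm_var])
    from dtm_subst[OF f this]
    show "dfn (\<lambda>e. f ((\<lambda>ia. e (Some (Some ia)))(Some i := e None)) \<sqsubseteq> e (Some None))"
      by (rule dfn_leq[OF _ dtm_var])
  qed (rule dfn_leq[OF dtm_var dtm_var])
  moreover have "f (e(Some i := a)) \<sqsubseteq> ?g e" if "a \<sqsubseteq> e None" for e a
  proof -
    obtain u where u: "\<forall>a. a \<sqsubseteq> e None \<longrightarrow> f (e(Some i := a)) \<sqsubseteq> u" using ex by blast
    show ?thesis using mu_holds[OF dfn1_bound[OF g] u] that by blast
  qed
  ultimately show ?thesis by (intro exI[of _ ?g]) blast
qed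

lemma bound_box:
  fixes f :: "('i option \<Rightarrow> nat) \<Rightarrow> nat"
  assumes f: "dtm f"
  shows "\<exists>g. dtm g \<and> (\<forall>e e'. (\<forall>j\<in>set is. e' (Some j) \<sqsubseteq> e None) \<longrightarrow>
    (\<forall>j. j \<notin> Some ` set is \<longrightarrow> e' j = e j) \<longrightarrow> f e' \<sqsubseteq> g e)"
proof (induction "is")
  case Nil
  have "f e' \<sqsubseteq> f e" if "\<forall>j. e' j = e j" for e e'
  proof -
    have "e' = e" using that by (simp add: fun_eq_iff)
    then show ?thesis by simp
  qed
  then show ?case using f by (intro exI[of _ f]) simp
next
  case (Cons i "is")
  obtain g where g: "dtm g" "\<And>e e'. (\<forall>j\<in>set is. e' (Some j) \<sqsubseteq> e None) \<Longrightarrow>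
    (\<forall>j. j \<notin> Some ` set is \<longrightarrow> e' j = e j) \<Longrightarrow> f e' \<sqsubseteq> g e" using Cons.IH by blast
  obtain g' where g': "dtm g'" "\<And>e a. a \<sqsubseteq> e None \<Longrightarrow> g (e(Some i := a)) \<sqsubseteq> g' e"
    using bound_step[OF g(1)] by blast
  have "f e' \<sqsubseteq> g' e" if e: "\<forall>j\<in>set (i # is). e' (Some j) \<sqsubseteq> e None"
    "\<forall>j. j \<notin> Some ` set (i # is) \<longrightarrow> e' j = e j" for e e'
  proof -
    have "f e' \<sqsubseteq> g (e(Some i := e' (Some i)))" by (rule g(2)) (use e in auto)
    also have "\<dots> \<sqsubseteq> g' e" by (rule g'(2)) (use e in simp)
    finally show ?thesis .
  qed
  then show ?case using g'(1) by blast
qed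

lemma dtm_bounded:
  assumes f: "dtm f" "finite S" "depends_on S f"
  shows "\<exists>g. dfun1 g \<and> (\<forall>w e. (\<forall>i\<in>S. e i \<sqsubseteq> w) \<longrightarrow> f e \<sqsubseteq> g w)"
proof -
  obtain "is" where set_is: "set is = S" using finite_list[OF f(2)] by blast
  obtain g where g: "dtm g" "\<And>e e'. (\<forall>j\<in>set is. e' (Some j) \<sqsubseteq> e None) \<Longrightarrow>
    (\<forall>j. j \<notin> Some ` set is \<longrightarrow> e' j = e j) \<Longrightarrow> f (\<lambda>i. e' (Some i)) \<sqsubseteq> g e"
    using bound_box[OF dtm_lift[OF f(1), of Some], of "is"] by blast
  let ?g = "\<lambda>w. g (case_option w (\<lambda>_. 0))"
  have "dtm (\<lambda>x :: nat \<Rightarrow> nat. case j of None \<Rightarrow> x 0 | Some i \<Rightarrow> 0)" for j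
    by (rule dtm_option[OF dtm_var dtm_const])
  from dtm_subst[OF g(1), of "\<lambda>j x. case j of None \<Rightarrow> x 0 | Some i \<Rightarrow> 0", OF this]
  have "dfun1 ?g" unfolding dfun1_def by simp
  moreover have "f e \<sqsubseteq> ?g w" if "\<forall>i\<in>S. e i \<sqsubseteq> w" for w e
  proof -
    let ?e = "case_option w (\<lambda>i. if i \<in> S then e i else 0)"
    have "f (\<lambda>i. ?e (Some i)) \<sqsubseteq> ?g w"
      by (rule g(2)) (use that set_is in \<open>auto split: option.split\<close>)
    moreover have "f (\<lambda>i. ?e (Some i)) = f e" by (rule depends_onD[OF f(3)]) simp
    ultimately show ?thesis by simp
  qed
  ultimately show ?thesis by blast
qed

lemma dtm_max: assumes "dtm A" "dtm B" shows "dtm (\<lambda>x. ord.max (A x) (B x))"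
proof -
  have eq: "(a = ord.max b c) \<longleftrightarrow> (b \<sqsubseteq> c \<and> a = c) \<or> (\<not> b \<sqsubseteq> c \<and> a = b)" for a b c
    by (simp add: ord.max_def)
  show ?thesis unfolding dtm_def eq
    by (intro dfn_disj dfn_conj dfn_not dfn_leq dfn_eq dtm_var dtm_lift[OF assms(1)] dtm_lift[OF assms(2)])
qed

lemma Fun_max: assumes "Fun L A" "Fun L B" shows "Fun L (\<lambda>x. ord.max (A x) (B x))"
proof -
  obtain S where S: "S \<subseteq> L" "finite S" "depends_on S A" using Fun_support[OF assms(1)] by blast
  obtain S' where S': "S' \<subseteq> L" "finite S'" "depends_on S' B" using Fun_support[OF assms(2)] by blast
  have "depends_on (S \<union> S') (\<lambda>x. ord.max (A x) (B x))"
    unfolding depends_on_def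
  proof (intro allI impI)
    fix x x' :: "'a \<Rightarrow> nat" assume "\<forall>i\<in>S \<union> S'. x i = x' i"
    then have "A x = A x'" "B x = B x'" using depends_onD[OF S(3), of x x'] depends_onD[OF S'(3), of x x'] by auto
    then show "ord.max (A x) (B x) = ord.max (A x') (B x')" by simp
  qed
  then show ?thesis
    unfolding Fun_def using S S' dtm_max[OF Fun_dtm[OF assms(1)] Fun_dtm[OF assms(2)]]
    by (intro conjI exI[of _ "S \<union> S'"]) auto
qed

lemma Fun_const: "Fun L (\<lambda>_. a)"
  unfolding Fun_def depends_on_def by (intro conjI exI[of _ "{}"] dtm_const) auto

lemma Fun_var: "i \<in> L \<Longrightarrow> Fun L (\<lambda>x. x i)"
  unfolding Fun_def depends_on_def by (intro conjI exI[of _ "{i}"] dtm_var) auto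

lemma Fun_dfun1:
  assumes "dfun1 g" "Fun L F"
  shows "Fun L (\<lambda>x. g (F x))"
proof -
  obtain S where S: "S \<subseteq> L" "finite S" "depends_on S F" using Fun_support[OF assms(2)] by blast
  have "depends_on S (\<lambda>x. g (F x))" unfolding depends_on_def using depends_onD[OF S(3)] by metis
  then show ?thesis unfolding Fun_def using S dfun1D[OF assms(1) Fun_dtm[OF assms(2)]] by blast
qed

lemma Fun_comp:
  assumes "dtm G" "finite S" "depends_on S G" "\<And>i. Fun L (B i)"
  shows "Fun L (\<lambda>x. G (\<lambda>i. B i x))"
proof -
  obtain S' where S': "S' \<subseteq> L" "finite S'" "\<forall>i\<in>S. depends_on S' (B i)"
    using finite_supports[OF assms(2), of L B] assms(4) by auto
  have "depends_on S' (\<lambda>x. G (\<lambda>i. B i x))"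
    unfolding depends_on_def
  proof (intro allI impI)
    fix x x' :: "'b \<Rightarrow> nat" assume *: "\<forall>i\<in>S'. x i = x' i"
    show "G (\<lambda>i. B i x) = G (\<lambda>i. B i x')"
      by (rule depends_onD[OF assms(3)]) (use * S'(3) depends_onD in blast)
  qed
  then show ?thesis
    unfolding Fun_def using S' dtm_subst[OF assms(1), of B, OF Fun_dtm[OF assms(4)]] by blast
qed

lemma common_bound:
  assumes "finite S" "\<And>n. n \<in> S \<Longrightarrow> Fun L (H n)"
  shows "\<exists>W. Fun L W \<and> (\<forall>n\<in>S. \<forall>x. H n x \<sqsubseteq> W x)"
  using assms
proof (induction S)
  case empty
  then show ?case using Fun_const by auto
next
  case (insert n S)
  then obtain W where W: "Fun L W" "\<And>m x. m \<in> S \<Longrightarrow> H m x \<sqsubseteq> W x" by blast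
  have "Fun L (\<lambda>x. ord.max (H n x) (W x))" by (rule Fun_max[OF _ W(1)]) (simp add: insert.prems)
  moreover have "H m x \<sqsubseteq> ord.max (H n x) (W x)" if "m \<in> insert n S" for m x
    using that W(2)[of m x] by (auto simp: ord.le_max_iff_disj)
  ultimately show ?case by blast
qed

section \<open>Closure properties of cuts\<close>

lemma NN_lt:
  assumes "Fun L F" "Fun L G"
  shows "rinterp (NN L) lt [repr L F, repr L G] \<longleftrightarrow> ev (\<lambda>x. F x \<sqsubset> G x)"
proof -
  let ?F = "\<lambda>n :: nat. if n = 0 then F else G"
  have "fm_sat (NN L) (\<lambda>n. repr L (?F n)) (Rel lt [Var 0, Var 1]) \<longleftrightarrow>
      ev (\<lambda>x. fm_sat M (\<lambda>n. ?F n x) (Rel lt [Var 0, Var 1]))"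
    by (rule los_repr[where k = 2]) (use assms lt_in in auto)
  then show ?thesis unfolding lss_def by (simp del: NN_simps)
qed

lemma ev_disj: assumes "dfn P" "dfn Q" shows "ev (\<lambda>x. P x \<or> Q x) \<longleftrightarrow> ev P \<or> ev Q"
  using ev_not[OF dfn_conj[OF dfn_not[OF assms(1)] dfn_not[OF assms(2)]]]
    ev_conj[OF dfn_not[OF assms(1)] dfn_not[OF assms(2)]] ev_not[OF assms(1)] ev_not[OF assms(2)]
  by simp

lemma ev_leq: "dtm F \<Longrightarrow> dtm G \<Longrightarrow> ev (\<lambda>x. F x \<sqsubseteq> G x) \<longleftrightarrow> eqv F G \<or> ev (\<lambda>x. F x \<sqsubset> G x)"
  unfolding leq_def eqv_def by (rule ev_disj[OF dfn_eq dfn_lss])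

lemma cut_leq:
  assumes "elem_cut V lt (NN L) J" "Fun L F" "Fun L G" "repr L G \<in> J" "ev (\<lambda>x. F x \<sqsubseteq> G x)"
  shows "repr L F \<in> J"
  using assms(5) ev_leq[OF Fun_dtm[OF assms(2)] Fun_dtm[OF assms(3)]]
proof (elim iffE)
  have "repr L F \<in> universe (NN L)" using assms(2) by simp
  moreover assume "ev (\<lambda>x. F x \<sqsubseteq> G x) \<longrightarrow> eqv F G \<or> ev (\<lambda>x. F x \<sqsubset> G x)"
  ultimately show ?thesis
    using repr_eq_iff[OF assms(2,3)] NN_lt[OF assms(2,3)] elem_cutD(2)[OF assms(1) _ assms(4)] assms(4,5) by metis
qed

text \<open>The graph of \<open>G\<close> is given by a formula with parameters from
  \<open>M\<close>, hence the demand for constants in \<open>J\<close>. The Tarski-Vaught test finds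
  a value in \<open>J\<close>, and the value is unique.\<close>

lemma cut_closed:
  assumes J: "elem_cut V lt (NN L) J" and const: "\<And>v. repr L (\<lambda>_. v) \<in> J"
    and G: "dtm G" "finite S" "depends_on S G" and B: "\<And>i. Fun L (B i)" "\<And>i. repr L (B i) \<in> J"
  shows "repr L (\<lambda>x. G (\<lambda>i. B i x)) \<in> J"
proof -
  obtain \<phi> \<rho> where \<phi>: "fm_in V \<phi>"
    "\<And>a e. (a = G e) = fm_sat M (case_nat a (\<lambda>n. case_sum e id (\<rho> n))) \<phi>"
    using dfn_optionE[of "\<lambda>a e. a = G e", OF G(1)[unfolded dtm_def]] by metis
  define E where "E n = case_sum B (\<lambda>v _. v) (\<rho> n)" for n
  have E: "Fun L (E n)" "repr L (E n) \<in> J" for n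
    unfolding E_def using B const Fun_const by (auto split: sum.split)
  let ?GB = "\<lambda>x. G (\<lambda>i. B i x)"
  have GB: "Fun L ?GB" by (rule Fun_comp[OF G B(1)])
  have sat: "fm_sat (NN L) (case_nat (repr L H) (\<lambda>n. repr L (E n))) \<phi> \<longleftrightarrow> eqv H ?GB" if H: "Fun L H" for H
  proof -
    obtain k where k: "fm_vars \<phi> \<subseteq> {..<k}"
      using finite_fm_vars[of \<phi>] finite_nat_iff_bounded by blast
    have F: "Fun L (case_nat H E n)" for n using H E by (cases n) simp_all
    have "fm_sat (NN L) (case_nat (repr L H) (\<lambda>n. repr L (E n))) \<phi> \<longleftrightarrow>
        ev (\<lambda>x. fm_sat M (\<lambda>n. case_nat H E n x) \<phi>)"
    proof (rule los_repr[OF _ F _ \<phi>(1) k])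
      fix n
      show "case_nat (repr L H) (\<lambda>n. repr L (E n)) n = repr L (case_nat H E n)" by (cases n) simp_all
      then show "case_nat (repr L H) (\<lambda>n. repr L (E n)) n \<in> universe (NN L)" using F[of n] by simp
    qed
    moreover have "fm_sat M (\<lambda>n. case_nat H E n x) \<phi> \<longleftrightarrow> H x = ?GB x" for x
      unfolding \<phi>(2) E_def by (rule fm_sat_cong) (simp split: nat.split sum.split)
    ultimately show ?thesis by (simp add: eqv_def)
  qed
  have "\<exists>a\<in>J. fm_sat (NN L) (case_nat a (\<lambda>n. repr L (E n))) \<phi>"
    by (rule elem_cutD(3)[OF J \<phi>(1), of _ "repr L ?GB"]) (use E(2) GB sat[OF GB] eqv_refl in auto)
  then obtain a where a: "a \<in> J" "fm_sat (NN L) (case_nat a (\<lambda>n. repr L (E n))) \<phi>" by blast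
  have "a \<in> universe (NN L)" using a(1) elem_cutD(1)[OF J] by blast
  then have "Fun L a" "repr L a = a" by (rule NN_Fun, rule repr_idem)
  then have "repr L ?GB = a" using sat[of a] a(2) repr_eq_iff[OF _ GB, of a] by simp
  then show ?thesis using a(1) by simp
qed

lemma iter_append: "iter (is @ js) P e = iter is (iter js P) e"
  by (induction "is" arbitrary: e) simp_all

text \<open>The largest index is quantified innermost and can be split off; this permits induction
  on the support from the top.\<close>

lemma ev_top:
  fixes m :: "'i::linorder"
  assumes "finite S" "\<And>s. s \<in> S \<Longrightarrow> s < m" "depends_on (insert m S) P"
  shows "ev P \<longleftrightarrow> ev (\<lambda>x. ult (\<lambda>z. P (x(m := z))))"
    and "depends_on S (\<lambda>x. ult (\<lambda>z. P (x(m := z))))"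
proof -
  show d: "depends_on S (\<lambda>x. ult (\<lambda>z. P (x(m := z))))"
    unfolding depends_on_def
  proof (intro allI impI)
    fix x x' :: "'i \<Rightarrow> nat" assume "\<forall>i\<in>S. x i = x' i"
    then have "P (x(m := z)) = P (x'(m := z))" for z by (intro depends_onD[OF assms(3)]) auto
    then show "ult (\<lambda>z. P (x(m := z))) = ult (\<lambda>z. P (x'(m := z)))" by simp
  qed
  have "sorted_list_of_set (insert m S) = sorted_list_of_set S @ [m]"
  proof (rule sorted_distinct_set_unique)
    show "sorted (sorted_list_of_set S @ [m])" "distinct (sorted_list_of_set S @ [m])"
      using assms(1,2) by (auto simp: sorted_append less_imp_le)
  qed (use assms(1) in \<open>simp_all del: sorted_list_of_set_insert_remove\<close>)
  moreover have "iter [m] P = (\<lambda>x. ult (\<lambda>z. P (x(m := z))))" by (rule ext) simp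
  ultimately show "ev P \<longleftrightarrow> ev (\<lambda>x. ult (\<lambda>z. P (x(m := z))))"
    using ev_iff[OF finite.insertI[OF assms(1)] assms(3), of "\<lambda>_. 0"] ev_iff[OF assms(1) d, of "\<lambda>_. 0"]
    by (simp add: iter_append del: fun_upd_apply)
qed

text \<open>The value of \<open>H\<close> is fixed before that of index \<open>y\<close> is chosen,
  and \<open>ult\<close> contains every final segment.\<close>

lemma ev_below:
  fixes y :: "'i::linorder"
  assumes "finite S" "\<And>s. s \<in> S \<Longrightarrow> s < y" "depends_on S H"
  shows "ev (\<lambda>x. H x \<sqsubset> x y)"
proof -
  have "depends_on (insert y S) (\<lambda>x. H x \<sqsubset> x y)"
    unfolding depends_on_def
  proof (intro allI impI)
    fix x x' :: "'i \<Rightarrow> nat" assume "\<forall>i\<in>insert y S. x i = x' i"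
    then show "H x \<sqsubset> x y \<longleftrightarrow> H x' \<sqsubset> x' y" using depends_onD[OF assms(3), of x x'] by simp
  qed
  note ev_top(1)[OF assms(1,2) this]
  moreover have "H (x(y := z)) = H x" for x z
    by (rule depends_onD[OF assms(3)]) (use assms(2) in auto)
  ultimately show ?thesis by (simp add: ult_gt)
qed

text \<open>The downward closure in \<open>NN L\<close> of the elements supported below
  \<open>y\<close>: the cut that separates the generators before \<open>y\<close> from the one at
  \<open>y\<close>.\<close>

definition below_cut :: "'i::linorder set \<Rightarrow> 'i \<Rightarrow> (('i \<Rightarrow> nat) \<Rightarrow> nat) set" where
  "below_cut L y = {G \<in> universe (NN L). \<exists>H. Fun (L \<inter> {..<y}) H \<and> ev (\<lambda>x. G x \<sqsubseteq> H x)}"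

lemma var_below_cut: assumes "i \<in> L" "i < y" shows "repr L (\<lambda>x. x i) \<in> below_cut L y"
proof -
  have F: "Fun L (\<lambda>x. x i)" by (rule Fun_var[OF assms(1)])
  have "Fun (L \<inter> {..<y}) (\<lambda>x. x i)" by (rule Fun_var) (use assms in simp)
  moreover have "ev (\<lambda>x. repr L (\<lambda>x. x i) x \<sqsubseteq> x i)"
    using eqv_sym[OF repr(2)[OF F]] ev_leq[OF Fun_dtm[OF repr(1)[OF F]] Fun_dtm[OF F]] by simp
  ultimately show ?thesis unfolding below_cut_def using F by auto
qed

lemma var_not_below_cut: assumes "y \<in> L" shows "repr L (\<lambda>x. x y) \<notin> below_cut L y"
proof
  assume "repr L (\<lambda>x. x y) \<in> below_cut L y"
  then obtain H where H: "Fun (L \<inter> {..<y}) H" "ev (\<lambda>x. repr L (\<lambda>x. x y) x \<sqsubseteq> H x)"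
    unfolding below_cut_def by blast
  have F: "Fun L (\<lambda>x. x y)" by (rule Fun_var[OF assms])
  note dt = Fun_dtm[OF repr(1)[OF F]] Fun_dtm[OF H(1)] Fun_dtm[OF F]
  obtain S where S: "S \<subseteq> L \<inter> {..<y}" "finite S" "depends_on S H" using Fun_support[OF H(1)] by blast
  have "ev (\<lambda>x. H x \<sqsubset> x y)" by (rule ev_below[OF S(2) _ S(3)]) (use S(1) in auto)
  then have "ev (\<lambda>x. H x \<sqsubset> repr L (\<lambda>x. x y) x)"
    by (rule ev_imp[where Q = "\<lambda>x. x y = repr L (\<lambda>x. x y) x"])
      (use repr(2)[OF F] in \<open>simp_all add: eqv_def dfn_lss dfn_eq dt\<close>)
  then have "ev (\<lambda>x. x y \<noteq> x y)"
    by (rule ev_imp[OF H(2) _ _ _, rotated 3]) (auto simp: dfn_lss dfn_leq dfn_const dt dest: ord.leD)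
  then show False by simp
qed

text \<open>Parameters in the cut are bounded by functions supported below \<open>y\<close> but need
  not have such support themselves, so a Skolem function alone does not suffice. The Skolem function
  \<open>f\<close> of \<open>\<phi>\<close> is bounded on boxes by a definable \<open>g\<close>, and
  the bounds of the relevant parameters by one \<open>W\<close>; thus the witness is at most
  \<open>g (W x)\<close>, which is supported below \<open>y\<close>.\<close>

lemma elem_cut_below: 
  assumes "L \<noteq> {}"
  shows "elem_cut V lt (NN L) (below_cut L y)"
  unfolding elem_cut_def
proof (intro conjI ballI allI impI)
  show "below_cut L y \<subseteq> universe (NN L)" unfolding below_cut_def by blast
next
  fix a b assume a: "a \<in> universe (NN L)" and b: "b \<in> below_cut L y" and ab: "rinterp (NN L) lt [a, b]"
  obtain H where H: "Fun (L \<inter> {..<y}) H" "ev (\<lambda>x. b x \<sqsubseteq> H x)" and b': "b \<in> universe (NN L)"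
    using b unfolding below_cut_def by blast
  have "ev (\<lambda>x. a x \<sqsubset> b x)"
    using NN_lt[OF NN_Fun[OF a] NN_Fun[OF b']] ab repr_idem[OF a] repr_idem[OF b'] by simp
  then have "ev (\<lambda>x. a x \<sqsubseteq> H x)"
    by (rule ev_imp[OF H(2) _ _ _, rotated 3])
      (use Fun_dtm[OF NN_Fun[OF a]] Fun_dtm[OF NN_Fun[OF b']] Fun_dtm[OF H(1)] ord.less_imp_le ord.order_trans in
        \<open>blast intro: dfn_lss dfn_leq\<close>)+
  then show "a \<in> below_cut L y" unfolding below_cut_def using a H(1) by blast
next
  fix \<phi> e assume \<phi>: "fm_in V \<phi>" and e: "range e \<subseteq> below_cut L y"
    and ex: "\<exists>a\<in>universe (NN L). fm_sat (NN L) (case_nat a e) \<phi>"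
  let ?S = "fm_vars (All \<phi>)"
  have eU: "e n \<in> universe (NN L)" for n using e unfolding below_cut_def by blast
  have "\<forall>n. \<exists>H. Fun (L \<inter> {..<y}) H \<and> ev (\<lambda>x. e n x \<sqsubseteq> H x)" using e unfolding below_cut_def by blast
  then obtain H where H: "\<And>n. Fun (L \<inter> {..<y}) (H n)" "\<And>n. ev (\<lambda>x. e n x \<sqsubseteq> H n x)" by metis
  obtain W where W: "Fun (L \<inter> {..<y}) W" "\<And>n x. n \<in> ?S \<Longrightarrow> H n x \<sqsubseteq> W x"
    using common_bound[OF finite_fm_vars, of "All \<phi>" "L \<inter> {..<y}" H] H(1) by blast
  define f where "f d = mu (\<lambda>a. fm_sat M (case_nat a d) \<phi> \<or> \<not> (\<exists>a. fm_sat M (case_nat a d) \<phi>))" for d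
  have exf: "\<exists>a. fm_sat M (case_nat a d) \<phi> \<or> \<not> (\<exists>a. fm_sat M (case_nat a d) \<phi>)" for d by blast
  have d\<phi>: "dfn (\<lambda>x :: nat option \<Rightarrow> nat. fm_sat M (case_nat (x None) (\<lambda>i. x (Some i))) \<phi>)"
    by (rule dfn_fm_dtm[OF \<phi>]) (rule dtm_case_nat[OF dtm_var dtm_var])
  have df: "dfn (\<lambda>x :: nat option \<Rightarrow> nat. fm_sat M (case_nat (x None) (\<lambda>i. x (Some i))) \<phi> \<or>
      \<not> (\<exists>a. fm_sat M (case_nat a (\<lambda>i. x (Some i))) \<phi>))"
    by (intro dfn_disj d\<phi> dfn_not dfn_subst[OF dfn_ex[OF d\<phi>] voc_var])
  have f: "dtm f" unfolding f_def by (rule dtm_mu[OF df exf])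
  have fd: "depends_on ?S f"
    unfolding depends_on_def
  proof (intro allI impI)
    fix d d' :: "nat \<Rightarrow> nat" assume *: "\<forall>i\<in>?S. d i = d' i"
    have "fm_sat M (case_nat a d) \<phi> = fm_sat M (case_nat a d') \<phi>" for a
      by (rule fm_sat_cong) (use * in \<open>auto split: nat.split\<close>)
    then show "f d = f d'" unfolding f_def by simp
  qed
  have spec: "fm_sat M (case_nat (f d) d) \<phi>" if "fm_sat M (case_nat a d) \<phi>" for a d
  proof -
    have "dfn1 (\<lambda>a. fm_sat M (case_nat a d) \<phi> \<or> \<not> (\<exists>a. fm_sat M (case_nat a d) \<phi>))"
      unfolding dfn1_def
      using dfn_subst[OF df, of "\<lambda>y z. case y of None \<Rightarrow> z 0 | Some i \<Rightarrow> d i", OF voc_option[OF voc_var voc_const]] by simp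
    from mu_holds[OF this, of a] show ?thesis using that unfolding f_def by blast
  qed
  obtain g where g: "dfun1 g" "\<And>w e. (\<forall>i\<in>?S. e i \<sqsubseteq> w) \<Longrightarrow> f e \<sqsubseteq> g w"
    using dtm_bounded[OF f finite_fm_vars fd] by blast
  let ?G = "\<lambda>x. f (\<lambda>n. e n x)"
  have GF: "Fun L ?G" by (rule Fun_comp[OF f finite_fm_vars fd]) (rule NN_Fun[OF eU])
  have de: "dtm (e n)" for n by (rule Fun_dtm[OF NN_Fun[OF eU]])
  obtain "is" where set_is: "set is = ?S" using finite_list[OF finite_fm_vars] by blast
  have "ev (\<lambda>x. \<forall>n\<in>set is. e n x \<sqsubseteq> H n x)"
    by (rule ev_Ball_list) (simp_all add: H(2) dfn_leq de Fun_dtm[OF H(1)])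
  then have "ev (\<lambda>x. ?G x \<sqsubseteq> g (W x))"
  proof (rule ev_mono)
    show "dfn (\<lambda>x. \<forall>n\<in>set is. e n x \<sqsubseteq> H n x)"
      by (rule dfn_Ball_list) (simp add: dfn_leq de Fun_dtm[OF H(1)])
    show "dfn (\<lambda>x. ?G x \<sqsubseteq> g (W x))"
      by (rule dfn_leq[OF Fun_dtm[OF GF] dfun1D[OF g(1) Fun_dtm[OF W(1)]]])
    fix x assume *: "\<forall>n\<in>set is. e n x \<sqsubseteq> H n x"
    show "?G x \<sqsubseteq> g (W x)" by (rule g(2)) (use * set_is W(2) ord.order_trans in blast)
  qed
  then have "ev (\<lambda>x. repr L ?G x \<sqsubseteq> g (W x))"
    by (rule ev_imp[where Q = "\<lambda>x. ?G x = repr L ?G x"])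
      (use repr(2)[OF GF] in \<open>simp_all add: eqv_def dfn_leq dfn_eq Fun_dtm[OF GF]
        Fun_dtm[OF repr(1)[OF GF]] dfun1D[OF g(1) Fun_dtm[OF W(1)]]\<close>)
  moreover have "Fun (L \<inter> {..<y}) (\<lambda>x. g (W x))" by (rule Fun_dfun1[OF g(1) W(1)])
  ultimately have "repr L ?G \<in> below_cut L y" unfolding below_cut_def using GF by auto
  moreover have "fm_sat (NN L) (case_nat (repr L ?G) e) \<phi>"
  proof -
    obtain a where a: "a \<in> universe (NN L)" "fm_sat (NN L) (case_nat a e) \<phi>" using ex by blast
    obtain k where k: "fm_vars \<phi> \<subseteq> {..<k}"
      using finite_fm_vars[of \<phi>] finite_nat_iff_bounded by blast
    have sat: "fm_sat (NN L) (case_nat (repr L b) e) \<phi> \<longleftrightarrow> ev (\<lambda>x. fm_sat M (case_nat (b x) (\<lambda>n. e n x)) \<phi>)"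
      if b: "Fun L b" for b
    proof -
      have F: "Fun L (case_nat b e n)" for n using b NN_Fun[OF eU] by (cases n) simp_all
      have "fm_sat (NN L) (case_nat (repr L b) e) \<phi> \<longleftrightarrow> ev (\<lambda>x. fm_sat M (\<lambda>n. case_nat b e n x) \<phi>)"
      proof (rule los_repr[OF _ F _ \<phi> k])
        fix n
        show "case_nat (repr L b) e n = repr L (case_nat b e n)" using repr_idem[OF eU] by (cases n) simp_all
        then show "case_nat (repr L b) e n \<in> universe (NN L)" using F[of n] by simp
      qed
      moreover have "(\<lambda>n. case_nat b e n x) = case_nat (b x) (\<lambda>n. e n x)" for x
        by (rule ext) (simp split: nat.split)
      ultimately show ?thesis by simp
    qed
    have db: "dfn (\<lambda>x. fm_sat M (case_nat (b x) (\<lambda>n. e n x)) \<phi>)" if "dtm b" for b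
      by (rule dfn_fm_dtm[OF \<phi>]) (rule dtm_case_nat[OF that de])
    have "ev (\<lambda>x. fm_sat M (case_nat (a x) (\<lambda>n. e n x)) \<phi>)"
      using sat[OF NN_Fun[OF a(1)]] a(2) repr_idem[OF a(1)] by simp
    then have "ev (\<lambda>x. fm_sat M (case_nat (?G x) (\<lambda>n. e n x)) \<phi>)"
      by (rule ev_mono[OF _ db[OF Fun_dtm[OF NN_Fun[OF a(1)]]] db[OF Fun_dtm[OF GF]]]) (rule spec)
    then show ?thesis using sat[OF GF] by blast
  qed
  ultimately show "\<exists>a\<in>below_cut L y. fm_sat (NN L) (case_nat a e) \<phi>" by blast
qed

text \<open>Minimality of \<open>ult\<close> at the largest index \<open>m\<close> of the support:
  given the lower coordinates, \<open>F\<close> is either almost everywhere constant in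
  \<open>x m\<close>, and is then replaced by a function on the smaller support, or
  \<open>x m\<close> is bounded by a definable function of \<open>F\<close>. As \<open>ev\<close>
  decides definable properties, one alternative holds almost everywhere.\<close>

lemma elem_shape:
  fixes S :: "'i::linorder set"
  assumes "finite S" "dtm F" "depends_on S F"
  shows "(\<exists>v. eqv F (\<lambda>_. v)) \<or> (\<exists>j\<in>S. \<exists>F' h. dtm F' \<and> depends_on (S \<inter> {..j}) F' \<and> eqv F F' \<and>
    dfun1 h \<and> ev (\<lambda>x. x j \<sqsubseteq> h (F' x)))"
  using assms
proof (induction S arbitrary: F rule: finite_linorder_max_induct)
  case empty
  have "F = (\<lambda>_. F (\<lambda>_. 0))" by (rule ext, rule depends_onD[OF empty.prems(2)]) simp
  then show ?case using eqv_refl by metis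
next
  case (insert m S)
  note dF = insert.prems(1)
  have dT: "dtm (\<lambda>e. F ((\<lambda>i. e (g i))(m := e k)))" for g and k :: 'b
    using dtm_subst[OF dF, of "\<lambda>j e. ((\<lambda>i. e (g i))(m := e k)) j", OF dtm_upd[OF dtm_var dtm_var]] .
  obtain h where h: "dfun1 h" "\<And>e. (\<exists>v. ult (\<lambda>z. F (e(m := z)) = v)) \<or> ult (\<lambda>z. z \<sqsubseteq> h (F (e(m := z))))"
    using ult_function[of "\<lambda>z e. F (e(m := z))", OF dT] by blast
  let ?Q = "\<lambda>x. \<exists>v. ult (\<lambda>z. F (x(m := z)) = v)"
  have dU: "dfn (\<lambda>x. ult (\<lambda>z. F ((\<lambda>i. x (g i))(m := z)) = t x))" if "dtm t" for g and t :: "('b \<Rightarrow> nat) \<Rightarrow> nat"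
    by (rule dfn_ult, rule dfn_eq[OF dT dtm_lift[OF that]])
  have dQ: "dfn ?Q" by (rule dfn_ex, rule dU[OF dtm_var])
  show ?case
  proof (cases "ev ?Q")
    case True
    \<comment> \<open>The constant value of \<open>F\<close> in the coordinate \<open>m\<close>; its
      choice is definable because \<open>ult\<close> is.\<close>
    define F' where "F' x = mu (\<lambda>v. ult (\<lambda>z. F (x(m := z)) = v) \<or> \<not> ?Q x)" for x
    have ex: "\<exists>v. ult (\<lambda>z. F (x(m := z)) = v) \<or> \<not> ?Q x" for x by blast
    have dW: "dfn (\<lambda>x. ult (\<lambda>z. F ((\<lambda>i. x (Some i))(m := z)) = x None) \<or> \<not> ?Q (\<lambda>i. x (Some i)))"
      by (intro dfn_disj dfn_not dfn_subst[OF dQ voc_var] dU dtm_var)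
    have dF': "dtm F'" unfolding F'_def by (rule dtm_mu[OF dW ex])
    have upd: "F (x(m := z)) = F (x'(m := z))" if "\<forall>i\<in>S. x i = x' i" for x x' z
      by (rule depends_onD[OF insert.prems(2)]) (use that in auto)
    have dep: "depends_on S F'"
      unfolding depends_on_def
    proof (intro allI impI)
      fix x x' :: "'i \<Rightarrow> nat" assume "\<forall>i\<in>S. x i = x' i"
      then show "F' x = F' x'" unfolding F'_def using upd[of x x'] by simp
    qed
    have spec: "ult (\<lambda>z. F (x(m := z)) = F' x)" if Q: "?Q x" for x
    proof -
      have "dfn1 (\<lambda>v. ult (\<lambda>z. F (x(m := z)) = v) \<or> \<not> ?Q x)"
        unfolding dfn1_def
        using dfn_subst[OF dW, of "\<lambda>y z. case y of None \<Rightarrow> z 0 | Some i \<Rightarrow> x i", OF voc_option[OF voc_var voc_const]] by simp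
      from mu_holds[OF this] ex[of x] Q show ?thesis unfolding F'_def by blast
    qed
    have "depends_on (insert m S) (\<lambda>x. F x = F' x)"
      unfolding depends_on_def
    proof (intro allI impI)
      fix x x' :: "'i \<Rightarrow> nat" assume "\<forall>i\<in>insert m S. x i = x' i"
      then have "F x = F x'" "F' x = F' x'"
        using depends_onD[OF insert.prems(2), of x x'] depends_onD[OF dep, of x x'] by auto
      then show "F x = F' x \<longleftrightarrow> F x' = F' x'" by simp
    qed
    note top = ev_top(1)[OF insert.hyps(1) _ this]
    have "F' (x(m := z)) = F' x" for x z
      by (rule depends_onD[OF dep]) (use insert.hyps(2) in auto)
    moreover have "ev (\<lambda>x. ult (\<lambda>z. F (x(m := z)) = F' x))"
      by (rule ev_mono[OF True dQ]) (rule dU[OF dF', of "\<lambda>i. i"], rule spec)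
    ultimately have FF': "eqv F F'"
      unfolding eqv_def using top insert.hyps(2) by simp
    from insert.IH[OF dF' dep] show ?thesis
    proof
      assume "\<exists>v. eqv F' (\<lambda>_. v)"
      then show ?thesis using eqv_trans[OF dF dF' dtm_const FF'] by blast
    next
      assume "\<exists>j\<in>S. \<exists>F'' h. dtm F'' \<and> depends_on (S \<inter> {..j}) F'' \<and> eqv F' F'' \<and> dfun1 h \<and> ev (\<lambda>x. x j \<sqsubseteq> h (F'' x))"
      then obtain j F'' h' where j: "j \<in> S" "dtm F''" "depends_on (S \<inter> {..j}) F''" "eqv F' F''" "dfun1 h'"
        "ev (\<lambda>x. x j \<sqsubseteq> h' (F'' x))" by blast
      have "depends_on (insert m S \<inter> {..j}) F''" by (rule depends_on_mono[OF j(3)]) blast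
      then show ?thesis using j eqv_trans[OF dF dF' j(2) FF' j(4)] by blast
    qed
  next
    case False
    then have "ev (\<lambda>x. \<not> ?Q x)" using ev_not[OF dQ] by blast
    then have "ev (\<lambda>x. ult (\<lambda>z. z \<sqsubseteq> h (F (x(m := z)))))"
    proof (rule ev_mono)
      show "dfn (\<lambda>x. ult (\<lambda>z. z \<sqsubseteq> h (F (x(m := z)))))"
        by (rule dfn_ult, rule dfn_leq[OF dtm_var dfun1D[OF h(1) dT]])
    qed (use h(2) dfn_not[OF dQ] in blast)+
    moreover have "depends_on (insert m S) (\<lambda>x. x m \<sqsubseteq> h (F x))"
      unfolding depends_on_def
    proof (intro allI impI)
      fix x x' :: "'i \<Rightarrow> nat" assume "\<forall>i\<in>insert m S. x i = x' i"
      then have "F x = F x'" "x m = x' m" using depends_onD[OF insert.prems(2), of x x'] by auto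
      then show "x m \<sqsubseteq> h (F x) \<longleftrightarrow> x' m \<sqsubseteq> h (F x')" by simp
    qed
    note ev_top(1)[OF insert.hyps(1) _ this]
    ultimately have "ev (\<lambda>x. x m \<sqsubseteq> h (F x))" using insert.hyps(2) by simp
    moreover have "insert m S \<inter> {..m} = insert m S" using insert.hyps(2) by (auto intro: less_imp_le)
    ultimately show ?thesis using dF insert.prems(2) h(1) eqv_refl by (intro disjI2 bexI[of _ m]) auto
  qed
qed

lemma const_in_cut:
  assumes "elem_cut V lt (NN L) J" "i \<in> L" "repr L (\<lambda>x. x i) \<in> J"
  shows "repr L (\<lambda>_. v) \<in> J"
proof -
  have "ev (\<lambda>x. v \<sqsubset> x i)" by (rule ev_below[of "{}"]) (auto simp: depends_on_def)
  then have "ev (\<lambda>x. v \<sqsubseteq> x i)" using ev_leq[OF dtm_const dtm_var] by blast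
  then show ?thesis by (rule cut_leq[OF assms(1) Fun_const Fun_var[OF assms(2)] assms(3)])
qed

text \<open>The index \<open>j\<close> is the top coordinate found by \<open>elem_shape\<close>:
  \<open>a\<close> is a definable function of generators up to \<open>c\<^sub>j\<close>, while
  \<open>c\<^sub>j\<close> lies below a definable function of \<open>a\<close>, and cuts containing
  \<open>M\<close> are closed under both. Lying above a generator excludes constants, as every
  generator exceeds all of \<open>M\<close>.\<close>

lemma cut_same_as_var:
  fixes L :: "'i::linorder set"
  assumes a: "a \<in> universe (NN L)" and i: "i \<in> L" "rinterp (NN L) lt [repr L (\<lambda>x. x i), a]"
  shows "\<exists>j\<in>L. \<forall>J. elem_cut V lt (NN L) J \<longrightarrow> (\<forall>v. repr L (\<lambda>_. v) \<in> J) \<longrightarrow> (a \<in> J \<longleftrightarrow> repr L (\<lambda>x. x j) \<in> J)"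
proof -
  have aF: "Fun L a" "repr L a = a" using NN_Fun[OF a] repr_idem[OF a] .
  obtain S where S: "S \<subseteq> L" "finite S" "depends_on S a" using Fun_support[OF aF(1)] by blast
  have "\<not> eqv a (\<lambda>_. v)" for v
  proof
    assume "eqv a (\<lambda>_. v)"
    then have ev1: "ev (\<lambda>x. a x = v)" unfolding eqv_def .
    have ev2: "ev (\<lambda>x. x i \<sqsubset> a x)" using NN_lt[OF Fun_var[OF i(1)] aF(1)] i(2) aF(2) by simp
    have ev3: "ev (\<lambda>x. x i \<sqsubset> v)"
      by (rule ev_imp[OF ev1 _ _ _ ev2]) (auto simp: dfn_eq dfn_lss Fun_dtm[OF aF(1)] dtm_const dtm_var)
    have ev4: "ev (\<lambda>x. v \<sqsubset> x i)" by (rule ev_below[of "{}"]) (auto simp: depends_on_def)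
    have "ev (\<lambda>x. x i \<noteq> x i)"
      by (rule ev_imp[OF ev3 _ _ _ ev4]) (auto simp: dfn_lss dtm_const dtm_var dfn_const dest: ord.less_asym)
    then show False by simp
  qed
  then obtain j F h where j: "j \<in> S" "dtm F" "depends_on (S \<inter> {..j}) F" "eqv a F" "dfun1 h" "ev (\<lambda>x. x j \<sqsubseteq> h (F x))"
    using elem_shape[OF S(2) Fun_dtm[OF aF(1)] S(3)] by blast
  have jL: "j \<in> L" using j(1) S(1) by blast
  have F: "Fun L F" unfolding Fun_def using j(2,3) S by (intro conjI exI[of _ "S \<inter> {..j}"]) auto
  have arep: "a = repr L F" using repr_eq_iff[OF aF(1) F] j(4) aF(2) by simp
  have "a \<in> J \<longleftrightarrow> repr L (\<lambda>x. x j) \<in> J"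
    if J: "elem_cut V lt (NN L) J" and const: "\<And>v. repr L (\<lambda>_. v) \<in> J" for J
  proof
    assume "a \<in> J"
    then have FJ: "repr L F \<in> J" using arep by simp
    have "repr L (\<lambda>x. h (F x)) \<in> J"
      using cut_closed[OF J const j(5)[unfolded dfun1_def], of "{0}" "\<lambda>_. F"] F FJ by (simp add: depends_on_def)
    then show "repr L (\<lambda>x. x j) \<in> J"
      by (rule cut_leq[OF J Fun_var[OF jL] Fun_dfun1[OF j(5) F] _ j(6)])
  next
    assume c: "repr L (\<lambda>x. x j) \<in> J"
    \<comment> \<open>\<open>cut_closed\<close> asks for every argument to lie in \<open>J\<close>,
      so coordinates outside the support are filled with the constant 0.\<close>
    define B where "B s = (if s \<in> S \<inter> {..j} then (\<lambda>x :: 'i \<Rightarrow> nat. x s) else (\<lambda>_. 0))" for s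
    have BF: "Fun L (B s)" for s unfolding B_def using S(1) Fun_var Fun_const by auto
    have "repr L (B s) \<in> J" for s
    proof (cases "s \<in> S \<inter> {..j}")
      case True
      have "s = j \<or> s < j" using True by auto
      then have "ev (\<lambda>x. x s \<sqsubseteq> x j)"
        using ev_leq[OF dtm_var dtm_var, of s j] ev_increasing[of s j] eqv_refl by blast
      moreover have "s \<in> L" using True S(1) by blast
      ultimately have "repr L (\<lambda>x. x s) \<in> J" using cut_leq[OF J Fun_var Fun_var[OF jL] c] by blast
      then show ?thesis using True unfolding B_def by (simp only: if_True)
    next
      case False
      then show ?thesis unfolding B_def using const by (simp only: if_False)
    qed
    then have "repr L (\<lambda>x. F (\<lambda>s. B s x)) \<in> J"
      by (intro cut_closed[OF J const j(2) _ j(3) BF] finite_Int disjI1[OF S(2)])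
    moreover have "(\<lambda>x. F (\<lambda>s. B s x)) = F"
      by (rule ext, rule depends_onD[OF j(3)]) (simp add: B_def)
    ultimately show "a \<in> J" using arep by simp
  qed
  then show ?thesis using jL by blast
qed

text \<open>For \<open>y\<close> beyond \<open>y0\<close>, the generator at \<open>g y\<close> lies
  in the same cuts above \<open>M\<close> as the image of the generator at \<open>y\<close>. For
  \<open>y < z\<close> the image of the cut below \<open>z\<close> contains the image of the
  generator at \<open>y\<close> but not that at \<open>z\<close>, so it separates \<open>g y\<close>
  from \<open>g z\<close> in the same order.\<close>

lemma not_isomorphic:
  fixes L :: "'i::linorder set" and L' :: "'j::linorder set"
  assumes ne: "L \<noteq> {}" and ne': "L' \<noteq> {}" and unb: "\<And>S. finite S \<Longrightarrow> S \<subseteq> L' \<Longrightarrow> \<exists>y\<in>L'. \<forall>s\<in>S. s < y"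
    and noemb: "\<And>y0 g. y0 \<in> L' \<Longrightarrow> g ` {y \<in> L'. y0 \<le> y} \<subseteq> L \<Longrightarrow> \<not> strict_mono_on {y \<in> L'. y0 \<le> y} g"
  shows "\<not> isomorphic V (NN L') (NN L)"
proof
  assume "isomorphic V (NN L') (NN L)"
  then obtain h where h: "iso_map V (NN L') (NN L) h" unfolding isomorphic_iff by blast
  let ?c = "\<lambda>i. repr L (\<lambda>x. x i)" and ?c' = "\<lambda>i. repr L' (\<lambda>x. x i)"
  have im: "h ` universe (NN L') = universe (NN L)"
    using iso_map_bij[OF h] by (simp only: bij_betw_def)
  have lt_iff: "rinterp (NN L') lt [a, b] \<longleftrightarrow> rinterp (NN L) lt [h a, h b]"
    if "a \<in> universe (NN L')" "b \<in> universe (NN L')" for a b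
  proof -
    have "set [a, b] \<subseteq> universe (NN L')" using that by auto
    then have "rinterp (NN L') lt [a, b] = rinterp (NN L) lt (map h [a, b])"
      using h lt_in unfolding iso_map_def by (metis length_Cons list.size(3) numeral_2_eq_2)
    then show ?thesis by (simp del: NN_simps)
  qed
  obtain i where i: "i \<in> L" using ne by blast
  have ciU: "?c i \<in> universe (NN L)" using Fun_var[OF i] by simp
  \<comment> \<open>The isomorphism may move \<open>M\<close>. Beyond the support of a preimage
    \<open>a\<close> of the generator \<open>?c i\<close>, images of generators lie above
    \<open>?c i\<close>, and a cut containing one of them contains all constants.\<close>
  obtain a where a: "a \<in> universe (NN L')" "h a = ?c i"
    using ciU[unfolded im[symmetric]] by (metis imageE)
  obtain S where S: "S \<subseteq> L'" "finite S" "depends_on S a" using Fun_support[OF NN_Fun[OF a(1)]] by blast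
  obtain y0 where y0: "y0 \<in> L'" "\<forall>s\<in>S. s < y0" using unb[OF S(2,1)] by blast
  let ?U = "{y \<in> L'. y0 \<le> y}"
  have cU: "?c' y \<in> universe (NN L')" if "y \<in> L'" for y using Fun_var[OF that] by simp
  have above: "rinterp (NN L) lt [?c i, h (?c' y)]" if y: "y \<in> ?U" for y
  proof -
    have "ev (\<lambda>x. a x \<sqsubset> x y)" by (rule ev_below[OF S(2) _ S(3)]) (use y y0(2) in auto)
    then have "rinterp (NN L') lt [a, ?c' y]"
      using NN_lt[OF NN_Fun[OF a(1)] Fun_var[of y L']] repr_idem[OF a(1)] y by simp
    then show ?thesis using lt_iff[OF a(1) cU] a(2) y by simp
  qed
  define same where "same y j \<longleftrightarrow> (\<forall>J. elem_cut V lt (NN L) J \<longrightarrow> (\<forall>v. repr L (\<lambda>_. v) \<in> J) \<longrightarrow>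
    (h (?c' y) \<in> J \<longleftrightarrow> ?c j \<in> J))" for y j
  have "\<forall>y\<in>?U. \<exists>j. j \<in> L \<and> same y j"
  proof
    fix y assume y: "y \<in> ?U"
    have "h (?c' y) \<in> universe (NN L)" unfolding im[symmetric] by (rule imageI[OF cU]) (use y in simp)
    then have "\<exists>j\<in>L. same y j" unfolding same_def by (rule cut_same_as_var[OF _ i above[OF y]])
    then show "\<exists>j. j \<in> L \<and> same y j" by blast
  qed
  from bchoice[OF this] obtain g where "\<forall>y\<in>?U. g y \<in> L \<and> same y (g y)" ..
  then have g: "\<And>y. y \<in> ?U \<Longrightarrow> g y \<in> L"
    "\<And>y J. y \<in> ?U \<Longrightarrow> elem_cut V lt (NN L) J \<Longrightarrow> (\<forall>v. repr L (\<lambda>_. v) \<in> J) \<Longrightarrow> h (?c' y) \<in> J \<longleftrightarrow> ?c (g y) \<in> J"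
    by (simp_all add: same_def)
  have "strict_mono_on ?U g"
  proof (rule strict_mono_onI)
    fix y z assume y: "y \<in> ?U" and z: "z \<in> ?U" and yz: "y < z"
    let ?J' = "below_cut L' z" and ?J = "h ` below_cut L' z"
    have J': "elem_cut V lt (NN L') ?J'" by (rule elem_cut_below[OF ne'])
    have J: "elem_cut V lt (NN L) ?J" by (rule iso_elem_cut[OF h NN_struct[OF ne'] lt_in J'])
    have yJ: "h (?c' y) \<in> ?J" by (rule imageI, rule var_below_cut) (use y yz in auto)
    have zJ: "h (?c' z) \<notin> ?J"
    proof
      assume "h (?c' z) \<in> ?J"
      then obtain b where b: "b \<in> ?J'" "h (?c' z) = h b" by blast
      have "?c' z = b"
        using inj_onD[OF bij_betw_imp_inj_on[OF iso_map_bij[OF h]] b(2) cU] z b(1) elem_cutD(1)[OF J'] by blast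
      then show False using b(1) var_not_below_cut[of z L'] z by blast
    qed
    have "?c i \<in> ?J" by (rule elem_cutD(2)[OF J ciU yJ above[OF y]])
    then have const: "\<forall>v. repr L (\<lambda>_. v) \<in> ?J" using const_in_cut[OF J i] by blast
    have "?c (g y) \<in> ?J" "?c (g z) \<notin> ?J" using g(2)[OF y J const] g(2)[OF z J const] yJ zJ by blast+
    moreover have "?c (g z) \<in> ?J" if "g z \<le> g y"
    proof (cases "g z = g y")
      case False
      then have "ev (\<lambda>x. x (g z) \<sqsubseteq> x (g y))"
        using ev_leq[OF dtm_var dtm_var, of "g z" "g y"] ev_increasing[of "g z" "g y"] that by simp
      then show ?thesis by (rule cut_leq[OF J Fun_var[OF g(1)[OF z]] Fun_var[OF g(1)[OF y]] \<open>?c (g y) \<in> ?J\<close>])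
    qed (use \<open>?c (g y) \<in> ?J\<close> in simp)
    ultimately show "g y < g z" by (meson not_less)
  qed
  then show False using noemb[OF y0(1), of g] g(1) by blast
qed

text \<open>Rank \<open>a\<close> corresponds to comparison modulo \<omega>^(f a). A move from
  \<open>a\<close> to a smaller \<open>b\<close> uses the exponent \<open>f b\<close>, which lies in
  both sets; the additional exponent \<open>t\<close> is above every level and is therefore seen in
  quotients only.\<close>

lemma delta_equiv_multisets:
  fixes \<delta> :: "'o rel" and f :: "'o \<Rightarrow> 'c::linorder"
  assumes f: "\<And>a b. (a, b) \<in> \<delta> - Id \<Longrightarrow> f a < f b" and t: "\<And>a. a \<in> Field \<delta> \<Longrightarrow> f a < t"
  defines "C \<equiv> f ` Field \<delta>"
  shows "delta_equiv TYPE('k) V \<delta> (NN {m. set_mset m \<subseteq> C}) (NN {m. set_mset m \<subseteq> insert t C})"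
proof (rule back_and_forth[where W = "\<lambda>a D p. a \<in> Field \<delta> \<and> part_iso C (insert t C) (f a) ((\<lambda>d. (d, p d)) ` D)"])
  fix a D p assume W: "a \<in> Field \<delta> \<and> part_iso C (insert t C) (f a) ((\<lambda>d. (d, p d)) ` D)"
  then have \<pi>: "part_iso C (insert t C) (f a) ((\<lambda>d. (d, p d)) ` D)" by blast
  have "finite D"
  proof (rule finite_imageD)
    show "finite ((\<lambda>d. (d, p d)) ` D)" using \<pi> unfolding part_iso_def by blast
  qed (simp add: inj_on_def)
  moreover have "strict_mono_on D p"
    by (rule strict_mono_onI, rule part_iso_less[OF \<pi>]) auto
  ultimately show "finite D \<and> D \<subseteq> {m. set_mset m \<subseteq> C} \<and> p ` D \<subseteq> {m. set_mset m \<subseteq> insert t C} \<and> strict_mono_on D p"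
    using part_isoD(1,2)[OF \<pi>] by blast
next
  fix a b D p S
  assume W: "a \<in> Field \<delta> \<and> part_iso C (insert t C) (f a) ((\<lambda>d. (d, p d)) ` D)" and ba: "(b, a) \<in> \<delta> - Id"
    and S: "finite S" "S \<subseteq> {m. set_mset m \<subseteq> C}"
  let ?\<pi> = "(\<lambda>d. (d, p d)) ` D"
  have b: "b \<in> Field \<delta>" using ba by (auto intro: FieldI1)
  have "\<exists>\<pi>'. part_iso C (insert t C) (f b) \<pi>' \<and> ?\<pi> \<subseteq> \<pi>' \<and> S \<subseteq> fst ` \<pi>'"
    by (rule part_iso_extend[OF conjunct2[OF W] f[OF ba]]) (use S b in \<open>auto simp: C_def\<close>)
  then obtain \<pi>' where \<pi>': "part_iso C (insert t C) (f b) \<pi>'" "?\<pi> \<subseteq> \<pi>'" "S \<subseteq> fst ` \<pi>'" by blast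
  obtain p' where p': "\<pi>' = (\<lambda>x. (x, p' x)) ` (fst ` \<pi>')" using part_iso_fun[OF \<pi>'(1)] by blast
  have "d \<in> fst ` \<pi>' \<and> p' d = p d" if "d \<in> D" for d
  proof -
    have "(d, p d) \<in> (\<lambda>x. (x, p' x)) ` (fst ` \<pi>')" using \<pi>'(2) that p' by blast
    then show ?thesis by auto
  qed
  then show "\<exists>D' p'. (b \<in> Field \<delta> \<and> part_iso C (insert t C) (f b) ((\<lambda>d. (d, p' d)) ` D')) \<and>
      D \<subseteq> D' \<and> S \<subseteq> D' \<and> (\<forall>i\<in>D. p' i = p i)"
    using \<pi>'(1,3) b p' by (intro exI[of _ "fst ` \<pi>'"] exI[of _ p']) auto
next
  fix a b D p S
  assume W: "a \<in> Field \<delta> \<and> part_iso C (insert t C) (f a) ((\<lambda>d. (d, p d)) ` D)" and ba: "(b, a) \<in> \<delta> - Id"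
    and S: "finite S" "S \<subseteq> {m. set_mset m \<subseteq> insert t C}"
  let ?\<pi> = "(\<lambda>d. (d, p d)) ` D"
  have b: "b \<in> Field \<delta>" using ba by (auto intro: FieldI1)
  \<comment> \<open>The roles are exchanged: as \<open>f a < t\<close>, exponents of the larger set
    below \<open>f a\<close> lie in \<open>C\<close> as well.\<close>
  have "\<exists>\<pi>'. part_iso (insert t C) C (f b) \<pi>' \<and> ?\<pi>\<inverse> \<subseteq> \<pi>' \<and> S \<subseteq> fst ` \<pi>'"
    by (rule part_iso_extend[OF part_iso_converse[OF conjunct2[OF W]] f[OF ba]])
      (use S b less_asym[OF t] W in \<open>auto simp: C_def\<close>)
  then obtain \<pi>'' where \<pi>'': "part_iso (insert t C) C (f b) \<pi>''" "?\<pi>\<inverse> \<subseteq> \<pi>''" "S \<subseteq> fst ` \<pi>''" by blast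
  define \<pi>' where "\<pi>' = \<pi>''\<inverse>"
  have \<pi>': "part_iso C (insert t C) (f b) \<pi>'" "?\<pi> \<subseteq> \<pi>'"
    unfolding \<pi>'_def using part_iso_converse[OF \<pi>''(1)] \<pi>''(2) by auto
  have S': "S \<subseteq> snd ` \<pi>'" unfolding \<pi>'_def using \<pi>''(3) by force
  obtain p' where p': "\<pi>' = (\<lambda>x. (x, p' x)) ` (fst ` \<pi>')" using part_iso_fun[OF \<pi>'(1)] by blast
  have "d \<in> fst ` \<pi>' \<and> p' d = p d" if "d \<in> D" for d
  proof -
    have "(d, p d) \<in> (\<lambda>x. (x, p' x)) ` (fst ` \<pi>')" using \<pi>'(2) that p' by blast
    then show ?thesis by auto
  qed
  moreover have "snd ` \<pi>' = p' ` (fst ` \<pi>')" by (subst p') (simp add: image_image)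
  ultimately show "\<exists>D' p'. (b \<in> Field \<delta> \<and> part_iso C (insert t C) (f b) ((\<lambda>d. (d, p' d)) ` D')) \<and>
      D \<subseteq> D' \<and> S \<subseteq> p' ` D' \<and> (\<forall>i\<in>D. p' i = p i)"
    using \<pi>'(1) b p' S' by (intro exI[of _ "fst ` \<pi>'"] exI[of _ p']) auto
next
  fix a assume "a \<in> Field \<delta>"
  then show "\<exists>D p. a \<in> Field \<delta> \<and> part_iso C (insert t C) (f a) ((\<lambda>d. (d, p d)) ` D)"
    by (intro exI[of _ "{{#}}"] exI[of _ "\<lambda>_. {#}"]) (simp add: part_iso_def)
next
  show "{m. set_mset m \<subseteq> C} \<noteq> {}" "{m. set_mset m \<subseteq> insert t C} \<noteq> {}"
    by (metis (mono_tags) empty_iff empty_subsetI mem_Collect_eq set_mset_empty)+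
qed

lemma not_isomorphic_multisets:
  fixes C :: "'c::linorder set"
  assumes wf: "wf {(x, y). x \<in> C \<and> y \<in> C \<and> x < y}" and t: "\<And>c. c \<in> C \<Longrightarrow> c < t"
  shows "\<not> isomorphic V (NN {m. set_mset m \<subseteq> insert t C}) (NN {m. set_mset m \<subseteq> C})"
proof (rule not_isomorphic)
  have ne: "{m :: 'c multiset. set_mset m \<subseteq> D} \<noteq> {}" for D
    by (metis (mono_tags) empty_iff empty_subsetI mem_Collect_eq set_mset_empty)
  show "{m. set_mset m \<subseteq> C} \<noteq> {}" "{m. set_mset m \<subseteq> insert t C} \<noteq> {}" by (rule ne)+
next
  fix S assume S: "finite S" "S \<subseteq> {m. set_mset m \<subseteq> insert t C}"
  \<comment> \<open>\<omega>^t * n exceeds every element in which \<open>t\<close> occurs fewer than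
    n times.\<close>
  obtain n where n: "\<forall>s\<in>S. count s t < n"
    using finite_nat_set_iff_bounded[of "(\<lambda>s. count s t) ` S"] S(1) by auto
  have "s < replicate_mset n t" if "s \<in> S" for s
    by (rule less_replicate_mset) (use n S(2) less_imp_le[OF t] that in blast)+
  moreover have "replicate_mset n t \<in> {m. set_mset m \<subseteq> insert t C}" by auto
  ultimately show "\<exists>y\<in>{m. set_mset m \<subseteq> insert t C}. \<forall>s\<in>S. s < y" by blast
next
  fix y0 g assume "y0 \<in> {m. set_mset m \<subseteq> insert t C}"
    and "g ` {y \<in> {m. set_mset m \<subseteq> insert t C}. y0 \<le> y} \<subseteq> {m. set_mset m \<subseteq> C}"
  then show "\<not> strict_mono_on {y \<in> {m. set_mset m \<subseteq> insert t C}. y0 \<le> y} g"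
    using no_embedding[OF wf t, of y0 g] by simp
qed

end

section \<open>From the axioms to the construction\<close>

lemma model_order:
  assumes A: "is_model V T A" and linear: "proves_linear V lt T" and A3: "derives V T (no_largest_ax lt)"
  shows "x \<in> universe A \<Longrightarrow> \<not> rinterp A lt [x, x]"
    and "x \<in> universe A \<Longrightarrow> y \<in> universe A \<Longrightarrow> z \<in> universe A \<Longrightarrow>
      rinterp A lt [x, y] \<Longrightarrow> rinterp A lt [y, z] \<Longrightarrow> rinterp A lt [x, z]"
    and "x \<in> universe A \<Longrightarrow> y \<in> universe A \<Longrightarrow> rinterp A lt [x, y] \<or> x = y \<or> rinterp A lt [y, x]"
    and "x \<in> universe A \<Longrightarrow> \<exists>y\<in>universe A. rinterp A lt [x, y]"
proof -
  have "universe A \<noteq> {}" using A unfolding is_model_def is_struct_def by blast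
  then obtain e :: "nat \<Rightarrow> _" where e: "range e \<subseteq> universe A" using assignment_exists[of "universe A"] by auto
  note sat = model_derives[OF A _ e]
  have ax: "fm_sat A e (lin_irrefl_ax lt)" "fm_sat A e (lin_trans_ax lt)" "fm_sat A e (lin_total_ax lt)"
    "fm_sat A e (no_largest_ax lt)"
    using linear A3 sat unfolding proves_linear_def by blast+
  show irrefl: "x \<in> universe A \<Longrightarrow> \<not> rinterp A lt [x, x]" for x
    using ax(1) by (simp add: lin_irrefl_ax_def)
  have "fm_sat A e (lin_trans_ax lt) \<longleftrightarrow> (\<forall>x\<in>universe A. \<forall>y\<in>universe A. \<forall>z\<in>universe A.
      rinterp A lt [x, y] \<and> rinterp A lt [y, z] \<longrightarrow> rinterp A lt [x, z])"
    by (simp add: lin_trans_ax_def numeral_2_eq_2)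
  note trans = ax(2)[unfolded this]
  show "x \<in> universe A \<Longrightarrow> y \<in> universe A \<Longrightarrow> z \<in> universe A \<Longrightarrow>
      rinterp A lt [x, y] \<Longrightarrow> rinterp A lt [y, z] \<Longrightarrow> rinterp A lt [x, z]"
    using trans by blast
  show total: "x \<in> universe A \<Longrightarrow> y \<in> universe A \<Longrightarrow> rinterp A lt [x, y] \<or> x = y \<or> rinterp A lt [y, x]" for x y
    using ax(3) by (auto simp: lin_total_ax_def)
  show "x \<in> universe A \<Longrightarrow> \<exists>y\<in>universe A. rinterp A lt [x, y]"
    using ax(4) total by (fastforce simp: no_largest_ax_def)
qed

text \<open>Every assignment extends its own tail by its value at 0, so a leading quantifier can be
  stripped when all assignments are admissible.\<close>

lemma Alls_sat:
  assumes "universe M = UNIV"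
  shows "(\<And>e. fm_sat M e (Alls n \<psi>)) \<Longrightarrow> fm_sat M e \<psi>"
proof (induction n arbitrary: e)
  case (Suc n)
  have "fm_sat M e (Alls n \<psi>)" for e
  proof -
    have "fm_sat M (case_nat (e 0) (\<lambda>n. e (Suc n))) (Alls n \<psi>)" using Suc.prems assms by simp
    moreover have "case_nat (e 0) (\<lambda>n. e (Suc n)) = e" by (rule ext) (simp split: nat.split)
    ultimately show ?thesis by simp
  qed
  then show ?case by (rule Suc.IH)
qed simp

theorem theorem3:
  fixes V :: "('f, 'r) vocab" and lt :: 'r
    and T :: "('f, 'r) fm set"
    and \<delta> :: "'o rel"
  assumes "countable_vocab V"
    and "lt \<in> rels V" and "rarity V lt = 2"
    and "is_theory V T" and "consistent V T"
    and linear: "proves_linear V lt T"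
    and A1: "\<And>n \<phi>. fm_in V \<phi> \<Longrightarrow> fm_vars \<phi> \<subseteq> {..n} \<Longrightarrow> derives V T (wo_ax lt n \<phi>)"
    and A2: "derives V T (pred_ax lt)"
    and A3: "derives V T (no_largest_ax lt)"
    and "Well_order \<delta>" and "countable (Field \<delta>)"
  shows "\<exists>(A :: ('f, 'r, nat) fo_struct) (B :: ('f, 'r, nat) fo_struct).
    is_model V T A \<and> countable (universe A) \<and>
    is_model V T B \<and> countable (universe B) \<and>
    delta_equiv TYPE('k) V \<delta> A B \<and> \<not> isomorphic V A B"
proof -
  obtain A :: "('f, 'r, 'f tm) fo_struct" where A: "is_model V T A" "countable (universe A)"
    using model_existence[OF assms(1,4,5)] by blast
  note ord = model_order[OF A(1) linear A3]
  have ne: "universe A \<noteq> {}" using A(1) unfolding is_model_def is_struct_def by blast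
  \<comment> \<open>A finite linear order has a largest element; infinity then gives the bijection
    with the natural numbers.\<close>
  have inf: "infinite (universe A)"
  proof
    let ?R = "\<lambda>x y. rinterp A lt [x, y]"
    assume fin: "finite (universe A)"
    have "asymp_on (universe A) ?R" by (rule asymp_onI) (use ord(1,2) in blast)
    moreover have "transp_on (universe A) ?R" by (rule transp_onI) (use ord(2) in blast)
    ultimately obtain m where "m \<in> universe A" "\<forall>x\<in>universe A. x \<noteq> m \<longrightarrow> \<not> ?R m x"
      using Finite_Set.bex_max_element[OF fin _ _ ne] by blast
    then show False using ord(1,4) by metis
  qed
  define h where "h = to_nat_on (universe A)"
  have h: "bij_betw h (universe A) UNIV" unfolding h_def by (rule to_nat_on_infinite[OF A(2) inf])
  define M where "M = copy_struct h A"
  have UM: "universe M = UNIV" unfolding M_def using h by (simp add: bij_betw_def)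
  have M: "is_model V T M"
    unfolding M_def by (rule iso_is_model[OF iso_copy[OF bij_betw_imp_inj_on[OF h]] assms(4) A(1)])
  have M_sat: "fm_sat M e \<phi>" if "derives V T \<phi>" for \<phi> e
    by (rule model_derives[OF M that]) (simp add: UM)
  note Mord = model_order[OF M linear A3, unfolded UM, OF UNIV_I]
  interpret lnp_model V lt M
  proof
    show "countable_vocab V" "lt \<in> rels V" "rarity V lt = 2" by fact+
    show "is_struct V M" using M unfolding is_model_def by blast
    show "universe M = UNIV" by (rule UM)
    fix x y z
    show "\<not> rinterp M lt [x, x]" by (rule Mord(1))
    show "rinterp M lt [x, y] \<Longrightarrow> rinterp M lt [y, z] \<Longrightarrow> rinterp M lt [x, z]" using Mord(2) by blast
    show "rinterp M lt [x, y] \<or> x = y \<or> rinterp M lt [y, x]" using Mord(3) by blast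
    show "\<exists>y. rinterp M lt [x, y]" using Mord(4) by blast
    show "rinterp M lt [y, x] \<Longrightarrow> \<exists>y. rinterp M lt [y, x] \<and> \<not> (\<exists>z. rinterp M lt [y, z] \<and> rinterp M lt [z, x])"
      using M_sat[OF A2, of "\<lambda>_. x"] by (auto simp: pred_ax_def UM numeral_2_eq_2)
  next
    fix \<phi> x e assume \<phi>: "fm_in V \<phi>" "fm_sat M (case_nat x e) \<phi>"
    obtain n where n: "fm_vars \<phi> \<subseteq> {..n}"
      using finite_fm_vars[of \<phi>] finite_nat_iff_bounded_le by blast
    let ?\<sigma> = "case_nat (Var 0) (\<lambda>k. Var (k + 2)) :: nat \<Rightarrow> 'f tm"
    have least: "fm_sat M e (Imp (Exi \<phi>) (Exi (Con \<phi> (All (Imp (Lt lt 0 1) (Neg (fm_subst ?\<sigma> \<phi>)))))))"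
      by (rule Alls_sat[OF UM]) (rule M_sat[OF A1[OF \<phi>(1) n, unfolded wo_ax_def]])
    have "(\<lambda>n. tm_val M (case_nat y (case_nat x e)) (?\<sigma> n)) = case_nat y e" for x y
      by (rule ext) (simp split: nat.split)
    then have "fm_sat M (case_nat y (case_nat x e)) (fm_subst ?\<sigma> \<phi>) \<longleftrightarrow> fm_sat M (case_nat y e) \<phi>" for x y
      unfolding fm_sat_subst by (simp only:)
    with least show "\<exists>x. fm_sat M (case_nat x e) \<phi> \<and> (\<forall>y. rinterp M lt [y, x] \<longrightarrow> \<not> fm_sat M (case_nat y e) \<phi>)"
      using \<phi>(2) by (auto simp: UM simp del: add_2_eq_Suc')
  qed
  have wo: "wf (\<delta> - Id)" "trans \<delta>" "antisym \<delta>" "total_on (Field \<delta>) \<delta>"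
    using assms(10) by (auto simp: well_order_on_def linear_order_on_def partial_order_on_def preorder_on_def)
  have "\<exists>f :: 'o \<Rightarrow> real. (\<forall>x\<in>Field \<delta>. \<forall>y\<in>Field \<delta>. (x, y) \<in> \<delta> - Id \<longleftrightarrow> f x < f y) \<and> (\<forall>x. f x < 3)"
  proof (rule countable_linear_embedding[OF assms(11)])
    fix x y z assume xy: "(x, y) \<in> \<delta> - Id" and yz: "(y, z) \<in> \<delta> - Id"
    then show "(x, z) \<in> \<delta> - Id" using transD[OF wo(2)] antisymD[OF wo(3)] by blast
  next
    fix x y assume "x \<in> Field \<delta>" "y \<in> Field \<delta>"
    then show "(x, y) \<in> \<delta> - Id \<or> x = y \<or> (y, x) \<in> \<delta> - Id" using wo(4) by (auto simp: total_on_def)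
  qed simp
  then obtain f :: "'o \<Rightarrow> real" where f: "\<And>x y. x \<in> Field \<delta> \<Longrightarrow> y \<in> Field \<delta> \<Longrightarrow> (x, y) \<in> \<delta> - Id \<longleftrightarrow> f x < f y"
    "\<And>x. f x < 3" by blast
  define C where "C = f ` Field \<delta>"
  \<comment> \<open>Types \<omega>^\<delta> and \<omega>^(\<delta>+1): the exponent 3 lies above the
    image of \<open>f\<close>.\<close>
  let ?L = "{m. set_mset m \<subseteq> C}" and ?L' = "{m. set_mset m \<subseteq> insert 3 C}"
  have C: "countable C" "\<And>c. c \<in> C \<Longrightarrow> c < 3" unfolding C_def using assms(11) f(2) by auto
  have inj: "inj_on f (Field \<delta>)"
  proof (rule inj_onI)
    fix x y assume "x \<in> Field \<delta>" "y \<in> Field \<delta>" "f x = f y"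
    then show "x = y" using f(1)[of x y] f(1)[of y x] wo(4) by (auto simp: total_on_def)
  qed
  have wfC: "wf {(x, y). x \<in> C \<and> y \<in> C \<and> x < y}"
  proof (rule wf_subset[OF wf_inv_image[OF wo(1), of "inv_into (Field \<delta>) f"]], rule subsetI)
    fix p assume "p \<in> {(x, y). x \<in> C \<and> y \<in> C \<and> x < y}"
    then obtain a b where "p = (f a, f b)" "a \<in> Field \<delta>" "b \<in> Field \<delta>" "f a < f b" unfolding C_def by auto
    then show "p \<in> inv_image (\<delta> - Id) (inv_into (Field \<delta>) f)" using f(1)[of a b] inj by simp
  qed
  have ne_L: "{m :: real multiset. set_mset m \<subseteq> D} \<noteq> {}" for D
    by (metis (mono_tags) empty_iff empty_subsetI mem_Collect_eq set_mset_empty)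
  have deq: "delta_equiv TYPE('k) V \<delta> (NN ?L) (NN ?L')"
    unfolding C_def
  proof (rule delta_equiv_multisets)
    fix a b assume "(a, b) \<in> \<delta> - Id"
    then show "f a < f b" using f(1)[of a b] FieldI1[of a b \<delta>] FieldI2[of a b \<delta>] by blast
  qed (rule f(2))
  have niso: "\<not> isomorphic V (NN ?L') (NN ?L)" by (rule not_isomorphic_multisets[OF wfC C(2)])
  have cnt: "countable (universe (NN ?L))" "countable (universe (NN ?L'))"
    by (rule countable_NN[OF countable_multisets_over], simp add: C(1))+
  have mods: "is_model V T (NN ?L)" "is_model V T (NN ?L')"
    by (rule NN_model[OF ne_L assms(4) M])+
  have str: "is_struct V (NN ?L)" "is_struct V (NN ?L')" by (rule NN_struct[OF ne_L])+
  \<comment> \<open>The longer index order comes first, since isomorphisms are excluded in the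
    direction from \<open>NN ?L'\<close> to \<open>NN ?L\<close>.\<close>
  define A' where "A' = copy_struct (to_nat_on (universe (NN ?L'))) (NN ?L')"
  define B' where "B' = copy_struct (to_nat_on (universe (NN ?L))) (NN ?L)"
  have isoA: "iso_map V (NN ?L') A' (to_nat_on (universe (NN ?L')))"
    unfolding A'_def by (rule iso_copy[OF inj_on_to_nat_on[OF cnt(2)]])
  have isoB: "iso_map V (NN ?L) B' (to_nat_on (universe (NN ?L)))"
    unfolding B'_def by (rule iso_copy[OF inj_on_to_nat_on[OF cnt(1)]])
  have "delta_equiv TYPE('k) V \<delta> (NN ?L') (NN ?L)" using deq unfolding delta_equiv_def by blast
  then have "delta_equiv TYPE('k) V \<delta> A' B'" by (rule iso_delta_equiv[OF isoA str(2) isoB str(1)])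
  moreover have "\<not> isomorphic V A' B'" using iso_isomorphic[OF isoA str(2) isoB str(1)] niso by blast
  moreover have "is_model V T A'" "is_model V T B'"
    by (rule iso_is_model[OF isoA assms(4) mods(2)], rule iso_is_model[OF isoB assms(4) mods(1)])
  ultimately show ?thesis by (intro exI[of _ A'] exI[of _ B']) simp
qed

end
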